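(* Let $k\ge2$ be an integer, $\nu>0$, $T>0$, and let $(\theta,u)$ be a smooth, non-decaying solution to $(SQG_\nu)$ on $[0,T]$ with initial data $\theta_0,u_0\in C_b^k(\mathbb R^2)$. Then there exists $U_\infty\in C([0,T];\mathbb R^2)$ with $U_\infty(0)=0$ such that for every $N\in\mathbb Z$ (with $U_\infty$ independent of $N$), all $t\in[0,T]$ and all $x\in\mathbb R^2$, $$u(t,x)-u_0(x)=U_\infty(t)-\int_0^t\Big(S_N\nabla K\mathbin{*\cdot}(\theta u)-\nu\,S_N\Delta K*\theta\Big)(s,x)\,ds+(H_NK)*(\theta(t)-\theta_0)(x).$$ Moreover, there is a constant $C>0$, independent of $\nu$, $T$, $t$ and of the solution, such that for each $t\in[0,T]$, $$\|u(t)\|_{L^2_{ul}}\le C\big(\|u_0\|_{L^2_{ul}}+\|\theta_0\|_{L^\infty}+|U_\infty(t)|+\nu\big)\exp\big(Ct\|\theta_0\|_{L^\infty}\big).$$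
   Context: Notation on $\mathbb R^2$. Fixed radial $\chi,\varphi\in\mathcal S(\mathbb R^2)$ satisfy $\operatorname{supp}\widehat\chi\subset\{|\xi|\le 5/6\}$, $\operatorname{supp}\widehat\varphi\subset\{3/5\le|\xi|\le5/3\}$ and $\widehat\chi(\xi)+\sum_{j\ge0}\widehat\varphi(2^{-j}\xi)=1$ for all $\xi$. For $j\in\mathbb Z$, $\varphi_j(x)=2^{2j}\varphi(2^jx)$ and $\dot\Delta_jf=\varphi_j*f$. For $n\in\mathbb Z$, $\chi_n$ is defined by $\widehat{\chi_n}=1-\sum_{j\ge n}\widehat\varphi(2^{-j}\cdot)$, $S_nf=\chi_n*f$, and $H_n=\mathrm{Id}-S_n$. $\Phi(x)=\frac1{2\pi|x|}$ and $K=\nabla^\perp\Phi$ (as a distribution), $\nabla^\perp=(-\partial_2,\partial_1)$. For bounded $f$, $(H_NK)*f:=\sum_{j\ge N}(\dot\Delta_jK)*f$ in $\mathcal S'$. For a vector field $v=(v^1,v^2)$, $S_N\nabla K\mathbin{*\cdot}v:=\sum_{n=1}^2(\partial_nS_NK)*v^n$. $\|f\|_{L^2_{ul}}=\sup_{x\in\mathbb R^2}\big(\int_{|x-y|<1}|f(y)|^2dy\big)^{1/2}$. $C_b^k(\mathbb R^2)$ is the space of $k$-times differentiable functions with continuous, bounded derivatives up to order $k$. $(SQG_\nu)$: $\partial_t\theta+u\cdot\nabla\theta=\nu\Delta\theta$; $\dot\Delta_ju=(\dot\Delta_jK)*\theta$ for all $j\in\mathbb Z$ (the homogeneous constitutive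 law); $\theta|_{t=0}=\theta_0$, $u|_{t=0}=u_0$. A smooth, non-decaying solution on $[0,T]$ with initial data $(\theta_0,u_0)\in C_b^k\times C_b^k$, where $(\theta_0,u_0)$ satisfies the homogeneous constitutive law and $\operatorname{div}u_0=0$, is a classical solution $(\theta,u)\in C^1((0,T];C_b^k(\mathbb R^2))\times C((0,T];C_b^k(\mathbb R^2))$ of $(SQG_\nu)$ such that the homogeneous constitutive law and $\operatorname{div}u=0$ hold on $(0,T]\times\mathbb R^2$, $\|\theta(t)\|_{L^\infty}\le\|\theta_0\|_{L^\infty}$ for all $t\in[0,T]$, and $\theta,u$ (with values $\theta_0,u_0$ at $t=0$) are bounded and continuous on $[0,T]\times\mathbb R^2$. *)

theory Defs
  imports "HOL-Analysis.Analysis" "HOL-Probability.Essential_Supremum"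
begin

section \<open>Differential operators and function spaces on the plane\<close>

definition pd :: "2 \<Rightarrow> (real^2 \<Rightarrow> 'b::real_normed_vector) \<Rightarrow> real^2 \<Rightarrow> 'b" where
  "pd i f x = vector_derivative (\<lambda>h. f (x + h *\<^sub>R axis i 1)) (at 0)"

text \<open>Iterated partial derivatives: a multi-index of order \<open>m\<close> is encoded by a list of \<open>m\<close>
  coordinate directions.\<close>

fun pds :: "2 list \<Rightarrow> (real^2 \<Rightarrow> 'b::real_normed_vector) \<Rightarrow> real^2 \<Rightarrow> 'b" where
  "pds [] f = f"
| "pds (i # is) f = pd i (pds is f)"

definition grad_perp :: "(real^2 \<Rightarrow> real) \<Rightarrow> real^2 \<Rightarrow> real^2" where
  "grad_perp f x = vector [- pd 2 f x, pd 1 f x]"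

definition divergence :: "(real^2 \<Rightarrow> real^2) \<Rightarrow> real^2 \<Rightarrow> real" where
  "divergence v x = (\<Sum>i\<in>UNIV. pd i (\<lambda>y. v y $ i) x)"

definition laplacian :: "(real^2 \<Rightarrow> real) \<Rightarrow> real^2 \<Rightarrow> real" where
  "laplacian f x = (\<Sum>i\<in>UNIV. pd i (pd i f) x)"

definition schwartz :: "(real^2 \<Rightarrow> real) \<Rightarrow> bool" where
  "schwartz f \<longleftrightarrow>
     (\<forall>is. pds is f differentiable_on UNIV \<and>
           (\<forall>m::nat. bounded (range (\<lambda>x. norm x ^ m * pds is f x))))"

definition Cb :: "nat \<Rightarrow> (real^2 \<Rightarrow> 'b::real_normed_vector) \<Rightarrow> bool" where
  "Cb k f \<longleftrightarrow>
     (\<forall>is. length is < k \<longrightarrow> pds is f differentiable_on UNIV) \<and>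
     (\<forall>is. length is \<le> k \<longrightarrow> continuous_on UNIV (pds is f) \<and> bounded (range (pds is f)))"

text \<open>Meaningful for \<^term>\<open>Cb k f\<close>, where all the suprema are finite. Mixed derivatives are
  counted once for each order of differentiation.\<close>

definition Cb_norm :: "nat \<Rightarrow> (real^2 \<Rightarrow> 'b::real_normed_vector) \<Rightarrow> real" where
  "Cb_norm k f = (\<Sum>is\<in>{is. length is \<le> k}. SUP x. norm (pds is f x))"

definition C0_Cb :: "nat \<Rightarrow> real set \<Rightarrow> (real \<Rightarrow> real^2 \<Rightarrow> 'b::real_normed_vector) \<Rightarrow> bool" where
  "C0_Cb k I w \<longleftrightarrow>
     (\<forall>t\<in>I. Cb k (w t) \<and> ((\<lambda>s. Cb_norm k (\<lambda>x. w s x - w t x)) \<longlongrightarrow> 0) (at t within I))"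

definition C1_Cb :: "nat \<Rightarrow> real set \<Rightarrow> (real \<Rightarrow> real^2 \<Rightarrow> 'b::real_normed_vector) \<Rightarrow> bool" where
  "C1_Cb k I w \<longleftrightarrow>
     (\<forall>t\<in>I. Cb k (w t)) \<and>
     (\<exists>w'. C0_Cb k I w' \<and>
        (\<forall>t\<in>I. ((\<lambda>s. Cb_norm k (\<lambda>x. (w s x - w t x) /\<^sub>R (s - t) - w' t x)) \<longlongrightarrow> 0)
                  (at t within I)))"

definition Linf_norm :: "(real^2 \<Rightarrow> 'b::real_normed_vector) \<Rightarrow> real" where
  "Linf_norm f = real_of_ereal (esssup lborel (\<lambda>x. ereal (norm (f x))))"

text \<open>Only used for bounded measurable functions, for which the supremum is finite.\<close>

definition L2ul_norm :: "(real^2 \<Rightarrow> 'b::real_normed_vector) \<Rightarrow> real" where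
  "L2ul_norm f = (SUP x. sqrt (LBINT y:ball x 1. (norm (f y))\<^sup>2))"

section \<open>Littlewood--Paley decomposition\<close>

definition fourier :: "(real^2 \<Rightarrow> real) \<Rightarrow> real^2 \<Rightarrow> complex" where
  "fourier f \<xi> = (LBINT x. cis (- (\<xi> \<bullet> x)) * complex_of_real (f x))"

definition radial :: "(real^2 \<Rightarrow> real) \<Rightarrow> bool" where
  "radial f \<longleftrightarrow> (\<forall>x y. norm x = norm y \<longrightarrow> f x = f y)"

text \<open>The last argument is the family of low-frequency kernels \<open>\<chi>\<^sub>n\<close>, which are prescribed through
  their Fourier transforms; injectivity of the Fourier transform on Schwartz functions makes each
  of them unique.\<close>

definition littlewood_paley ::
    "(real^2 \<Rightarrow> real) \<Rightarrow> (real^2 \<Rightarrow> real) \<Rightarrow> (int \<Rightarrow> real^2 \<Rightarrow> real) \<Rightarrow> bool" where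
  "littlewood_paley chi \<phi> chis \<longleftrightarrow>
     schwartz chi \<and> radial chi \<and> schwartz \<phi> \<and> radial \<phi> \<and>
     closure {\<xi>. fourier chi \<xi> \<noteq> 0} \<subseteq> {\<xi>. norm \<xi> \<le> 5/6} \<and>
     closure {\<xi>. fourier \<phi> \<xi> \<noteq> 0} \<subseteq> {\<xi>. 3/5 \<le> norm \<xi> \<and> norm \<xi> \<le> 5/3} \<and>
     (\<forall>\<xi>. (\<lambda>j::nat. fourier \<phi> (2 powi (- int j) *\<^sub>R \<xi>)) sums (1 - fourier chi \<xi>)) \<and>
     (\<forall>n. schwartz (chis n) \<and>
       (\<forall>\<xi>. (\<lambda>j::nat. fourier \<phi> (2 powi (- (n + int j)) *\<^sub>R \<xi>)) sums (1 - fourier (chis n) \<xi>)))"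

definition dilate :: "(real^2 \<Rightarrow> real) \<Rightarrow> int \<Rightarrow> real^2 \<Rightarrow> real" where
  "dilate \<phi> j x = 2 powi (2 * j) * \<phi> (2 powi j *\<^sub>R x)"

text \<open>Convolution \<open>F * g\<close> of a (scalar or vector valued) kernel with a scalar function.\<close>

definition conv ::
    "(real^2 \<Rightarrow> 'b::{banach,second_countable_topology}) \<Rightarrow> (real^2 \<Rightarrow> real) \<Rightarrow> real^2 \<Rightarrow> 'b" where
  "conv F g x = (LBINT y. g y *\<^sub>R F (x - y))"

text \<open>The homogeneous block \<open>\<phi>\<^sub>j * f\<close>; the function being localized may be vector valued.\<close>

definition LP_block ::
    "(real^2 \<Rightarrow> real) \<Rightarrow> int \<Rightarrow> (real^2 \<Rightarrow> 'b::{banach,second_countable_topology}) \<Rightarrow> real^2 \<Rightarrow> 'b" where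
  "LP_block \<phi> j f x = (LBINT y. dilate \<phi> j (x - y) *\<^sub>R f y)"

section \<open>The kernel of the constitutive law\<close>

text \<open>Distributions are represented by their action on (real-valued) test functions.\<close>

definition Phi :: "real^2 \<Rightarrow> real" where
  "Phi x = 1 / (2 * pi * norm x)"

definition K :: "(real^2 \<Rightarrow> real) \<Rightarrow> real^2" where
  "K \<psi> = - (LBINT y. Phi y *\<^sub>R grad_perp \<psi> y)"

definition laplacian_distr ::
    "((real^2 \<Rightarrow> real) \<Rightarrow> 'b) \<Rightarrow> (real^2 \<Rightarrow> real) \<Rightarrow> 'b" where
  "laplacian_distr D \<psi> = D (laplacian \<psi>)"

text \<open>The function \<open>\<psi> * D\<close> for a test function \<open>\<psi>\<close> and a distribution \<open>D\<close>.\<close>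

definition mollify :: "(real^2 \<Rightarrow> real) \<Rightarrow> ((real^2 \<Rightarrow> real) \<Rightarrow> 'b) \<Rightarrow> real^2 \<Rightarrow> 'b" where
  "mollify \<psi> D x = D (\<lambda>y. \<psi> (x - y))"

definition hom_law :: "(real^2 \<Rightarrow> real) \<Rightarrow> (real^2 \<Rightarrow> real) \<Rightarrow> (real^2 \<Rightarrow> real^2) \<Rightarrow> bool" where
  "hom_law \<phi> \<theta> u \<longleftrightarrow>
     (\<forall>j x. LP_block \<phi> j u x = conv (mollify (dilate \<phi> j) K) \<theta> x)"

text \<open>\<open>S\<^sub>N\<nabla>K *\<cdot> v\<close> and \<open>S\<^sub>N\<Delta>K * f\<close>, where \<open>chiN\<close> is the convolution kernel of \<open>S\<^sub>N\<close>.\<close>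

definition SN_gradK_conv ::
    "(real^2 \<Rightarrow> real) \<Rightarrow> (real^2 \<Rightarrow> real^2) \<Rightarrow> real^2 \<Rightarrow> real^2" where
  "SN_gradK_conv chiN v x = (\<Sum>n\<in>UNIV. conv (pd n (mollify chiN K)) (\<lambda>y. v y $ n) x)"

definition SN_lapK_conv ::
    "(real^2 \<Rightarrow> real) \<Rightarrow> (real^2 \<Rightarrow> real) \<Rightarrow> real^2 \<Rightarrow> real^2" where
  "SN_lapK_conv chiN f = conv (mollify chiN (laplacian_distr K)) f"

text \<open>\<open>(H\<^sub>NK) * f\<close> is a series in the space of tempered distributions. The predicate says that this
  series converges there and that its sum is the bounded continuous function \<open>g\<close>; such a \<open>g\<close> is
  unique, which gives a meaning to pointwise values of \<open>(H\<^sub>NK) * f\<close>.\<close>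

definition is_HN_conv ::
    "(real^2 \<Rightarrow> real) \<Rightarrow> int \<Rightarrow> (real^2 \<Rightarrow> real) \<Rightarrow> (real^2 \<Rightarrow> real^2) \<Rightarrow> bool" where
  "is_HN_conv \<phi> N f g \<longleftrightarrow>
     continuous_on UNIV g \<and> bounded (range g) \<and>
     (\<forall>\<psi>. schwartz \<psi> \<longrightarrow>
        (\<lambda>j::nat. LBINT y. \<psi> y *\<^sub>R conv (mollify (dilate \<phi> (N + int j)) K) f y)
          sums (LBINT y. \<psi> y *\<^sub>R g y))"

section \<open>Smooth, non-decaying solutions\<close>

definition smooth_nondecaying_solution ::
    "(real^2 \<Rightarrow> real) \<Rightarrow> nat \<Rightarrow> real \<Rightarrow> real \<Rightarrow> (real^2 \<Rightarrow> real) \<Rightarrow> (real^2 \<Rightarrow> real^2) \<Rightarrow>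
     (real \<Rightarrow> real^2 \<Rightarrow> real) \<Rightarrow> (real \<Rightarrow> real^2 \<Rightarrow> real^2) \<Rightarrow> bool" where
  "smooth_nondecaying_solution \<phi> k \<nu> T \<theta>0 u0 \<theta> u \<longleftrightarrow>
     Cb k \<theta>0 \<and> Cb k u0 \<and> hom_law \<phi> \<theta>0 u0 \<and> (\<forall>x. divergence u0 x = 0) \<and>
     \<theta> 0 = \<theta>0 \<and> u 0 = u0 \<and>
     C1_Cb k {0<..T} \<theta> \<and> C0_Cb k {0<..T} u \<and>
     (\<forall>t\<in>{0<..T}. \<forall>x.
        ((\<lambda>s. \<theta> s x) has_real_derivative
           \<nu> * laplacian (\<theta> t) x - (\<Sum>i\<in>UNIV. u t x $ i * pd i (\<theta> t) x))
          (at t within {0<..T})) \<and>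
     (\<forall>t\<in>{0<..T}. hom_law \<phi> (\<theta> t) (u t)) \<and>
     (\<forall>t\<in>{0<..T}. \<forall>x. divergence (u t) x = 0) \<and>
     (\<forall>t\<in>{0..T}. Linf_norm (\<theta> t) \<le> Linf_norm \<theta>0) \<and>
     continuous_on ({0..T} \<times> UNIV) (\<lambda>(t, x). \<theta> t x) \<and>
     bounded ((\<lambda>(t, x). \<theta> t x) ` ({0..T} \<times> UNIV)) \<and>
     continuous_on ({0..T} \<times> UNIV) (\<lambda>(t, x). u t x) \<and>
     bounded ((\<lambda>(t, x). u t x) ` ({0..T} \<times> UNIV))"

end

theory Submission
  imports Defs "HOL-Probability.Characteristic_Functions"
begin

text \<open>
  Let \<open>S\<^sub>n\<close> be convolution with \<open>chis n\<close>. Then \<open>S\<^sub>n\<^sub>+\<^sub>1 - S\<^sub>n\<close> is the block \<open>\<Delta>\<^sub>n\<close>, \<open>S\<^sub>n f\<close> tends to \<open>f\<close> as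
  \<open>n\<close> tends to infinity, and \<open>S\<^sub>n f\<close> flattens out as \<open>n\<close> tends to minus infinity. By the constitutive
  law \<open>(H\<^sub>N K) * (\<theta>(t) - \<theta>\<^sub>0)\<close> is therefore \<open>w - S\<^sub>N w\<close> with \<open>w = u(t) - u\<^sub>0\<close>, and the formula says
  that \<open>S\<^sub>N w\<close> plus the time integral depends neither on \<open>N\<close> nor on \<open>x\<close>. Passing from \<open>N\<close> to \<open>N + 1\<close>
  changes nothing: this is the transport equation tested against \<open>\<Delta>\<^sub>N K\<close>. Letting \<open>N\<close> tend to minus
  infinity then removes the dependence on \<open>x\<close>.

  The same argument works in a frame moving with velocity \<open>U\<^sub>\<infinity>\<close>, where the flux contains \<open>u - U\<^sub>\<infinity>\<close>
  instead of \<open>u\<close>. This is why the estimate involves \<open>U\<^sub>\<infinity>\<close> only at the final time. In that frame, with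
  \<open>N = 0\<close>, the low frequencies are controlled by integrable kernels, and the high frequencies
  \<open>(H\<^sub>0 K) * \<theta>\<close> by \<open>\<parallel>\<theta>\<parallel>\<^sub>\<infinity>\<close>: near the ball by a Plancherel inequality, far from it by the decay of the
  kernel. A bound \<open>m e\<^sup>\<lambda>\<^sup>t\<close> on \<open>u - U\<^sub>\<infinity>\<close> improves itself to \<open>(Q + m/2) e\<^sup>\<lambda>\<^sup>t\<close>, which replaces
  Gronwall's inequality and needs no measurability of the norm in time.
\<close>

section \<open>Affine changes of variables\<close>


text \<open>The exponent 3 in the decay of kernels shapes everything. \<open>Phi\<close> is of order
  1/|x|, so a potential is integrable only after cancellation: vanishing moments of order 0 and 1 of
  the density bring it down to order |x|^(-3). The blocks of K have this cancellation because
  \<open>\<phi>\<close> has mean zero, and S_N grad K and S_N Laplace K have it through their extra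
  derivatives. The low-pass kernels have mean one, so S_N K by itself gets no such bound and is
  never convolved with the solution; low frequencies of the velocity are reached through the
  transport equation only. Since K is homogeneous of degree -2, the L1 norms of S_N grad K and S_N
  Laplace K are 2^N and 4^N times those at N = 0, which makes the time integral vanish as N tends to
  minus infinity. The blocks of K have the same L1 norm at every frequency, so the high frequencies
  cannot be summed in L1; their truncated sums are instead bounded uniformly as Fourier multipliers.
  The moving frame is not circular: the velocity at infinity is defined in the frame at rest, and
  only afterwards shown to be the same in every frame, including the one that it drives
  itself.\<close>

lemma integrable_lborel_affine:
  fixes f :: "'a::euclidean_space \<Rightarrow> 'b::{banach,second_countable_topology}"
  assumes f: "integrable lborel f" and c: "c \<noteq> 0"
  shows "integrable lborel (\<lambda>x. f (t + c *\<^sub>R x))"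
proof -
  have [measurable]: "f \<in> borel_measurable borel" using f by auto
  have "integrable (density (distr lborel borel (\<lambda>x. t + c *\<^sub>R x)) (\<lambda>_. ennreal (\<bar>c\<bar> ^ DIM('a)))) f"
    using f c lborel_affine[of c t] by simp
  then have "integrable (distr lborel borel (\<lambda>x. t + c *\<^sub>R x)) (\<lambda>x. \<bar>c\<bar> ^ DIM('a) *\<^sub>R f x)"
    by (subst (asm) integrable_density) auto
  then have "integrable lborel (\<lambda>x. \<bar>c\<bar> ^ DIM('a) *\<^sub>R f (t + c *\<^sub>R x))"
    by (subst (asm) integrable_distr_eq) auto
  then have "integrable lborel (\<lambda>x. (1 / \<bar>c\<bar> ^ DIM('a)) *\<^sub>R (\<bar>c\<bar> ^ DIM('a) *\<^sub>R f (t + c *\<^sub>R x)))"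
    by - (rule integrable_scaleR_right)
  moreover have "(\<lambda>x. (1 / \<bar>c\<bar> ^ DIM('a)) *\<^sub>R (\<bar>c\<bar> ^ DIM('a) *\<^sub>R f (t + c *\<^sub>R x))) = (\<lambda>x. f (t + c *\<^sub>R x))"
    using c by simp
  ultimately show ?thesis by (simp only:)
qed

lemma integrable_lborel_affine_iff:
  fixes f :: "'a::euclidean_space \<Rightarrow> 'b::{banach,second_countable_topology}"
  assumes c: "c \<noteq> 0"
  shows "integrable lborel (\<lambda>x. f (t + c *\<^sub>R x)) \<longleftrightarrow> integrable lborel f"
proof
  assume "integrable lborel (\<lambda>x. f (t + c *\<^sub>R x))"
  from integrable_lborel_affine[OF this, of "1 / c" "- (t /\<^sub>R c)"] c
  show "integrable lborel f" by (simp add: algebra_simps divide_inverse_commute)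
qed (rule integrable_lborel_affine[OF _ c])

lemma integral_lborel_affine:
  fixes f :: "'a::euclidean_space \<Rightarrow> 'b::{banach,second_countable_topology}"
  assumes c: "c \<noteq> 0"
  shows "(LBINT x. f x) = \<bar>c\<bar> ^ DIM('a) *\<^sub>R (LBINT x. f (t + c *\<^sub>R x))"
proof (cases "integrable lborel f")
  case True
  then have [measurable]: "f \<in> borel_measurable borel" by auto
  have "(LBINT x. f x) = integral\<^sup>L (density (distr lborel borel (\<lambda>x. t + c *\<^sub>R x)) (\<lambda>_. ennreal (\<bar>c\<bar> ^ DIM('a)))) f"
    using c lborel_affine[of c t] by simp
  also have "\<dots> = integral\<^sup>L (distr lborel borel (\<lambda>x. t + c *\<^sub>R x)) (\<lambda>x. \<bar>c\<bar> ^ DIM('a) *\<^sub>R f x)"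
    by (subst integral_density) auto
  also have "\<dots> = (LBINT x. \<bar>c\<bar> ^ DIM('a) *\<^sub>R f (t + c *\<^sub>R x))"
    by (subst integral_distr) auto
  finally show ?thesis by simp
next
  \<comment> \<open>Neither side is integrable, so both integrals are the default value 0.\<close>
  case False
  then show ?thesis
    using integrable_lborel_affine_iff[OF c, of f t] by (simp add: not_integrable_integral_eq)
qed

lemma integral_lborel_reflect:
  fixes f :: "'a::euclidean_space \<Rightarrow> 'b::{banach,second_countable_topology}"
  shows "(LBINT y. f (x - y)) = (LBINT y. f y)"
  using integral_lborel_affine[of "-1" f x] by simp

lemma integrable_lborel_reflect:
  fixes f :: "'a::euclidean_space \<Rightarrow> 'b::{banach,second_countable_topology}"
  shows "integrable lborel (\<lambda>y. f (x - y)) \<longleftrightarrow> integrable lborel f"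
  using integrable_lborel_affine_iff[of "-1" f x] by simp

lemma integral_lborel_translate:
  fixes f :: "'a::euclidean_space \<Rightarrow> 'b::{banach,second_countable_topology}"
  shows "(LBINT y. f (y + x)) = (LBINT y. f y)"
  using integral_lborel_affine[of 1 f x] by (simp add: add.commute)

lemma integrable_lborel_translate:
  fixes f :: "'a::euclidean_space \<Rightarrow> 'b::{banach,second_countable_topology}"
  shows "integrable lborel (\<lambda>y. f (y + x)) \<longleftrightarrow> integrable lborel f"
  using integrable_lborel_affine_iff[of 1 f x] by (simp add: add.commute)

section \<open>Decaying kernels\<close>

lemma emeasure_ball_plane:
  assumes "0 \<le> r"
  shows "emeasure lborel (ball (x::real^2) r) = ennreal (pi * r\<^sup>2)"
  using emeasure_ball[of r x] assms unit_ball_vol_2 by (simp add: ennreal_mult')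

text \<open>Dyadic majorant: if k is least with |x| < 2^k, then 1 + |x| is at least 2^k / 2, so the
  k-th term of the series already dominates. The ball has area of order 4^k against the weight
  8^(-k), which leaves a geometric series.\<close>

lemma integrable_inverse_cube: "integrable lborel (\<lambda>x::real^2. 1 / (1 + norm x) ^ 3)"
proof (rule integrableI_bounded)
  have *: "ennreal (norm (1 / (1 + norm x) ^ 3)) \<le> (\<Sum>k. ennreal (8 / 8 ^ k) * indicator (ball 0 (2 ^ k)) x)" for x :: "real^2"
  proof -
    define k where "k = (LEAST k::nat. norm x < 2 ^ k)"
    have ex: "\<exists>k::nat. norm x < 2 ^ k" using real_arch_pow[of 2 "norm x"] by simp
    have k: "norm x < 2 ^ k" unfolding k_def by (rule LeastI_ex[OF ex])
    have "2 ^ k / 2 \<le> 1 + norm x"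
    proof (cases k)
      case 0 then show ?thesis by simp
    next
      case (Suc m)
      then have "\<not> norm x < 2 ^ m" using not_less_Least[of m "\<lambda>k. norm x < 2 ^ k"] k_def by simp
      then show ?thesis using Suc by simp
    qed
    then have "(2 ^ k / 2) ^ 3 \<le> (1 + norm x) ^ 3" by (intro power_mono) auto
    moreover have "(2 ^ k / 2) ^ 3 = (8 ^ k / 8 :: real)"
    proof -
      have "(2 ^ k) ^ 3 = ((2::real) ^ 3) ^ k"
        by (subst power_mult[symmetric], subst mult.commute, subst power_mult) simp
      then show ?thesis by (simp add: power_divide)
    qed
    ultimately have "1 / (1 + norm x) ^ 3 \<le> 8 / 8 ^ k"
      by (simp add: field_simps add_pos_nonneg zero_less_power)
    then have "ennreal (norm (1 / (1 + norm x) ^ 3)) \<le> ennreal (8 / 8 ^ k) * indicator (ball 0 (2 ^ k)) x"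
      using k by (auto intro!: ennreal_leI)
    also have "\<dots> \<le> (\<Sum>k. ennreal (8 / 8 ^ k) * indicator (ball 0 (2 ^ k)) x)"
      using sum_le_suminf[of "\<lambda>k. ennreal (8 / 8 ^ k) * indicator (ball 0 (2 ^ k)) x" "{k}"]
      by (simp only: sum.insert sum.empty finite.emptyI empty_iff add_0_right not_False_eq_True finite_insert) simp
    finally show ?thesis .
  qed
  have "(\<integral>\<^sup>+x. ennreal (norm (1 / (1 + norm x) ^ 3)) \<partial>(lborel::(real^2) measure))
      \<le> (\<integral>\<^sup>+x. (\<Sum>k. ennreal (8 / 8 ^ k) * indicator (ball 0 (2 ^ k)) x) \<partial>(lborel::(real^2) measure))"
    by (intro nn_integral_mono *)
  also have "\<dots> = (\<Sum>k. \<integral>\<^sup>+x. ennreal (8 / 8 ^ k) * indicator (ball 0 (2 ^ k)) x \<partial>(lborel::(real^2) measure))"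
    by (intro nn_integral_suminf borel_measurable_times_ennreal borel_measurable_const borel_measurable_indicator) simp
  also have "\<dots> = (\<Sum>k. ennreal (8 / 8 ^ k) * ennreal (pi * (2 ^ k)\<^sup>2))"
    by (intro suminf_cong) (simp add: nn_integral_cmult_indicator emeasure_ball_plane)
  also have "\<dots> = (\<Sum>k. ennreal (8 * pi * (1 / 2) ^ k))"
  proof (intro suminf_cong)
    fix k :: nat
    have "(2 ^ k)\<^sup>2 * (2::real) ^ k = 8 ^ k"
      by (simp add: power2_eq_square power_mult_distrib[symmetric])
    then have "8 / 8 ^ k * (pi * (2 ^ k)\<^sup>2) = 8 * pi * (1 / 2 :: real) ^ k"
      by (simp add: power_divide field_simps)
    then show "ennreal (8 / 8 ^ k) * ennreal (pi * (2 ^ k)\<^sup>2) = ennreal (8 * pi * (1 / 2) ^ k)"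
      by (subst ennreal_mult'[symmetric]) auto
  qed
  also have "\<dots> = ennreal (\<Sum>k. 8 * pi * (1 / 2) ^ k)"
    by (intro suminf_ennreal2) (auto intro!: summable_mult summable_geometric)
  also have "\<dots> < \<infinity>" by simp
  finally show "(\<integral>\<^sup>+x. ennreal (norm (1 / (1 + norm x) ^ 3)) \<partial>(lborel::(real^2) measure)) < \<infinity>" .
qed simp

text \<open>Cubic decay is integrable in dimension 2, is stable under bounded factors and bounded
  shifts, and is the rate that \<open>kernel_Riesz\<close> delivers. Rapid decay would be lost under
  the nonlocal operator.\<close>

definition kernel :: "(real^2 \<Rightarrow> 'b::real_normed_vector) \<Rightarrow> bool" where
  "kernel G \<longleftrightarrow> continuous_on UNIV G \<and> (\<exists>C. \<forall>x. norm (G x) \<le> C / (1 + norm x) ^ 3)"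

lemma kernelE:
  assumes "kernel G"
  obtains C where "C > 0" "\<And>x. norm (G x) \<le> C / (1 + norm x) ^ 3"
proof -
  obtain C where C: "\<And>x. norm (G x) \<le> C / (1 + norm x) ^ 3" using assms unfolding kernel_def by auto
  have "norm (G x) \<le> (\<bar>C\<bar> + 1) / (1 + norm x) ^ 3" for x
    using C[of x] by (rule order_trans) (auto intro!: divide_right_mono)
  with that[of "\<bar>C\<bar> + 1"] show ?thesis by auto
qed

lemma kernelI:
  assumes "continuous_on UNIV G" "\<And>x. norm (G x) \<le> C / (1 + norm x) ^ 3"
  shows "kernel G"
  using assms unfolding kernel_def by auto

lemma kernel_continuous: "kernel G \<Longrightarrow> continuous_on A G"
  unfolding kernel_def using continuous_on_subset by blast

lemma kernel_measurable: "kernel G \<Longrightarrow> G \<in> borel_measurable borel"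
  by (intro borel_measurable_continuous_onI) (rule kernel_continuous)

lemma kernel_integrable:
  fixes G :: "real^2 \<Rightarrow> 'b::{banach,second_countable_topology}"
  assumes "kernel G" shows "integrable lborel G"
proof -
  obtain C where C: "C > 0" "\<And>x. norm (G x) \<le> C / (1 + norm x) ^ 3" using kernelE[OF assms] by blast
  show ?thesis
  proof (rule Bochner_Integration.integrable_bound)
    show "integrable lborel (\<lambda>x::real^2. C * (1 / (1 + norm x) ^ 3))"
      by (intro integrable_mult_right integrable_inverse_cube)
    show "G \<in> borel_measurable lborel" using kernel_measurable[OF assms] by simp
    show "AE x in lborel. norm (G x) \<le> norm (C * (1 / (1 + norm x) ^ 3))"
      using C by (auto intro!: AE_I2)
  qed
qed

lemma kernel_bounded_mult:
  fixes G :: "real^2 \<Rightarrow> 'b::real_normed_vector"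
  assumes "kernel G" "continuous_on UNIV f" "\<And>x. \<bar>f x\<bar> \<le> B"
  shows "kernel (\<lambda>x. f x *\<^sub>R G x)"
proof -
  obtain C where C: "C > 0" "\<And>x. norm (G x) \<le> C / (1 + norm x) ^ 3" using kernelE[OF assms(1)] by blast
  have "norm (f x *\<^sub>R G x) \<le> (B * C) / (1 + norm x) ^ 3" for x
    using mult_mono[OF assms(3)[of x] C(2)[of x]] assms(3)[of x] by simp
  then show ?thesis
    by (rule kernelI[rotated]) (intro continuous_intros assms kernel_continuous)
qed

lemma kernel_add:
  assumes "kernel F" "kernel G" shows "kernel (\<lambda>x. F x + G x)"
proof -
  obtain C where C: "C > 0" "\<And>x. norm (F x) \<le> C / (1 + norm x) ^ 3" using kernelE[OF assms(1)] by blast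
  obtain D where D: "D > 0" "\<And>x. norm (G x) \<le> D / (1 + norm x) ^ 3" using kernelE[OF assms(2)] by blast
  have "norm (F x + G x) \<le> (C + D) / (1 + norm x) ^ 3" for x
    using C(2)[of x] D(2)[of x] norm_triangle_ineq[of "F x" "G x"] by (simp add: add_divide_distrib)
  then show ?thesis by (rule kernelI[rotated]) (intro continuous_intros assms kernel_continuous)
qed

lemma kernel_bounded_linear:
  assumes "bounded_linear L" "kernel F" shows "kernel (\<lambda>x. L (F x))"
proof -
  interpret bounded_linear L by fact
  obtain C where C: "C > 0" "\<And>x. norm (F x) \<le> C / (1 + norm x) ^ 3" using kernelE[OF assms(2)] by blast
  obtain B where B: "B > 0" "\<And>x. norm (L x) \<le> norm x * B" using pos_bounded by auto
  have "norm (L (F x)) \<le> (C * B) / (1 + norm x) ^ 3" for x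
    using order_trans[OF B(2) mult_right_mono[OF C(2)[of x], of B]] B(1) by simp
  then show ?thesis
    by (rule kernelI[rotated]) (intro continuous_on assms kernel_continuous)
qed

lemma kernel_0: "kernel (\<lambda>x. 0)" by (rule kernelI[of _ 0]) auto

lemma kernel_sum: "(\<And>i. i \<in> I \<Longrightarrow> kernel (F i)) \<Longrightarrow> kernel (\<lambda>x. \<Sum>i\<in>I. F i x)"
  by (induction I rule: infinite_finite_induct) (auto intro: kernel_0 kernel_add)

lemma kernel_mult_left: fixes F :: "real^2 \<Rightarrow> real" shows "kernel F \<Longrightarrow> kernel (\<lambda>x. c * F x)"
  by (rule kernel_bounded_linear[OF bounded_linear_mult_right])

lemma kernel_scaleR_const: fixes F :: "real^2 \<Rightarrow> real" shows "kernel F \<Longrightarrow> kernel (\<lambda>x. F x *\<^sub>R v)"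
  by (rule kernel_bounded_linear[OF bounded_linear_scaleR_left])

lemma kernel_minus: "kernel F \<Longrightarrow> kernel (\<lambda>x. - F x)"
  by (rule kernel_bounded_linear[OF bounded_linear_minus[OF bounded_linear_ident]])

lemma kernel_diff: "kernel F \<Longrightarrow> kernel G \<Longrightarrow> kernel (\<lambda>x. F x - G x)"
  using kernel_add[OF _ kernel_minus] by fastforce

lemma one_plus_norm_shift: "1 + norm x \<le> (1 + norm (x + y)) * (1 + norm (y::'a::real_normed_vector))"
proof -
  have "norm x \<le> norm (x + y) + norm y" using norm_triangle_ineq4[of "x + y" y] by simp
  moreover have "0 \<le> norm (x + y) * norm y" by simp
  ultimately show ?thesis unfolding distrib_left distrib_right by linarith
qed

lemma decay_shift:
  fixes x y :: "real^2"
  assumes "C \<ge> 0" shows "C / (1 + norm (x + y)) ^ n \<le> C * (1 + norm y) ^ n / (1 + norm x) ^ n"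
proof -
  have "(1 + norm x) ^ n \<le> ((1 + norm (x + y)) * (1 + norm y)) ^ n"
    by (intro power_mono one_plus_norm_shift) simp
  then have "C * (1 + norm x) ^ n \<le> C * ((1 + norm (x + y)) ^ n * (1 + norm y) ^ n)"
    using assms by (intro mult_left_mono) (auto simp: power_mult_distrib)
  then show ?thesis
    by (simp add: field_simps add_pos_nonneg zero_less_power)
qed

section \<open>Partial derivatives along coordinate lines\<close>

text \<open>\<open>pd\<close> is a \<open>vector_derivative\<close> and hence an arbitrary value
  where no derivative exists. The relation also records existence, but only along coordinate lines;
  for Riesz potentials nothing more is proved.\<close>

definition has_pd :: "2 \<Rightarrow> (real^2 \<Rightarrow> 'b::real_normed_vector) \<Rightarrow> (real^2 \<Rightarrow> 'b) \<Rightarrow> bool" where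
  "has_pd n f f' \<longleftrightarrow> (\<forall>x. ((\<lambda>h. f (x + h *\<^sub>R axis n 1)) has_vector_derivative f' x) (at 0))"

lemma has_pd_imp_pd: "has_pd n f f' \<Longrightarrow> pd n f = f'"
  unfolding has_pd_def pd_def by (auto intro: vector_derivative_at)

lemma differentiable_imp_has_pd:
  assumes "f differentiable_on UNIV" shows "has_pd n f (pd n f)"
  unfolding has_pd_def pd_def
proof (intro allI, subst vector_derivative_works[symmetric])
  fix x
  have "f differentiable at (x + 0 *\<^sub>R axis n 1)" using assms by (simp add: differentiable_on_def)
  moreover have "(\<lambda>h. x + h *\<^sub>R axis n 1) differentiable at (0::real)"
    by (intro derivative_intros)
  ultimately show "(\<lambda>h. f (x + h *\<^sub>R axis n 1)) differentiable at 0"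
    using differentiable_chain_at[of "\<lambda>h. x + h *\<^sub>R axis n 1" 0 f] by (simp add: o_def)
qed

lemma has_pd_line:
  assumes "has_pd n f f'"
  shows "((\<lambda>h. f (x + h *\<^sub>R axis n 1)) has_vector_derivative f' (x + s *\<^sub>R axis n 1)) (at s within S)"
proof -
  have "((\<lambda>h. f ((x + s *\<^sub>R axis n 1) + h *\<^sub>R axis n 1)) has_vector_derivative f' (x + s *\<^sub>R axis n 1)) (at ((\<lambda>h. h - s) s))"
    using assms unfolding has_pd_def by simp
  moreover have "((\<lambda>h. h - s) has_vector_derivative 1) (at s)" by (auto intro!: derivative_eq_intros)
  ultimately have "(((\<lambda>h. f ((x + s *\<^sub>R axis n 1) + h *\<^sub>R axis n 1)) \<circ> (\<lambda>h. h - s)) has_vector_derivative 1 *\<^sub>R f' (x + s *\<^sub>R axis n 1)) (at s)"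
    by (intro vector_diff_chain_at)
  then show ?thesis
    by (subst has_vector_derivative_at_within) (simp_all add: o_def add.assoc scaleR_left_distrib[symmetric])
qed

lemma has_pd_lipschitz:
  assumes "has_pd n f f'" "\<And>s. s \<in> closed_segment 0 h \<Longrightarrow> norm (f' (x + s *\<^sub>R axis n 1)) \<le> B"
  shows "norm (f (x + h *\<^sub>R axis n 1) - f x) \<le> B * \<bar>h\<bar>"
proof -
  have "norm (f (x + h *\<^sub>R axis n 1) - f (x + 0 *\<^sub>R axis n 1)) \<le> B * norm (h - 0)"
  proof (rule differentiable_bound[of "closed_segment 0 h" "\<lambda>h. f (x + h *\<^sub>R axis n 1)" "\<lambda>s t. t *\<^sub>R f' (x + s *\<^sub>R axis n 1)"])
    fix s assume s: "s \<in> closed_segment 0 h"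
    show "((\<lambda>h. f (x + h *\<^sub>R axis n 1)) has_derivative (\<lambda>t. t *\<^sub>R f' (x + s *\<^sub>R axis n 1))) (at s within closed_segment 0 h)"
      using has_pd_line[OF assms(1)] unfolding has_vector_derivative_def .
    show "onorm (\<lambda>t. t *\<^sub>R f' (x + s *\<^sub>R axis n 1)) \<le> B"
      using assms(2)[OF s] by (intro onorm_le) (simp add: mult.commute[of B] mult_left_mono)
  qed auto
  then show ?thesis by simp
qed

lemma has_pd_add: "has_pd n f f' \<Longrightarrow> has_pd n g g' \<Longrightarrow> has_pd n (\<lambda>x. f x + g x) (\<lambda>x. f' x + g' x)"
  unfolding has_pd_def by (auto intro!: derivative_intros)

lemma has_pd_diff: "has_pd n f f' \<Longrightarrow> has_pd n g g' \<Longrightarrow> has_pd n (\<lambda>x. f x - g x) (\<lambda>x. f' x - g' x)"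
  unfolding has_pd_def by (auto intro!: derivative_intros)

lemma has_pd_linear: "bounded_linear L \<Longrightarrow> has_pd n f f' \<Longrightarrow> has_pd n (\<lambda>x. L (f x)) (\<lambda>x. L (f' x))"
  unfolding has_pd_def using bounded_linear.has_vector_derivative by blast

lemma has_pd_const: "has_pd n (\<lambda>x. c) (\<lambda>x. 0)"
  unfolding has_pd_def by (auto intro!: derivative_intros)

lemma has_pd_sum: "(\<And>i. i \<in> I \<Longrightarrow> has_pd n (f i) (f' i)) \<Longrightarrow> has_pd n (\<lambda>x. \<Sum>i\<in>I. f i x) (\<lambda>x. \<Sum>i\<in>I. f' i x)"
  by (induction I rule: infinite_finite_induct) (auto intro: has_pd_const has_pd_add)

lemma has_pd_scaleR:
  assumes "has_pd n f f'" "has_pd n g g'"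
  shows "has_pd n (\<lambda>x. f x *\<^sub>R g x) (\<lambda>x. f x *\<^sub>R g' x + f' x *\<^sub>R g x)"
  unfolding has_pd_def
proof
  fix x
  have "((\<lambda>h. f (x + h *\<^sub>R axis n 1)) has_field_derivative f' x) (at 0)"
    using assms(1) unfolding has_pd_def has_real_derivative_iff_has_vector_derivative by simp
  from has_vector_derivative_scaleR[OF this, of "\<lambda>h. g (x + h *\<^sub>R axis n 1)" "g' x"] assms(2)
  show "((\<lambda>h. f (x + h *\<^sub>R axis n 1) *\<^sub>R g (x + h *\<^sub>R axis n 1)) has_vector_derivative f x *\<^sub>R g' x + f' x *\<^sub>R g x) (at 0)"
    unfolding has_pd_def by simp
qed

lemma has_pd_mult:
  fixes f g :: "real^2 \<Rightarrow> real"
  assumes "has_pd n f f'" "has_pd n g g'"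
  shows "has_pd n (\<lambda>x. f x * g x) (\<lambda>x. f x * g' x + f' x * g x)"
  using has_pd_scaleR[OF assms] by simp

lemma has_pd_affine:
  assumes "has_pd n f f'"
  shows "has_pd n (\<lambda>x. f (a + c *\<^sub>R x)) (\<lambda>x. c *\<^sub>R f' (a + c *\<^sub>R x))"
  unfolding has_pd_def
proof
  fix x
  have "((\<lambda>h. f ((a + c *\<^sub>R x) + h *\<^sub>R axis n 1)) has_vector_derivative f' (a + c *\<^sub>R x)) (at ((\<lambda>h. c * h) 0))"
    using assms unfolding has_pd_def by simp
  moreover have "((\<lambda>h. c * h) has_vector_derivative c) (at 0)" by (auto intro!: derivative_eq_intros)
  ultimately have "(((\<lambda>h. f ((a + c *\<^sub>R x) + h *\<^sub>R axis n 1)) \<circ> (\<lambda>h. c * h)) has_vector_derivative c *\<^sub>R f' (a + c *\<^sub>R x)) (at 0)"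
    by (intro vector_diff_chain_at)
  then show "((\<lambda>h. f (a + c *\<^sub>R (x + h *\<^sub>R axis n 1))) has_vector_derivative c *\<^sub>R f' (a + c *\<^sub>R x)) (at 0)"
    by (simp add: o_def algebra_simps)
qed

lemma has_pd_reflect:
  assumes "has_pd n f f'"
  shows "has_pd n (\<lambda>y. f (x - y)) (\<lambda>y. - f' (x - y))"
  using has_pd_affine[OF assms, of x "-1"] by simp

lemma has_pd_nth: "has_pd n (\<lambda>x. x $ i) (\<lambda>x. if i = n then 1 else 0)"
proof -
  have "((\<lambda>h. x $ i + h * (if i = n then 1 else 0)) has_vector_derivative (if i = n then 1 else 0)) (at 0)" for x :: "real^2"
    by (auto intro!: derivative_eq_intros)
  then show ?thesis unfolding has_pd_def by (simp add: axis_def)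
qed

lemma has_vector_derivative_quotient:
  fixes x e :: "'a::real_vector"
  assumes "((\<lambda>h. f (x + h *\<^sub>R e)) has_vector_derivative f') (at 0)"
  shows "((\<lambda>h. (f (x + h *\<^sub>R e) - f x) /\<^sub>R h) \<longlongrightarrow> f') (at 0)"
proof (rule Lim_transform_eventually)
  show "((\<lambda>h. (f (x + h *\<^sub>R e) - f x - h *\<^sub>R f') /\<^sub>R h + f') \<longlongrightarrow> f') (at 0)"
  proof -
    have "((\<lambda>h. norm ((f (x + h *\<^sub>R e) - f x - h *\<^sub>R f') /\<^sub>R h)) \<longlongrightarrow> 0) (at 0)"
      using assms by (simp add: has_vector_derivative_def has_derivative_at divide_inverse mult.commute)
    then have "((\<lambda>h. (f (x + h *\<^sub>R e) - f x - h *\<^sub>R f') /\<^sub>R h) \<longlongrightarrow> 0) (at 0)"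
      by (rule tendsto_norm_zero_cancel)
    from tendsto_add[OF this tendsto_const] show ?thesis by simp
  qed
  show "\<forall>\<^sub>F h in at 0. (f (x + h *\<^sub>R e) - f x - h *\<^sub>R f') /\<^sub>R h + f' = (f (x + h *\<^sub>R e) - f x) /\<^sub>R h"
    by (auto simp: eventually_at_filter scaleR_diff_right)
qed

text \<open>Translation invariance makes the integrals of all difference quotients vanish.\<close>

lemma integral_has_pd_eq_0:
  fixes H :: "real^2 \<Rightarrow> 'b::{banach,second_countable_topology}"
  assumes pd: "has_pd n H H'" and H: "kernel H" and H': "kernel H'"
  shows "(LBINT x. H' x) = 0"
proof -
  obtain C where C: "C > 0" "\<And>x. norm (H' x) \<le> C / (1 + norm x) ^ 3" using kernelE[OF H'] by blast
  define e :: "real^2" where "e = axis n 1"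
  have [simp]: "norm e = 1" by (simp add: e_def)
  define q where "q m x = (H (x + (1 / real (Suc m)) *\<^sub>R e) - H x) /\<^sub>R (1 / real (Suc m))" for m x
  have int: "integrable lborel (\<lambda>x. H (x + a))" for a
    using kernel_integrable[OF H] by (simp add: integrable_lborel_translate)
  have q0: "(LBINT x. q m x) = 0" for m
    unfolding q_def using int kernel_integrable[OF H]
    by (simp add: integral_lborel_translate)
  have "(\<lambda>m. LBINT x. q m x) \<longlonglongrightarrow> (LBINT x. H' x)"
  proof (rule integral_dominated_convergence[where w="\<lambda>x. (C * 8) * (1 / (1 + norm x) ^ 3)"])
    show "H' \<in> borel_measurable lborel" using kernel_measurable[OF H'] by simp
    show "q m \<in> borel_measurable lborel" for m
      unfolding q_def using borel_measurable_integrable[OF int] borel_measurable_integrable[OF kernel_integrable[OF H]] by (intro borel_measurable_scaleR borel_measurable_diff) auto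
    show "integrable lborel (\<lambda>x::real^2. (C * 8) * (1 / (1 + norm x) ^ 3))"
      by (intro integrable_mult_right integrable_inverse_cube)
    show "AE x in lborel. (\<lambda>m. q m x) \<longlonglongrightarrow> H' x"
    proof (rule AE_I2)
      fix x
      have "((\<lambda>h. H (x + h *\<^sub>R e)) has_vector_derivative H' x) (at 0)"
        using pd unfolding has_pd_def e_def by auto
      then have "((\<lambda>h. (H (x + h *\<^sub>R e) - H x) /\<^sub>R h) \<longlongrightarrow> H' x) (at 0)"
        by (rule has_vector_derivative_quotient)
      moreover have "filterlim (\<lambda>m. 1 / real (Suc m)) (at 0) sequentially"
        by (intro filterlim_atI) (use LIMSEQ_inverse_real_of_nat in \<open>auto simp: divide_inverse\<close>)
      ultimately show "(\<lambda>m. q m x) \<longlonglongrightarrow> H' x"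
        unfolding q_def by (rule filterlim_compose)
    qed
    \<comment> \<open>The increment is at most 1, so the mean value inequality sees the derivative
      only within distance 1 of \<open>x\<close>, where the decay constant grows by at most 2^3 =
      8.\<close>
    show "AE x in lborel. norm (q m x) \<le> (C * 8) * (1 / (1 + norm x) ^ 3)" for m
    proof (rule AE_I2)
      fix x
      let ?h = "1 / real (Suc m)"
      have "norm (H (x + ?h *\<^sub>R axis n 1) - H x) \<le> (C * 8 / (1 + norm x) ^ 3) * \<bar>?h\<bar>"
      proof (rule has_pd_lipschitz[OF pd])
        fix s assume "s \<in> closed_segment 0 ?h"
        then have s: "0 \<le> s" "s \<le> ?h" by (auto simp: closed_segment_eq_real_ivl)
        have "?h \<le> 1" by simp
        with s have "s \<le> 1" by linarith
        have "norm (H' (x + s *\<^sub>R axis n 1)) \<le> C * (1 + norm (s *\<^sub>R e)) ^ 3 / (1 + norm x) ^ 3"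
          using order_trans[OF C(2) decay_shift, of x "s *\<^sub>R e"] C(1) unfolding e_def by simp
        also have "\<dots> \<le> C * 8 / (1 + norm x) ^ 3"
        proof -
          have "(1 + norm (s *\<^sub>R e)) ^ 3 \<le> 2 ^ 3" using s \<open>s \<le> 1\<close> by (intro power_mono) auto
          then show ?thesis using C(1) by (intro divide_right_mono) auto
        qed
        finally show "norm (H' (x + s *\<^sub>R axis n 1)) \<le> C * 8 / (1 + norm x) ^ 3" .
      qed
      then have "norm (H (x + ?h *\<^sub>R e) - H x) \<le> (C * 8 * (1 / (1 + norm x) ^ 3)) * ?h"
        unfolding e_def by simp
      from mult_left_mono[OF this, of "real (Suc m)"]
      show "norm (q m x) \<le> (C * 8) * (1 / (1 + norm x) ^ 3)"
        unfolding q_def by simp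
    qed
  qed
  then have "(\<lambda>m::nat. 0) \<longlonglongrightarrow> (LBINT x. H' x)" by (simp only: q0)
  then show ?thesis by (rule LIMSEQ_unique[OF _ tendsto_const])
qed

text \<open>Only one factor has to decay: the other one is bounded together with its derivative, so
  the product is still a kernel and the integral of its derivative vanishes.\<close>

lemma integral_by_parts_pd:
  fixes G :: "real^2 \<Rightarrow> 'b::{banach,second_countable_topology}" and f :: "real^2 \<Rightarrow> real"
  assumes G: "has_pd n G G'" "kernel G" "kernel G'"
    and f: "has_pd n f f'" "continuous_on UNIV f" "continuous_on UNIV f'" "\<And>x. \<bar>f x\<bar> \<le> B" "\<And>x. \<bar>f' x\<bar> \<le> B'"
  shows "(LBINT x. f x *\<^sub>R G' x) = - (LBINT x. f' x *\<^sub>R G x)"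
proof -
  have k: "kernel (\<lambda>x. f x *\<^sub>R G x)" "kernel (\<lambda>x. f x *\<^sub>R G' x)" "kernel (\<lambda>x. f' x *\<^sub>R G x)"
    using kernel_bounded_mult G f by blast+
  have "(LBINT x. f x *\<^sub>R G' x + f' x *\<^sub>R G x) = 0"
    by (rule integral_has_pd_eq_0[OF has_pd_scaleR[OF f(1) G(1)] k(1) kernel_add[OF k(2,3)]])
  then show ?thesis
    using k by (simp add: kernel_integrable eq_neg_iff_add_eq_0)
qed


section \<open>Fourier analysis on the plane\<close>

definition gauss :: "real^2 \<Rightarrow> real" where
  "gauss x = exp (- (norm x)\<^sup>2 / 2)"

lemma gauss_pos: "0 < gauss x"
  by (simp add: gauss_def)

lemma continuous_on_gauss [continuous_intros]: "continuous_on S f \<Longrightarrow> continuous_on S (\<lambda>x. gauss (f x))"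
  unfolding gauss_def by (intro continuous_intros) auto

lemma measurable_cis [measurable]: "cis \<in> borel_measurable borel"
  by (intro borel_measurable_continuous_onI continuous_intros)

text \<open>Lebesgue measure is by definition the image of the product measure over the basis, so
  product integrands factor. This reduces the planar Gaussian integral to one dimension.\<close>

lemma lborel_prod_Basis:
  fixes f :: "'a::euclidean_space \<Rightarrow> real \<Rightarrow> 'b::{real_normed_field,banach,second_countable_topology}"
  assumes f: "\<And>b. b \<in> Basis \<Longrightarrow> integrable lborel (f b)"
  shows "integrable lborel (\<lambda>x. \<Prod>b\<in>Basis. f b (x \<bullet> b))" (is ?I)
    and "(LBINT x. (\<Prod>b\<in>Basis. f b (x \<bullet> b))) = (\<Prod>b\<in>Basis. LBINT t. f b t)" (is ?E)
proof -
  let ?M = "\<lambda>_::'a. lborel :: real measure"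
  interpret product_sigma_finite ?M by standard
  let ?g = "\<lambda>f::'a\<Rightarrow>real. \<Sum>b\<in>Basis. f b *\<^sub>R b"
  have eq: "(lborel::'a measure) = distr (Pi\<^sub>M Basis ?M) borel ?g"
    unfolding lborel_def[where 'a='a] lborel_eq_real ..
  have g: "?g \<in> measurable (Pi\<^sub>M Basis ?M) borel" by measurable
  have m: "(\<lambda>x. \<Prod>b\<in>Basis. f b (x \<bullet> b)) \<in> borel_measurable borel"
    using f by (intro borel_measurable_prod measurable_compose[OF _ borel_measurable_integrable[OF f]]) auto
  have *: "(\<Prod>b\<in>Basis. f b (?g h \<bullet> b)) = (\<Prod>b\<in>Basis. f b (h b))" for h
    by (intro prod.cong refl) simp
  show ?I
    unfolding eq by (subst integrable_distr_eq[OF g m]) (simp only: *, intro product_integrable_prod f finite_Basis)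
  show ?E
    unfolding eq integral_distr[OF g m] * by (rule product_integral_prod[OF finite_Basis f])
qed

text \<open>Up to the factor sqrt (2 pi) this is the characteristic function of the standard normal
  distribution.\<close>

lemma gauss_1d:
  "integrable lborel (\<lambda>x::real. cis (t * x) * complex_of_real (exp (- x\<^sup>2 / 2)))" (is ?I)
  "(LBINT x::real. cis (t * x) * complex_of_real (exp (- x\<^sup>2 / 2))) = complex_of_real (sqrt (2 * pi) * exp (- t\<^sup>2 / 2))" (is ?E)
proof -
  have i: "integrable lborel (\<lambda>x. sqrt (2 * pi) * std_normal_density x)"
    by (intro integrable_mult_right) (auto intro: integrable_normal_density)
  have e: "sqrt (2 * pi) * std_normal_density x = exp (- x\<^sup>2 / 2)" for x
    by (simp add: std_normal_density_def)
  show ?I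
    by (rule Bochner_Integration.integrable_bound[OF i]) (auto simp: e norm_mult)
  have "complex_of_real (exp (- t\<^sup>2 / 2)) = char std_normal_distribution t"
    by (simp add: char_std_normal_distribution)
  also have "\<dots> = (LBINT x. std_normal_density x *\<^sub>R iexp (t * x))"
    unfolding char_def by (subst integral_density) (auto simp: normal_density_nonneg)
  finally have "complex_of_real (sqrt (2 * pi)) * complex_of_real (exp (- t\<^sup>2 / 2)) =
     (LBINT x. complex_of_real (sqrt (2 * pi)) * (std_normal_density x *\<^sub>R iexp (t * x)))"
    by (simp only: integral_mult_right_zero)
  also have "\<dots> = (LBINT x::real. cis (t * x) * complex_of_real (exp (- x\<^sup>2 / 2)))"
    unfolding e[symmetric] by (intro Bochner_Integration.integral_cong refl) (simp add: cis_conv_exp scaleR_conv_of_real mult_ac)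
  finally show ?E by (simp add: mult_ac)
qed

lemma fourier_gauss:
  "integrable lborel (\<lambda>x. cis (\<xi> \<bullet> x) * complex_of_real (gauss x))" (is ?I)
  "(LBINT x. cis (\<xi> \<bullet> x) * complex_of_real (gauss x)) = complex_of_real (2 * pi * gauss \<xi>)" (is ?E)
proof -
  let ?f = "\<lambda>b x. cis ((\<xi> \<bullet> b) * x) * complex_of_real (exp (- x\<^sup>2 / 2))"
  have n: "(norm x)\<^sup>2 = (\<Sum>b\<in>Basis. (x \<bullet> b)\<^sup>2)" for x :: "real^2"
    unfolding power2_norm_eq_inner euclidean_inner[of x x] by (simp add: power2_eq_square)
  have *: "(\<Prod>b\<in>Basis. ?f b (x \<bullet> b)) = cis (\<xi> \<bullet> x) * complex_of_real (gauss x)" for x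
  proof -
    have "cis (\<xi> \<bullet> x) = (\<Prod>b\<in>Basis. cis ((\<xi> \<bullet> b) * (x \<bullet> b)))"
      by (simp add: cis_conv_exp euclidean_inner[of \<xi> x] sum_distrib_left exp_sum)
    moreover have "gauss x = (\<Prod>b\<in>Basis. exp (- (x \<bullet> b)\<^sup>2 / 2))"
      by (simp add: gauss_def n exp_sum[symmetric] sum_negf sum_divide_distrib)
    ultimately show ?thesis by (simp add: prod.distrib)
  qed
  show ?I using lborel_prod_Basis(1)[of ?f, OF gauss_1d(1)] by (simp only: *)
  have "(LBINT x. cis (\<xi> \<bullet> x) * complex_of_real (gauss x)) = (\<Prod>b\<in>(Basis::(real^2) set). complex_of_real (sqrt (2 * pi) * exp (- (\<xi> \<bullet> b)\<^sup>2 / 2)))"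
    using lborel_prod_Basis(2)[of ?f, OF gauss_1d(1)] by (simp only: * gauss_1d(2))
  also have "\<dots> = complex_of_real ((\<Prod>b\<in>(Basis::(real^2) set). sqrt (2 * pi)) * gauss \<xi>)"
    by (simp add: gauss_def n exp_sum[symmetric] sum_negf sum_divide_distrib prod.distrib of_real_prod[symmetric] del: of_real_mult of_real_prod prod_constant)
  finally show ?E by simp
qed

lemma integrable_gauss: "integrable lborel gauss"
  using integrable_norm[OF fourier_gauss(1)[of 0]] gauss_pos[THEN less_imp_le] by (simp add: norm_mult)

lemma integral_gauss: "(LBINT x. gauss x) = 2 * pi"
proof -
  have "complex_of_real (LBINT x. gauss x) = complex_of_real (2 * pi)"
    using fourier_gauss(2)[of 0] by (simp add: gauss_def)
  then show ?thesis by (simp only: of_real_eq_iff)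
qed

lemma fourier_gauss_scaled:
  assumes "c > 0"
  shows "integrable lborel (\<lambda>\<xi>. cis (\<xi> \<bullet> z) * complex_of_real (gauss ((1 / c) *\<^sub>R \<xi>)))" (is ?I)
    and "(LBINT \<xi>. cis (\<xi> \<bullet> z) * complex_of_real (gauss ((1 / c) *\<^sub>R \<xi>))) = complex_of_real ((2 * pi) * (c\<^sup>2 * gauss (c *\<^sub>R z)))" (is ?E)
proof -
  let ?F = "\<lambda>\<xi>. cis (\<xi> \<bullet> z) * complex_of_real (gauss ((1 / c) *\<^sub>R \<xi>))"
  have *: "?F (0 + c *\<^sub>R \<xi>) = cis ((c *\<^sub>R z) \<bullet> \<xi>) * complex_of_real (gauss \<xi>)" for \<xi>
    using assms by (simp add: inner_commute)
  show ?I
    using fourier_gauss(1)[of "c *\<^sub>R z"] integrable_lborel_affine_iff[of c ?F 0] assms unfolding * by auto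
  show ?E
    using fourier_gauss(2)[of "c *\<^sub>R z"] integral_lborel_affine[of c ?F 0] assms unfolding * by (auto simp: scaleR_conv_of_real)
qed

section \<open>Dilations and approximate identities\<close>

definition ngauss :: "real^2 \<Rightarrow> real" where "ngauss x = gauss x / (2 * pi)"

lemma ngauss_integrable: "integrable lborel ngauss" and integral_ngauss: "(LBINT x. ngauss x) = 1"
  and ngauss_nonneg: "0 \<le> ngauss x"
  unfolding ngauss_def using integrable_gauss integral_gauss gauss_pos[of x] by auto

lemma continuous_on_ngauss [continuous_intros]: "continuous_on S f \<Longrightarrow> continuous_on S (\<lambda>x. ngauss (f x))"
  unfolding ngauss_def by (intro continuous_intros) auto

lemma dilate_eq: "dilate F j x = (2 powi j)\<^sup>2 * F ((2 powi j) *\<^sub>R x)"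
  by (simp add: dilate_def power_int_mult mult.commute[of 2])

lemma integral_dilate: "(LBINT x. dilate F j x) = (LBINT x. F x)"
  using integral_lborel_affine[of "2 powi j" F 0] by (simp add: dilate_eq power_int_abs)

lemma integrable_dilate: "integrable lborel F \<Longrightarrow> integrable lborel (dilate F j)"
  unfolding dilate_eq using integrable_lborel_affine[of F "2 powi j" 0] by (intro integrable_mult_right) simp

lemma conv_dilate:
  fixes f :: "real^2 \<Rightarrow> 'b::{banach,second_countable_topology}"
  shows "(LBINT y. dilate F j (x - y) *\<^sub>R f y) = (LBINT z. F z *\<^sub>R f (x - (1 / (2 powi j)) *\<^sub>R z))"
  using integral_lborel_affine[of "- (1 / (2 powi j))" "\<lambda>y. dilate F j (x - y) *\<^sub>R f y" x]
  by (simp add: dilate_eq power_int_abs power_divide scaleR_scaleR[symmetric] del: scaleR_scaleR)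
   (simp add: divide_simps)

text \<open>After the substitution in \<open>conv_dilate\<close> the scale sits in the argument of
  \<open>f\<close>, where continuity gives the pointwise limit and boundedness the majorant.\<close>

lemma approx_identity:
  fixes f :: "real^2 \<Rightarrow> 'b::{banach,second_countable_topology}"
  assumes F: "integrable lborel F" and f: "continuous_on UNIV f" "\<And>x. norm (f x) \<le> B"
  shows "(\<lambda>m. LBINT y. dilate F (int m) (x - y) *\<^sub>R f y) \<longlonglongrightarrow> (LBINT y. F y) *\<^sub>R f x"
proof -
  have [measurable]: "f \<in> borel_measurable borel" "F \<in> borel_measurable borel"
    using f(1) F by (auto intro: borel_measurable_continuous_onI)
  have "(\<lambda>m. LBINT z. F z *\<^sub>R f (x - (1 / (2 powi (int m))) *\<^sub>R z)) \<longlonglongrightarrow> (LBINT z. F z *\<^sub>R f x)"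
  proof (rule integral_dominated_convergence[where w="\<lambda>z. norm (F z) * B"])
    show "integrable lborel (\<lambda>z. norm (F z) * B)" using F by (intro integrable_mult_left integrable_norm)
    show "AE z in lborel. (\<lambda>m. F z *\<^sub>R f (x - (1 / (2 powi (int m))) *\<^sub>R z)) \<longlonglongrightarrow> F z *\<^sub>R f x"
    proof (rule AE_I2)
      fix z :: "real^2"
      have "(\<lambda>m. (1 / 2) ^ m *\<^sub>R z) \<longlonglongrightarrow> 0 *\<^sub>R z"
        by (intro tendsto_scaleR tendsto_const LIMSEQ_power_zero) simp
      then have "(\<lambda>m. x - (1 / (2 powi (int m))) *\<^sub>R z) \<longlonglongrightarrow> x - 0 *\<^sub>R z"
        by (intro tendsto_diff tendsto_const) (simp add: power_divide)
      then have "(\<lambda>m. f (x - (1 / (2 powi (int m))) *\<^sub>R z)) \<longlonglongrightarrow> f x"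
        using f(1) by (intro continuous_on_tendsto_compose[of UNIV f]) auto
      then show "(\<lambda>m. F z *\<^sub>R f (x - (1 / (2 powi (int m))) *\<^sub>R z)) \<longlonglongrightarrow> F z *\<^sub>R f x"
        by (intro tendsto_scaleR tendsto_const)
    qed
    show "AE z in lborel. norm (F z *\<^sub>R f (x - (1 / (2 powi (int m))) *\<^sub>R z)) \<le> norm (F z) * B" for m
      using f(2) by (auto intro!: AE_I2 mult_left_mono)
  qed measurable
  then show ?thesis by (simp add: conv_dilate F)
qed

lemma integrable_pair_bound:
  fixes K :: "'a::euclidean_space \<times> 'c::euclidean_space \<Rightarrow> 'b::{banach,second_countable_topology}"
  assumes K: "K \<in> borel_measurable (lborel \<Otimes>\<^sub>M lborel)"
    and a: "integrable lborel a" and b: "integrable lborel b"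
    and le: "\<And>x y. norm (K (x, y)) \<le> a x * b y"
  shows "integrable (lborel \<Otimes>\<^sub>M lborel) K"
proof (rule Bochner_Integration.integrable_bound[OF _ K])
  have [measurable]: "a \<in> borel_measurable borel" "b \<in> borel_measurable borel" using a b by auto
  show "integrable (lborel \<Otimes>\<^sub>M lborel) (\<lambda>z. \<bar>a (fst z)\<bar> * \<bar>b (snd z)\<bar>)"
  proof (rule lborel_pair.Fubini_integrable)
    show "(\<lambda>z. \<bar>a (fst z)\<bar> * \<bar>b (snd z)\<bar>) \<in> borel_measurable (lborel \<Otimes>\<^sub>M lborel)" by measurable
    show "integrable lborel (\<lambda>x. LBINT y. norm (\<bar>a (fst (x, y))\<bar> * \<bar>b (snd (x, y))\<bar>))"
      using a by (simp add: abs_mult)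
    show "AE x in lborel. integrable lborel (\<lambda>y. \<bar>a (fst (x, y))\<bar> * \<bar>b (snd (x, y))\<bar>)"
      using b by simp
  qed
  show "AE z in lborel \<Otimes>\<^sub>M lborel. norm (K z) \<le> norm (\<bar>a (fst z)\<bar> * \<bar>b (snd z)\<bar>)"
  proof (rule AE_I2)
    fix z show "norm (K z) \<le> norm (\<bar>a (fst z)\<bar> * \<bar>b (snd z)\<bar>)"
      using le[of "fst z" "snd z"] by (simp add: abs_mult[symmetric])
  qed
qed

lemma Fubini_lborel:
  fixes K :: "'a::euclidean_space \<Rightarrow> 'c::euclidean_space \<Rightarrow> 'b::{banach,second_countable_topology}"
  assumes "integrable (lborel \<Otimes>\<^sub>M lborel) (\<lambda>(x, y). K x y)"
  shows "(LBINT y. LBINT x. K x y) = (LBINT x. LBINT y. K x y)"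
proof -
  show ?thesis by (rule lborel_pair.Fubini_integral[OF assms])
qed

lemma gauss_measurable [measurable]: "gauss \<in> borel_measurable borel"
  by (intro borel_measurable_continuous_onI continuous_intros)

lemma ngauss_measurable [measurable]: "ngauss \<in> borel_measurable borel"
  by (intro borel_measurable_continuous_onI continuous_intros)

section \<open>Inversion with a Gaussian cut-off, and injectivity\<close>

lemma norm_fourier_le:
  assumes "integrable lborel h" shows "norm (fourier h \<xi>) \<le> (LBINT x. \<bar>h x\<bar>)"
  unfolding fourier_def using integral_norm_bound[of lborel "\<lambda>x. cis (- (\<xi> \<bullet> x)) * complex_of_real (h x)"]
  by (simp add: norm_mult)

lemma integrable_fourier:
  assumes "integrable lborel h" shows "integrable lborel (\<lambda>x. cis (- (\<xi> \<bullet> x)) * complex_of_real (h x))"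
proof -
  have [measurable]: "h \<in> borel_measurable borel" using assms by auto
  show ?thesis
    by (rule Bochner_Integration.integrable_bound[OF assms]) (auto simp: norm_mult)
qed

lemma fourier_measurable:
  assumes "integrable lborel h" shows "fourier h \<in> borel_measurable borel"
proof -
  have [measurable]: "h \<in> borel_measurable borel" using assms by auto
  have "(\<lambda>\<xi>. LBINT x. cis (- (\<xi> \<bullet> x)) * complex_of_real (h x)) \<in> borel_measurable borel"
    by measurable
  then show ?thesis unfolding fourier_def[abs_def] .
qed

text \<open>The transform of an integrable function need not be integrable. The Gaussian factor
  makes Fubini applicable, and the inner integral is again a Gaussian, of width 2^(-j). One factor 2
  pi comes from its transform, the other from the normalisation of \<open>ngauss\<close>.\<close>

lemma fourier_inversion_gauss:
  assumes h: "integrable lborel h"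
  shows "(LBINT \<xi>. fourier h \<xi> * (cis (\<xi> \<bullet> z) * complex_of_real (gauss ((1 / 2 powi j) *\<^sub>R \<xi>)))) =
    complex_of_real ((2 * pi)\<^sup>2 * (LBINT y. dilate ngauss j (z - y) * h y))"
proof -
  let ?g = "\<lambda>\<xi>. gauss ((1 / 2 powi j) *\<^sub>R \<xi>)"
  have [measurable]: "h \<in> borel_measurable borel" using h by auto
  have int: "integrable (lborel \<Otimes>\<^sub>M lborel) (\<lambda>(\<xi>, x). cis (- (\<xi> \<bullet> x)) * complex_of_real (h x) * (cis (\<xi> \<bullet> z) * complex_of_real (?g \<xi>)))"
  proof (rule integrable_pair_bound)
    show "(\<lambda>(\<xi>, x). cis (- (\<xi> \<bullet> x)) * complex_of_real (h x) * (cis (\<xi> \<bullet> z) * complex_of_real (?g \<xi>))) \<in> borel_measurable (lborel \<Otimes>\<^sub>M lborel)"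
      by measurable
    show "integrable lborel ?g"
      using integrable_lborel_affine[OF integrable_gauss, of "1 / 2 powi j" 0] by simp
    show "integrable lborel (\<lambda>x. \<bar>h x\<bar>)" using h by simp
  qed (use gauss_pos[THEN less_imp_le] in \<open>auto simp: norm_mult mult.commute\<close>)
  have "(LBINT \<xi>. fourier h \<xi> * (cis (\<xi> \<bullet> z) * complex_of_real (?g \<xi>))) =
     (LBINT \<xi>. LBINT x. cis (- (\<xi> \<bullet> x)) * complex_of_real (h x) * (cis (\<xi> \<bullet> z) * complex_of_real (?g \<xi>)))"
    unfolding fourier_def by (simp only: integral_mult_left_zero)
  also have "\<dots> = (LBINT x. LBINT \<xi>. cis (- (\<xi> \<bullet> x)) * complex_of_real (h x) * (cis (\<xi> \<bullet> z) * complex_of_real (?g \<xi>)))"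
    by (rule Fubini_lborel[OF int, symmetric])
  also have "\<dots> = (LBINT x. complex_of_real ((2 * pi)\<^sup>2 * (dilate ngauss j (z - x) * h x)))"
  proof (rule Bochner_Integration.integral_cong[OF refl])
    fix x
    have "(LBINT \<xi>. cis (- (\<xi> \<bullet> x)) * complex_of_real (h x) * (cis (\<xi> \<bullet> z) * complex_of_real (?g \<xi>)))
       = (LBINT \<xi>. complex_of_real (h x) * (cis (\<xi> \<bullet> (z - x)) * complex_of_real (?g \<xi>)))"
    proof (intro Bochner_Integration.integral_cong refl)
      fix \<xi> show "cis (- (\<xi> \<bullet> x)) * complex_of_real (h x) * (cis (\<xi> \<bullet> z) * complex_of_real (?g \<xi>)) = complex_of_real (h x) * (cis (\<xi> \<bullet> (z - x)) * complex_of_real (?g \<xi>))"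
        using cis_mult[of "- (\<xi> \<bullet> x)" "\<xi> \<bullet> z"] by (simp add: inner_diff_right)
    qed
    also have "\<dots> = complex_of_real (h x) * complex_of_real ((2 * pi) * ((2 powi j)\<^sup>2 * gauss (2 powi j *\<^sub>R (z - x))))"
      using fourier_gauss_scaled(2)[of "2 powi j" "z - x"] by (subst integral_mult_right_zero) simp
    also have "\<dots> = complex_of_real ((2 * pi)\<^sup>2 * (dilate ngauss j (z - x) * h x))"
      by (simp add: dilate_eq ngauss_def power2_eq_square)
    finally show "(LBINT \<xi>. cis (- (\<xi> \<bullet> x)) * complex_of_real (h x) * (cis (\<xi> \<bullet> z) * complex_of_real (?g \<xi>))) = complex_of_real ((2 * pi)\<^sup>2 * (dilate ngauss j (z - x) * h x))" .
  qed
  also have "\<dots> = complex_of_real ((2 * pi)\<^sup>2 * (LBINT y. dilate ngauss j (z - y) * h y))"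
    by (simp only: integral_complex_of_real integral_mult_right_zero)
  finally show ?thesis .
qed

text \<open>Equal transforms have equal Gaussian mollifications at every scale, by the inversion
  formula; letting the scale shrink recovers the functions at each point.\<close>

lemma fourier_injective:
  assumes f: "integrable lborel f" "continuous_on UNIV f" "\<And>x. \<bar>f x\<bar> \<le> B"
    and g: "integrable lborel g" "continuous_on UNIV g" "\<And>x. \<bar>g x\<bar> \<le> B'"
    and eq: "\<And>\<xi>. fourier f \<xi> = fourier g \<xi>"
  shows "f = g"
proof
  fix z
  have e: "(LBINT y. dilate ngauss j (z - y) * f y) = (LBINT y. dilate ngauss j (z - y) * g y)" for j
  proof -
    have "complex_of_real ((2 * pi)\<^sup>2 * (LBINT y. dilate ngauss j (z - y) * f y)) = complex_of_real ((2 * pi)\<^sup>2 * (LBINT y. dilate ngauss j (z - y) * g y))"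
      unfolding fourier_inversion_gauss[OF f(1), symmetric] fourier_inversion_gauss[OF g(1), symmetric] eq ..
    then show ?thesis by (simp only: of_real_eq_iff mult_cancel_left) simp
  qed
  have "(\<lambda>m. LBINT y. dilate ngauss (int m) (z - y) * f y) \<longlonglongrightarrow> f z"
    using approx_identity[OF ngauss_integrable f(2), of B z] f(3) by (simp add: integral_ngauss)
  moreover have "(\<lambda>m. LBINT y. dilate ngauss (int m) (z - y) * g y) \<longlonglongrightarrow> g z"
    using approx_identity[OF ngauss_integrable g(2), of B' z] g(3) by (simp add: integral_ngauss)
  ultimately show "f z = g z" unfolding e by (rule LIMSEQ_unique)
qed


section \<open>Transforms of derivatives, dilates and convolutions\<close>

lemma fourier_Re_Im:
  assumes "integrable lborel f"
  shows "Re (fourier f \<xi>) = (LBINT x. cos (\<xi> \<bullet> x) *\<^sub>R f x)" "Im (fourier f \<xi>) = - (LBINT x. sin (\<xi> \<bullet> x) *\<^sub>R f x)"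
  unfolding fourier_def using integral_Re[OF integrable_fourier[OF assms, of \<xi>]] integral_Im[OF integrable_fourier[OF assms, of \<xi>]]
  by simp_all

lemma has_pd_inner: "has_pd n (\<lambda>x. \<xi> \<bullet> x) (\<lambda>x. \<xi> $ n)"
proof -
  have "((\<lambda>h. \<xi> \<bullet> x + h * \<xi> $ n) has_vector_derivative \<xi> $ n) (at 0)" for x :: "real^2"
    by (auto intro!: derivative_eq_intros)
  then show ?thesis unfolding has_pd_def by (simp add: inner_add_right inner_axis)
qed

lemma has_pd_DERIV:
  fixes f :: "real^2 \<Rightarrow> real" and g :: "real \<Rightarrow> real"
  assumes "has_pd n f f'" "\<And>x. DERIV g x :> g' x"
  shows "has_pd n (\<lambda>x. g (f x)) (\<lambda>x. g' (f x) * f' x)"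
  unfolding has_pd_def has_real_derivative_iff_has_vector_derivative[symmetric]
proof
  fix x
  have "DERIV (\<lambda>h. f (x + h *\<^sub>R axis n 1)) 0 :> f' x"
    using assms(1) unfolding has_pd_def has_real_derivative_iff_has_vector_derivative[symmetric] by simp
  from DERIV_chain2[where f=g, OF _ this, of "g' (f x)"] assms(2)[of "f x"]
  show "DERIV (\<lambda>h. g (f (x + h *\<^sub>R axis n 1))) 0 :> g' (f x) * f' x" by simp
qed

text \<open>Integration by parts is available for real bounded factors, so the character is split
  into cosine and sine and the two parts are treated separately.\<close>

lemma fourier_pd:
  assumes G: "has_pd n G G'" "kernel G" "kernel G'"
  shows "fourier G' \<xi> = \<i> * complex_of_real (\<xi> $ n) * fourier G \<xi>"
proof -
  have i: "integrable lborel G" "integrable lborel G'" using G kernel_integrable by blast+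
  have c: "(LBINT x. cos (\<xi> \<bullet> x) *\<^sub>R G' x) = - (LBINT x. (- sin (\<xi> \<bullet> x) * \<xi> $ n) *\<^sub>R G x)"
  proof (rule integral_by_parts_pd[OF G has_pd_DERIV[OF has_pd_inner]])
    show "DERIV cos x :> - sin x" for x :: real by (rule DERIV_cos)
    show "\<bar>cos (\<xi> \<bullet> x)\<bar> \<le> 1" for x by simp
    show "\<bar>- sin (\<xi> \<bullet> x) * \<xi> $ n\<bar> \<le> \<bar>\<xi> $ n\<bar>" for x
      using mult_right_mono[OF abs_sin_le_one[of "\<xi> \<bullet> x"], of "\<bar>\<xi> $ n\<bar>"] by (simp add: abs_mult)
  qed (auto intro!: continuous_intros)
  have s: "(LBINT x. sin (\<xi> \<bullet> x) *\<^sub>R G' x) = - (LBINT x. (cos (\<xi> \<bullet> x) * \<xi> $ n) *\<^sub>R G x)"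
  proof (rule integral_by_parts_pd[OF G has_pd_DERIV[OF has_pd_inner]])
    show "DERIV sin x :> cos x" for x :: real by (rule DERIV_sin)
    show "\<bar>sin (\<xi> \<bullet> x)\<bar> \<le> 1" for x by simp
    show "\<bar>cos (\<xi> \<bullet> x) * \<xi> $ n\<bar> \<le> \<bar>\<xi> $ n\<bar>" for x
      using mult_right_mono[OF abs_cos_le_one[of "\<xi> \<bullet> x"], of "\<bar>\<xi> $ n\<bar>"] by (simp add: abs_mult)
  qed (auto intro!: continuous_intros)
  have c': "(LBINT x. (- sin (\<xi> \<bullet> x) * \<xi> $ n) *\<^sub>R G x) = - (\<xi> $ n) * (LBINT x. sin (\<xi> \<bullet> x) *\<^sub>R G x)"
    by (subst integral_mult_right_zero[symmetric]) (simp add: mult_ac)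
  have s': "(LBINT x. (cos (\<xi> \<bullet> x) * \<xi> $ n) *\<^sub>R G x) = \<xi> $ n * (LBINT x. cos (\<xi> \<bullet> x) *\<^sub>R G x)"
    by (subst integral_mult_right_zero[symmetric]) (simp add: mult_ac)
  show ?thesis
    by (rule complex_eqI) (simp_all add: fourier_Re_Im i c[unfolded c'] s[unfolded s'] del: real_scaleR_def)
qed

lemma fourier_dilate: "fourier (dilate F j) \<xi> = fourier F ((2 powi (- j)) *\<^sub>R \<xi>)"
proof -
  let ?c = "2 powi j :: real"
  have "fourier F ((2 powi (- j)) *\<^sub>R \<xi>) = ?c\<^sup>2 *\<^sub>R (LBINT x. cis (- (((1 / ?c) *\<^sub>R \<xi>) \<bullet> (?c *\<^sub>R x))) * complex_of_real (F (?c *\<^sub>R x)))"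
    unfolding fourier_def using integral_lborel_affine[of ?c "\<lambda>x. cis (- (((1 / ?c) *\<^sub>R \<xi>) \<bullet> x)) * complex_of_real (F x)" 0]
    by (simp add: power_int_minus divide_inverse power_int_abs)
  also have "\<dots> = (LBINT x. cis (- (((1 / ?c) *\<^sub>R \<xi>) \<bullet> (?c *\<^sub>R x))) * complex_of_real (dilate F j x))"
    by (simp add: dilate_eq scaleR_conv_of_real integral_mult_right_zero[symmetric] mult_ac del: integral_mult_right_zero)
  finally show ?thesis by (simp add: fourier_def)
qed

lemma continuous_on_integral_param:
  fixes F :: "'p::metric_space \<Rightarrow> 'a::euclidean_space \<Rightarrow> 'b::{banach,second_countable_topology}"
  assumes m: "\<And>p. p \<in> S \<Longrightarrow> F p \<in> borel_measurable borel"
    and c: "\<And>y. continuous_on S (\<lambda>p. F p y)"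
    and w: "integrable lborel w" "\<And>p y. p \<in> S \<Longrightarrow> norm (F p y) \<le> w y"
  shows "continuous_on S (\<lambda>p. LBINT y. F p y)"
  unfolding continuous_on_sequentially o_def
proof (intro allI ballI impI)
  fix X a assume a: "a \<in> S" and X: "(\<forall>n. X n \<in> S) \<and> X \<longlonglongrightarrow> a"
  show "(\<lambda>n. LBINT y. F (X n) y) \<longlonglongrightarrow> (LBINT y. F a y)"
  proof (rule integral_dominated_convergence[where w=w])
    show "AE y in lborel. (\<lambda>n. F (X n) y) \<longlonglongrightarrow> F a y"
      using c a X by (auto simp: continuous_on_sequentially o_def intro!: AE_I2)
  qed (use m a X w in auto)
qed

lemma integral_convolution:
  fixes k f :: "real^2 \<Rightarrow> real"
  assumes k: "integrable lborel k" and f: "integrable lborel f"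
  shows "integrable lborel (\<lambda>x. LBINT y. k (x - y) * f y)" (is ?I)
    and "fourier (\<lambda>x. LBINT y. k (x - y) * f y) \<xi> = fourier k \<xi> * fourier f \<xi>" (is ?F)
    and "(LBINT x. LBINT y. k (x - y) * f y) = (LBINT x. k x) * (LBINT x. f x)" (is ?V)
proof -
  have [measurable]: "k \<in> borel_measurable borel" "f \<in> borel_measurable borel" using k f by auto
  have kt: "integrable lborel (\<lambda>x. k (x - y))" for y
    using integrable_lborel_translate[of k "- y"] k by simp
  have kn: "(LBINT x. \<bar>k (x - y)\<bar>) = (LBINT x. \<bar>k x\<bar>)" for y
    using integral_lborel_translate[of "\<lambda>x. \<bar>k x\<bar>" "- y"] by simp
  have int: "integrable (lborel \<Otimes>\<^sub>M lborel) (\<lambda>(y, x). k (x - y) * f y)"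
  proof (rule lborel_pair.Fubini_integrable)
    show "(\<lambda>(y, x). k (x - y) * f y) \<in> borel_measurable (lborel \<Otimes>\<^sub>M lborel)" by measurable
    show "integrable lborel (\<lambda>y. LBINT x. norm (case (y, x) of (y, x) \<Rightarrow> k (x - y) * f y))"
      using f by (simp add: abs_mult kn)
    show "AE y in lborel. integrable lborel (\<lambda>x. case (y, x) of (y, x) \<Rightarrow> k (x - y) * f y)"
      using kt by simp
  qed
  show ?I using lborel_pair.integrable_snd[OF int] .
  show ?F
  proof -
    have "integrable (lborel \<Otimes>\<^sub>M lborel) (\<lambda>(y, x). cis (- (\<xi> \<bullet> x)) * complex_of_real (k (x - y) * f y))"
      by (rule Bochner_Integration.integrable_bound[OF int]) (auto simp: norm_mult)
    from Fubini_lborel[OF this]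
    have "(LBINT x. LBINT y. cis (- (\<xi> \<bullet> x)) * complex_of_real (k (x - y) * f y)) =
      (LBINT y. LBINT x. cis (- (\<xi> \<bullet> x)) * complex_of_real (k (x - y) * f y))" .
    moreover have "(LBINT x. cis (- (\<xi> \<bullet> x)) * complex_of_real (k (x - y) * f y)) = fourier k \<xi> * (cis (- (\<xi> \<bullet> y)) * complex_of_real (f y))" for y
    proof -
      have "(LBINT x. cis (- (\<xi> \<bullet> x)) * complex_of_real (k (x - y) * f y)) = (LBINT x. cis (- (\<xi> \<bullet> (x + y))) * complex_of_real (k x * f y))"
        using integral_lborel_translate[of "\<lambda>x. cis (- (\<xi> \<bullet> x)) * complex_of_real (k (x - y) * f y)" y] by simp
      also have "\<dots> = (LBINT x. (cis (- (\<xi> \<bullet> x)) * complex_of_real (k x)) * (cis (- (\<xi> \<bullet> y)) * complex_of_real (f y)))"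
      proof (intro Bochner_Integration.integral_cong refl)
        fix x show "cis (- (\<xi> \<bullet> (x + y))) * complex_of_real (k x * f y) = (cis (- (\<xi> \<bullet> x)) * complex_of_real (k x)) * (cis (- (\<xi> \<bullet> y)) * complex_of_real (f y))"
          using cis_mult[of "- (\<xi> \<bullet> x)" "- (\<xi> \<bullet> y)"] by (simp add: inner_add_right)
      qed
      finally show ?thesis by (simp only: integral_mult_left_zero fourier_def)
    qed
    ultimately show ?thesis
      by (simp add: fourier_def integral_complex_of_real[symmetric] del: of_real_mult integral_complex_of_real)
  qed
  show ?V
  proof -
    have "(LBINT x. LBINT y. k (x - y) * f y) = (LBINT y. LBINT x. k (x - y) * f y)"
      by (rule Fubini_lborel[OF int])
    also have "\<dots> = (LBINT y. (LBINT x. k x) * f y)"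
      using integral_lborel_translate[of k "- _"] by simp
    finally show ?thesis by simp
  qed
qed

text \<open>Plancherel's identity with a Gaussian weight: pair the inversion formula with
  \<open>h\<close> and exchange the integrals. The weight keeps the frequency integral finite
  although \<open>h\<close> is merely integrable.\<close>

lemma gauss_energy:
  assumes h: "integrable lborel h"
  shows "(LBINT \<xi>. (norm (fourier h \<xi>))\<^sup>2 * gauss ((1 / 2 powi j) *\<^sub>R \<xi>)) =
    (2 * pi)\<^sup>2 * (LBINT z. h z * (LBINT y. dilate ngauss j (z - y) * h y))"
proof -
  let ?g = "\<lambda>\<xi>. gauss ((1 / 2 powi j) *\<^sub>R \<xi>)"
  let ?h = "LBINT x. \<bar>h x\<bar>"
  have [measurable]: "h \<in> borel_measurable borel" "fourier h \<in> borel_measurable borel"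
    using h fourier_measurable[OF h] by auto
  let ?K = "\<lambda>z \<xi>. complex_of_real (h z) * (fourier h \<xi> * (cis (\<xi> \<bullet> z) * complex_of_real (?g \<xi>)))"
  have int: "integrable (lborel \<Otimes>\<^sub>M lborel) (\<lambda>(z, \<xi>). ?K z \<xi>)"
  proof (rule integrable_pair_bound)
    show "(\<lambda>(z, \<xi>). ?K z \<xi>) \<in> borel_measurable (lborel \<Otimes>\<^sub>M lborel)" by measurable
    show "integrable lborel (\<lambda>x. \<bar>h x\<bar>)" using h by simp
    show "integrable lborel (\<lambda>\<xi>. ?h * ?g \<xi>)"
      using integrable_lborel_affine[OF integrable_gauss, of "1 / 2 powi j" 0] by simp
    show "norm (case (z, \<xi>) of (z, \<xi>) \<Rightarrow> ?K z \<xi>) \<le> \<bar>h z\<bar> * (?h * ?g \<xi>)" for z \<xi>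
      using norm_fourier_le[OF h, of \<xi>] gauss_pos[THEN less_imp_le]
      by (auto simp: norm_mult intro!: mult_left_mono mult_right_mono)
  qed
  have "complex_of_real ((2 * pi)\<^sup>2 * (LBINT z. h z * (LBINT y. dilate ngauss j (z - y) * h y))) =
     (LBINT z. complex_of_real (h z) * complex_of_real ((2 * pi)\<^sup>2 * (LBINT y. dilate ngauss j (z - y) * h y)))"
    by (simp only: of_real_mult[symmetric] integral_complex_of_real integral_mult_right_zero[symmetric] mult.left_commute[of "h _"])
  also have "\<dots> = (LBINT z. LBINT \<xi>. ?K z \<xi>)"
    unfolding fourier_inversion_gauss[OF h, symmetric] by (simp only: integral_mult_right_zero)
  also have "\<dots> = (LBINT \<xi>. LBINT z. ?K z \<xi>)"
    by (rule Fubini_lborel[OF int, symmetric])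
  also have "\<dots> = (LBINT \<xi>. complex_of_real ((norm (fourier h \<xi>))\<^sup>2 * ?g \<xi>))"
  proof (intro Bochner_Integration.integral_cong refl)
    fix \<xi>
    have "(LBINT z. ?K z \<xi>) = (LBINT z. (fourier h \<xi> * complex_of_real (?g \<xi>)) * cnj (cis (- (\<xi> \<bullet> z)) * complex_of_real (h z)))"
      by (intro Bochner_Integration.integral_cong refl) (simp add: cis_cnj mult_ac)
    also have "\<dots> = (fourier h \<xi> * complex_of_real (?g \<xi>)) * cnj (fourier h \<xi>)"
      unfolding fourier_def by (simp only: integral_mult_right_zero Bochner_Integration.integral_cnj)
    also have "\<dots> = complex_of_real ((norm (fourier h \<xi>))\<^sup>2 * ?g \<xi>)"
      using complex_norm_square[of "fourier h \<xi>"] by (simp add: mult_ac)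
    finally show "(LBINT z. ?K z \<xi>) = complex_of_real ((norm (fourier h \<xi>))\<^sup>2 * ?g \<xi>)" .
  qed
  finally show ?thesis by (simp only: integral_complex_of_real of_real_eq_iff)
qed

section \<open>The Plancherel inequality\<close>

lemma square_le_abs: "\<bar>a\<bar> \<le> B \<Longrightarrow> a\<^sup>2 \<le> B * \<bar>a\<bar>" for a :: real
  using mult_right_mono[of "\<bar>a\<bar>" B "\<bar>a\<bar>"] by (simp add: power2_eq_square)

lemma kernel_boundedE:
  assumes "kernel G" obtains C where "C > 0" "\<And>x. norm (G x) \<le> C"
proof -
  obtain C where C: "C > 0" "\<And>x. norm (G x) \<le> C / (1 + norm x) ^ 3" using kernelE[OF assms] by blast
  have "C / (1 + norm x) ^ 3 \<le> C / 1" for x :: "real^2"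
    using C(1) by (intro divide_left_mono) (auto simp: add_pos_nonneg)
  then show ?thesis using that[of C] C by (auto intro: order_trans)
qed

text \<open>The mollifier is nonnegative with mass one. Bounding \<open>f z * f y\<close> by half
  the sum of the squares and integrating, each half contributes half of the right-hand side. The
  bound is uniform in \<open>j\<close>.\<close>

lemma ngauss_energy_le:
  assumes f: "integrable lborel f" "\<And>x. \<bar>f x\<bar> \<le> B"
  shows "(LBINT z. f z * (LBINT y. dilate ngauss j (z - y) * f y)) \<le> (LBINT z. (f z)\<^sup>2)"
proof -
  let ?m = "dilate ngauss j"
  have [measurable]: "f \<in> borel_measurable borel" "?m \<in> borel_measurable borel"
    using f integrable_dilate[OF ngauss_integrable, of j] by auto
  have B: "0 \<le> B" using f(2)[of 0] by linarith
  have f2: "integrable lborel (\<lambda>z. (f z)\<^sup>2)"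
  proof (rule Bochner_Integration.integrable_bound)
    show "integrable lborel (\<lambda>z. B * f z)" using f by simp
    show "AE x in lborel. norm ((f x)\<^sup>2) \<le> norm (B * f x)"
      using f(2) B by (auto intro!: AE_I2 square_le_abs simp: abs_mult)
  qed measurable
  have mi: "integrable lborel ?m" by (rule integrable_dilate[OF ngauss_integrable])
  have mz: "integrable lborel (\<lambda>y. ?m (z - y))" for z using mi by (simp add: integrable_lborel_reflect)
  have m1: "(LBINT y. ?m (z - y)) = 1" for z by (simp add: integral_lborel_reflect integral_dilate integral_ngauss)
  have m0: "0 \<le> ?m x" for x by (simp add: dilate_eq ngauss_nonneg)
  have mb: "integrable lborel (\<lambda>y. ?m (z - y) * g y)" if "g \<in> borel_measurable borel" "\<And>x. \<bar>g x\<bar> \<le> A" for g z A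
  proof (rule Bochner_Integration.integrable_bound)
    show "integrable lborel (\<lambda>y. ?m (z - y) * A)" using mz by simp
    show "AE y in lborel. norm (?m (z - y) * g y) \<le> norm (?m (z - y) * A)"
      using that(2) by (auto intro!: AE_I2 mult_left_mono order_trans[OF that(2) abs_ge_self] simp: abs_mult)
  qed (use that in measurable)
  have sq: "\<bar>(f x)\<^sup>2\<bar> \<le> B\<^sup>2" for x using power_mono[OF f(2)[of x], of 2] by simp
  have i1: "integrable lborel (\<lambda>z. LBINT y. ?m (z - y) * f y)" and i2: "integrable lborel (\<lambda>z. LBINT y. ?m (z - y) * (f y)\<^sup>2)"
    by (rule integral_convolution(1)[OF mi f(1)], rule integral_convolution(1)[OF mi f2])
  have "(LBINT z. f z * (LBINT y. ?m (z - y) * f y)) \<le> (LBINT z. 1 / 2 * (f z)\<^sup>2 + 1 / 2 * (LBINT y. ?m (z - y) * (f y)\<^sup>2))"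
  proof (rule integral_mono)
    show "integrable lborel (\<lambda>z. f z * (LBINT y. ?m (z - y) * f y))"
    proof (rule Bochner_Integration.integrable_bound)
      show "integrable lborel (\<lambda>z. B * (LBINT y. ?m (z - y) * f y))" using i1 by simp
      show "AE z in lborel. norm (f z * (LBINT y. ?m (z - y) * f y)) \<le> norm (B * (LBINT y. ?m (z - y) * f y))"
        using f(2) B by (auto simp: abs_mult intro!: AE_I2 mult_right_mono)
      show "(\<lambda>z. f z * (LBINT y. ?m (z - y) * f y)) \<in> borel_measurable lborel"
        using i1 by (intro borel_measurable_times) auto
    qed
    show "integrable lborel (\<lambda>z. 1 / 2 * (f z)\<^sup>2 + 1 / 2 * (LBINT y. ?m (z - y) * (f y)\<^sup>2))"
      using f2 i2 by simp
    fix z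
    have "f z * (LBINT y. ?m (z - y) * f y) = (LBINT y. ?m (z - y) * (f z * f y))"
      by (simp add: integral_mult_right_zero[symmetric] mult_ac del: integral_mult_right_zero)
    also have "\<dots> \<le> (LBINT y. ?m (z - y) * (1 / 2 * (f z)\<^sup>2) + 1 / 2 * (?m (z - y) * (f y)\<^sup>2))"
    proof (rule integral_mono)
      have "\<bar>f z * f y\<bar> \<le> B * B" for y using f(2) B by (auto simp: abs_mult intro!: mult_mono)
      then show "integrable lborel (\<lambda>y. ?m (z - y) * (f z * f y))" by (intro mb) auto
      show "integrable lborel (\<lambda>y. ?m (z - y) * (1 / 2 * (f z)\<^sup>2) + 1 / 2 * (?m (z - y) * (f y)\<^sup>2))"
        using mz mb[OF _ sq] by simp
      fix y
      have "f z * f y \<le> 1 / 2 * (f z)\<^sup>2 + 1 / 2 * (f y)\<^sup>2"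
        using sum_squares_bound[of "f z" "f y"] by simp
      from mult_left_mono[OF this m0[of "z - y"]]
      show "?m (z - y) * (f z * f y) \<le> ?m (z - y) * (1 / 2 * (f z)\<^sup>2) + 1 / 2 * (?m (z - y) * (f y)\<^sup>2)"
        by (simp add: algebra_simps)
    qed
    also have "\<dots> = 1 / 2 * (f z)\<^sup>2 + 1 / 2 * (LBINT y. ?m (z - y) * (f y)\<^sup>2)"
      using mz mb[OF _ sq] by (subst Bochner_Integration.integral_add) (auto simp: m1)
    finally show "f z * (LBINT y. ?m (z - y) * f y) \<le> 1 / 2 * (f z)\<^sup>2 + 1 / 2 * (LBINT y. ?m (z - y) * (f y)\<^sup>2)" .
  qed
  also have "\<dots> = (LBINT z. (f z)\<^sup>2)"
    using f2 i2 integral_convolution(3)[OF mi f2] by (simp add: integral_dilate integral_ngauss)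
  finally show ?thesis .
qed

text \<open>The multiplier bound on L2 without an L2 theory of the Fourier transform: with a
  Gaussian weight the energies of \<open>g\<close> and \<open>f\<close> can be compared pointwise in
  frequency. Back in physical space, the energy of \<open>f\<close> is at most its L2 norm squared
  for each \<open>j\<close>, and the energy of \<open>g\<close> tends to its L2 norm squared as
  \<open>j\<close> grows.\<close>

lemma Plancherel_le:
  fixes k f :: "real^2 \<Rightarrow> real"
  assumes k: "kernel k" and f: "integrable lborel f" "\<And>x. \<bar>f x\<bar> \<le> B"
    and A: "\<And>\<xi>. norm (fourier k \<xi>) \<le> A"
  defines "g \<equiv> \<lambda>x. LBINT y. k (x - y) * f y"
  shows "integrable lborel (\<lambda>x. (g x)\<^sup>2)" "(LBINT x. (g x)\<^sup>2) \<le> A\<^sup>2 * (LBINT x. (f x)\<^sup>2)"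
proof -
  have [measurable]: "f \<in> borel_measurable borel" "k \<in> borel_measurable borel"
    using f kernel_measurable[OF k] by auto
  have ki: "integrable lborel k" by (rule kernel_integrable[OF k])
  obtain C where C: "C > 0" and kC: "\<And>x. \<bar>k x\<bar> \<le> C" using kernel_boundedE[OF k] by auto
  have gi: "integrable lborel g" unfolding g_def by (rule integral_convolution(1)[OF ki f(1)])
  define D where "D = C * (LBINT y. \<bar>f y\<bar>)"
  have gb: "\<bar>g x\<bar> \<le> D" for x
  proof -
    have "\<bar>g x\<bar> \<le> (LBINT y. \<bar>k (x - y) * f y\<bar>)"
      unfolding g_def using integral_norm_bound[of lborel "\<lambda>y. k (x - y) * f y"] by simp
    also have "\<dots> \<le> (LBINT y. C * \<bar>f y\<bar>)"
    proof (rule integral_mono_AE')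
      show "integrable lborel (\<lambda>y. C * \<bar>f y\<bar>)" using f by simp
      show "AE y in lborel. \<bar>k (x - y) * f y\<bar> \<le> C * \<bar>f y\<bar>"
        using kC by (auto simp: abs_mult intro!: AE_I2 mult_right_mono)
    qed (use C in auto)
    finally show ?thesis by (simp add: D_def)
  qed
  have D: "0 \<le> D" using gb[of 0] by linarith
  have gc: "continuous_on UNIV g"
    unfolding g_def
  proof (rule continuous_on_integral_param[where w="\<lambda>y. C * \<bar>f y\<bar>"])
    show "continuous_on UNIV (\<lambda>x. k (x - y) * f y)" for y
      by (intro continuous_intros continuous_on_compose2[OF kernel_continuous[OF k, of UNIV]]) auto
    show "norm (k (x - y) * f y) \<le> C * \<bar>f y\<bar>" for x y
      using kC by (auto simp: abs_mult intro!: mult_right_mono)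
  qed (use f in auto)
  have [measurable]: "g \<in> borel_measurable borel" using gi by auto
  show "integrable lborel (\<lambda>x. (g x)\<^sup>2)"
  proof (rule Bochner_Integration.integrable_bound)
    show "integrable lborel (\<lambda>z. D * g z)" using gi by simp
    show "AE x in lborel. norm ((g x)\<^sup>2) \<le> norm (D * g x)"
      using gb D by (auto intro!: AE_I2 square_le_abs simp: abs_mult)
  qed measurable
  let ?E = "\<lambda>j h. LBINT z. h z * (LBINT y. dilate ngauss j (z - y) * h y)"
  have le: "?E j g \<le> A\<^sup>2 * (LBINT x. (f x)\<^sup>2)" for j
  proof -
    let ?w = "\<lambda>\<xi>. gauss ((1 / 2 powi j) *\<^sub>R \<xi>)"
    have wi: "integrable lborel ?w" using integrable_lborel_affine[OF integrable_gauss, of "1 / 2 powi j" 0] by simp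
    have ei: "integrable lborel (\<lambda>\<xi>. (norm (fourier h \<xi>))\<^sup>2 * ?w \<xi>)" if "integrable lborel h" for h
    proof (rule Bochner_Integration.integrable_bound)
      have [measurable]: "fourier h \<in> borel_measurable borel" by (rule fourier_measurable[OF that])
      show "(\<lambda>\<xi>. (norm (fourier h \<xi>))\<^sup>2 * ?w \<xi>) \<in> borel_measurable lborel" by measurable
      show "integrable lborel (\<lambda>\<xi>. (LBINT x. \<bar>h x\<bar>)\<^sup>2 * ?w \<xi>)" using wi by simp
      show "AE \<xi> in lborel. norm ((norm (fourier h \<xi>))\<^sup>2 * ?w \<xi>) \<le> norm ((LBINT x. \<bar>h x\<bar>)\<^sup>2 * ?w \<xi>)"
        using norm_fourier_le[OF that] by (auto simp: abs_mult intro!: AE_I2 mult_right_mono power_mono)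
    qed
    have "(2 * pi)\<^sup>2 * ?E j g = (LBINT \<xi>. (norm (fourier g \<xi>))\<^sup>2 * ?w \<xi>)"
      by (rule gauss_energy[OF gi, symmetric])
    also have "\<dots> \<le> (LBINT \<xi>. A\<^sup>2 * ((norm (fourier f \<xi>))\<^sup>2 * ?w \<xi>))"
    proof (rule integral_mono)
      fix \<xi>
      have "norm (fourier g \<xi>) \<le> A * norm (fourier f \<xi>)"
        unfolding g_def integral_convolution(2)[OF ki f(1)] norm_mult by (intro mult_right_mono A) simp
      then have "(norm (fourier g \<xi>))\<^sup>2 \<le> (A * norm (fourier f \<xi>))\<^sup>2" by (intro power_mono) auto
      then show "(norm (fourier g \<xi>))\<^sup>2 * ?w \<xi> \<le> A\<^sup>2 * ((norm (fourier f \<xi>))\<^sup>2 * ?w \<xi>)"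
        using gauss_pos[THEN less_imp_le] by (simp add: power_mult_distrib mult.assoc[symmetric] mult_right_mono)
    qed (use ei[OF gi] ei[OF f(1)] in auto)
    also have "\<dots> = A\<^sup>2 * ((2 * pi)\<^sup>2 * ?E j f)" by (simp only: integral_mult_right_zero gauss_energy[OF f(1)])
    also have "\<dots> \<le> A\<^sup>2 * ((2 * pi)\<^sup>2 * (LBINT z. (f z)\<^sup>2))"
      by (intro mult_left_mono ngauss_energy_le[OF f]) auto
    finally have "(2 * pi)\<^sup>2 * ?E j g \<le> (2 * pi)\<^sup>2 * (A\<^sup>2 * (LBINT z. (f z)\<^sup>2))" by (simp only: mult_ac)
    then show ?thesis by (subst (asm) mult_le_cancel_left_pos) auto
  qed
  have lim: "(\<lambda>m. ?E (int m) g) \<longlonglongrightarrow> (LBINT z. g z * g z)"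
  proof (rule integral_dominated_convergence[where w="\<lambda>z. \<bar>g z\<bar> * D"])
    have mi: "integrable lborel (dilate ngauss j)" for j by (rule integrable_dilate[OF ngauss_integrable])
    have [measurable]: "dilate ngauss j \<in> borel_measurable borel" for j using mi by auto
    show "integrable lborel (\<lambda>z. \<bar>g z\<bar> * D)" using gi by simp
    show "AE z in lborel. (\<lambda>m. g z * (LBINT y. dilate ngauss (int m) (z - y) * g y)) \<longlonglongrightarrow> g z * g z"
    proof (rule AE_I2)
      fix z
      have "(\<lambda>m. LBINT y. dilate ngauss (int m) (z - y) * g y) \<longlonglongrightarrow> g z"
        using approx_identity[OF ngauss_integrable gc, of D z] gb by (simp add: integral_ngauss)
      then show "(\<lambda>m. g z * (LBINT y. dilate ngauss (int m) (z - y) * g y)) \<longlonglongrightarrow> g z * g z"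
        by (intro tendsto_mult tendsto_const)
    qed
    show "(\<lambda>z. g z * (LBINT y. dilate ngauss (int m) (z - y) * g y)) \<in> borel_measurable lborel" for m
      using integral_convolution(1)[OF mi gi] by (intro borel_measurable_times) auto
    show "AE z in lborel. norm (g z * (LBINT y. dilate ngauss (int m) (z - y) * g y)) \<le> \<bar>g z\<bar> * D" for m
    proof (rule AE_I2)
      fix z
      have "\<bar>LBINT y. dilate ngauss (int m) (z - y) * g y\<bar> \<le> (LBINT y. \<bar>dilate ngauss (int m) (z - y) * g y\<bar>)"
        using integral_norm_bound[of lborel "\<lambda>y. dilate ngauss (int m) (z - y) * g y"] by simp
      also have "\<dots> \<le> (LBINT y. dilate ngauss (int m) (z - y) * D)"
      proof (rule integral_mono_AE')
        show "integrable lborel (\<lambda>y. dilate ngauss (int m) (z - y) * D)" using mi by (simp add: integrable_lborel_reflect)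
        show "AE y in lborel. \<bar>dilate ngauss (int m) (z - y) * g y\<bar> \<le> dilate ngauss (int m) (z - y) * D"
          using gb by (auto simp: abs_mult dilate_eq ngauss_nonneg intro!: AE_I2 mult_left_mono)
        show "AE y in lborel. 0 \<le> dilate ngauss (int m) (z - y) * D" using D by (simp add: dilate_eq ngauss_nonneg)
      qed
      also have "\<dots> = D" by (simp add: integral_lborel_reflect integral_dilate integral_ngauss)
      finally show "norm (g z * (LBINT y. dilate ngauss (int m) (z - y) * g y)) \<le> \<bar>g z\<bar> * D"
        by (auto simp: abs_mult intro!: mult_left_mono)
    qed
  qed measurable
  have "(LBINT z. g z * g z) \<le> A\<^sup>2 * (LBINT x. (f x)\<^sup>2)"
    by (rule LIMSEQ_le_const2[OF lim]) (use le in auto)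
  then show "(LBINT x. (g x)\<^sup>2) \<le> A\<^sup>2 * (LBINT x. (f x)\<^sup>2)" by (simp add: power2_eq_square)
qed


section \<open>Rapidly decreasing functions\<close>

text \<open>Decay of the function alone, without its derivatives. This survives multiplication by
  powers of the norm, which are not smooth at the origin but are needed for the moments in
  \<open>kernel_Riesz\<close>.\<close>

definition rapid :: "(real^2 \<Rightarrow> real) \<Rightarrow> bool" where
  "rapid f \<longleftrightarrow> continuous_on UNIV f \<and> (\<forall>m. \<exists>C. \<forall>x. \<bar>f x\<bar> * (1 + norm x) ^ m \<le> C)"

lemma one_plus_power_le: "0 \<le> r \<Longrightarrow> (1 + r) ^ m \<le> 2 ^ m * (1 + r ^ m)" for r :: real
proof -
  assume r: "0 \<le> r"
  have "(1 + r) ^ m \<le> (2 * max 1 r) ^ m" using r by (intro power_mono) auto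
  also have "\<dots> = 2 ^ m * (max 1 r) ^ m" by (simp add: power_mult_distrib)
  also have "(max 1 r) ^ m \<le> 1 + r ^ m" using r by (auto simp: max_def)
  finally show ?thesis by simp
qed

lemma pds_append: "pds (as @ bs) f = pds as (pds bs f)"
  by (induction as) auto

lemma schwartz_pd: assumes "schwartz f" shows "schwartz (pd n f)"
proof -
  have "pds is (pd n f) = pds (is @ [n]) f" for "is"
    by (simp add: pds_append)
  then show ?thesis using assms unfolding schwartz_def by simp
qed

lemma schwartz_differentiable: "schwartz f \<Longrightarrow> f differentiable_on UNIV"
  unfolding schwartz_def by (drule spec[of _ "[]"]) simp

lemma schwartz_has_pd: "schwartz f \<Longrightarrow> has_pd n f (pd n f)"
  by (intro differentiable_imp_has_pd schwartz_differentiable)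

lemma schwartz_rapid:
  assumes "schwartz f" shows "rapid f"
  unfolding rapid_def
proof (intro conjI allI)
  have b: "bounded (range (\<lambda>x. norm x ^ m * f x))" for m
    using assms unfolding schwartz_def by (auto dest!: spec[of _ "[]"])
  show "continuous_on UNIV f"
    using schwartz_differentiable[OF assms] by (rule differentiable_imp_continuous_on)
  fix m
  obtain A where A: "\<And>x. \<bar>f x\<bar> \<le> A" using b[of 0] by (auto simp: bounded_iff)
  obtain D where D: "\<And>x. norm x ^ m * \<bar>f x\<bar> \<le> D" using b[of m] by (auto simp: bounded_iff abs_mult)
  have "\<bar>f x\<bar> * (1 + norm x) ^ m \<le> 2 ^ m * (A + D)" for x
  proof -
    have "\<bar>f x\<bar> * (1 + norm x) ^ m \<le> \<bar>f x\<bar> * (2 ^ m * (1 + norm x ^ m))"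
      by (intro mult_left_mono one_plus_power_le) auto
    also have "\<dots> = 2 ^ m * (\<bar>f x\<bar> + norm x ^ m * \<bar>f x\<bar>)" by (simp add: algebra_simps)
    also have "\<dots> \<le> 2 ^ m * (A + D)" using A[of x] D[of x] by (intro mult_left_mono) auto
    finally show ?thesis .
  qed
  then show "\<exists>C. \<forall>x. \<bar>f x\<bar> * (1 + norm x) ^ m \<le> C" by blast
qed

lemma rapid_mult_growth:
  assumes "rapid f" "continuous_on UNIV g" "\<And>x. \<bar>g x\<bar> \<le> B * (1 + norm x) ^ n"
  shows "rapid (\<lambda>x. g x * f x)"
  unfolding rapid_def
proof (intro conjI allI)
  show "continuous_on UNIV (\<lambda>x. g x * f x)" using assms unfolding rapid_def by (intro continuous_intros) auto
  fix m
  obtain C where C: "\<And>x. \<bar>f x\<bar> * (1 + norm x) ^ (n + m) \<le> C" using assms(1) unfolding rapid_def by metis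
  have "0 \<le> B" using order_trans[OF abs_ge_zero assms(3)[of 0]] by simp
  have "\<bar>g x * f x\<bar> * (1 + norm x) ^ m \<le> B * C" for x
  proof -
    have "\<bar>g x * f x\<bar> * (1 + norm x) ^ m \<le> (B * (1 + norm x) ^ n) * (\<bar>f x\<bar> * (1 + norm x) ^ m)"
      unfolding abs_mult mult.assoc[of "\<bar>g x\<bar>"] by (intro mult_right_mono assms(3)) auto
    also have "\<dots> = B * (\<bar>f x\<bar> * (1 + norm x) ^ (n + m))" by (simp add: power_add mult_ac)
    also have "\<dots> \<le> B * C" using C \<open>0 \<le> B\<close> by (intro mult_left_mono) auto
    finally show ?thesis .
  qed
  then show "\<exists>C. \<forall>x. \<bar>g x * f x\<bar> * (1 + norm x) ^ m \<le> C" by blast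
qed

lemma rapid_kernel: assumes "rapid f" shows "kernel f"
proof -
  obtain C where C: "\<And>x. \<bar>f x\<bar> * (1 + norm x) ^ 3 \<le> C" using assms unfolding rapid_def by metis
  have "norm (f x) \<le> C / (1 + norm x) ^ 3" for x
    using C[of x] by (simp add: pos_le_divide_eq add_pos_nonneg)
  then show ?thesis using assms unfolding kernel_def rapid_def by blast
qed

lemmas schwartz_kernel = rapid_kernel[OF schwartz_rapid]

lemma schwartz_bounded: assumes "schwartz f" obtains B where "\<And>x. \<bar>f x\<bar> \<le> B"
  using kernel_boundedE[OF schwartz_kernel[OF assms]] by auto

lemma schwartz_fourier_injective:
  assumes "schwartz f" "schwartz g" "\<And>\<xi>. fourier f \<xi> = fourier g \<xi>"
  shows "f = g"
proof -
  obtain B B' where "\<And>x. \<bar>f x\<bar> \<le> B" "\<And>x. \<bar>g x\<bar> \<le> B'"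
    using schwartz_bounded assms(1,2) by metis
  then show ?thesis
    using assms schwartz_kernel[of f] schwartz_kernel[of g]
    by (intro fourier_injective[of f B g B'] kernel_integrable kernel_continuous) auto
qed

text \<open>Both sides have the Fourier transform \<open>- \<xi>\<^sub>i \<xi>\<^sub>j f\<close>.\<close>

lemma schwartz_pd_commute:
  assumes "schwartz f" shows "pd i (pd j f) = pd j (pd i f)"
proof -
  have *: "fourier (pd i (pd j f)) \<xi> = \<i> * complex_of_real (\<xi> $ i) * (\<i> * complex_of_real (\<xi> $ j) * fourier f \<xi>)" for i j \<xi>
    using fourier_pd[OF schwartz_has_pd schwartz_kernel schwartz_kernel] assms by (simp add: schwartz_pd)
  show ?thesis
    by (rule schwartz_fourier_injective) (simp_all add: assms schwartz_pd *)
qed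

lemma has_pd_dilate:
  assumes "has_pd n f f'" shows "has_pd n (dilate f j) (\<lambda>x. 2 powi j * dilate f' j x)"
proof -
  have e: "dilate g j = (\<lambda>x. (2 powi j)\<^sup>2 * g (0 + 2 powi j *\<^sub>R x))" for g
    by (simp add: fun_eq_iff dilate_eq)
  show ?thesis
    using has_pd_linear[OF bounded_linear_mult_right has_pd_affine[OF assms, of 0 "2 powi j"], of "(2 powi j)\<^sup>2"]
    unfolding e by (simp add: mult_ac)
qed

lemma pds_dilate:
  assumes "schwartz f"
  shows "pds is (dilate f j) = (\<lambda>x. (2 powi j) ^ length is * dilate (pds is f) j x)"
proof (induction "is")
  case (Cons i "is")
  have "schwartz (pds is f)"
    using assms by (induction "is") (auto intro: schwartz_pd)
  from has_pd_linear[OF bounded_linear_mult_right has_pd_dilate[OF schwartz_has_pd[OF this, of i], of j], of "(2 powi j) ^ length is"]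
  show ?case by (simp add: Cons has_pd_imp_pd mult_ac)
qed simp

lemma schwartz_dilate: assumes f: "schwartz f" shows "schwartz (dilate f j)"
  unfolding schwartz_def
proof (intro allI conjI)
  fix "is"
  define c where "c = (2 powi j :: real)"
  have c: "c > 0" by (simp add: c_def)
  have s: "schwartz (pds is f)"
    using assms by (induction "is") (auto intro: schwartz_pd)
  have d: "pds is f differentiable_on UNIV" and b: "bounded (range (\<lambda>x. norm x ^ m * pds is f x))" for m
    using f unfolding schwartz_def by auto
  have e: "pds is (dilate f j) = (\<lambda>x. c ^ length is * (c\<^sup>2 * pds is f (c *\<^sub>R x)))"
    by (simp add: pds_dilate[OF f] dilate_eq c_def)
  have "(\<lambda>x. pds is f (c *\<^sub>R x)) differentiable_on UNIV"
    using d by (intro differentiable_on_compose[of "\<lambda>x. c *\<^sub>R x" UNIV "pds is f"] derivative_intros) (auto intro: differentiable_on_subset)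
  then show "pds is (dilate f j) differentiable_on UNIV"
    unfolding e by (intro derivative_intros)
  fix m
  obtain D where D: "\<And>x. norm x ^ m * \<bar>pds is f x\<bar> \<le> D" using b[of m] by (auto simp: bounded_iff abs_mult)
  have "norm (norm x ^ m * pds is (dilate f j) x) \<le> c ^ length is * c\<^sup>2 * (1 / c) ^ m * D" for x
  proof -
    have "norm (norm x ^ m * pds is (dilate f j) x) = c ^ length is * c\<^sup>2 * (1 / c) ^ m * (norm (c *\<^sub>R x) ^ m * \<bar>pds is f (c *\<^sub>R x)\<bar>)"
      using c by (simp add: e abs_mult power_mult_distrib power_divide)
    also have "\<dots> \<le> c ^ length is * c\<^sup>2 * (1 / c) ^ m * D" using D[of "c *\<^sub>R x"] c by (intro mult_left_mono) auto
    finally show ?thesis .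
  qed
  then show "bounded (range (\<lambda>x. norm x ^ m * pds is (dilate f j) x))" by (auto simp: bounded_iff)
qed

section \<open>Riesz potentials\<close>

text \<open>With \<open>Phi\<close> equal to 1/(2 pi |x|) this is the inverse square root of minus
  the Laplacian in the plane.\<close>

definition Riesz :: "(real^2 \<Rightarrow> real) \<Rightarrow> real^2 \<Rightarrow> real" where
  "Riesz f x = (LBINT y. Phi y * f (x - y))"

lemma Phi_nonneg: "0 \<le> Phi x" by (simp add: Phi_def)

lemma Phi_measurable [measurable]: "Phi \<in> borel_measurable borel"
  unfolding Phi_def by measurable

text \<open>The dyadic scheme again, now with shrinking balls: values of order 2^k against areas of
  order 4^(-k).\<close>

lemma integrable_Phi_ball: "integrable lborel (\<lambda>x. Phi x * indicator (ball 0 1) x)"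
proof (rule integrableI_bounded)
  let ?f = "\<lambda>k x. ennreal (2 * 2 ^ k) * indicator (ball 0 ((1 / 2) ^ k)) (x::real^2)"
  have *: "ennreal (norm (Phi x * indicator (ball 0 1) x)) \<le> (\<Sum>k. ?f k x)" for x :: "real^2"
  proof (cases "x = 0 \<or> 1 \<le> norm x")
    \<comment> \<open>At the origin \<open>Phi\<close> has the default value 0, by division by
      zero.\<close>
    case True then show ?thesis by (auto simp: Phi_def)
  next
    case False
    define m where "m = (LEAST m::nat. (1 / 2) ^ m \<le> norm x)"
    have ex: "\<exists>m::nat. (1 / 2) ^ m \<le> norm x" using real_arch_pow_inv[of "norm x" "1 / 2"] False by (auto intro: less_imp_le)
    have m: "(1 / 2) ^ m \<le> norm x" unfolding m_def by (rule LeastI_ex[OF ex])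
    then obtain k where k: "m = Suc k" using False by (cases m) auto
    then have "\<not> (1 / 2) ^ k \<le> norm x" using not_less_Least[of k "\<lambda>m. (1 / 2) ^ m \<le> norm x"] m_def by simp
    then have in_ball: "x \<in> ball 0 ((1 / 2) ^ k)" by simp
    have "1 / norm x \<le> 2 * 2 ^ k"
      using m False unfolding k by (simp add: power_divide field_simps)
    moreover have "Phi x \<le> 1 / norm x"
    proof -
      have "1 * norm x \<le> 2 * pi * norm x" using pi_gt3 by (intro mult_right_mono) auto
      then show ?thesis unfolding Phi_def using False by (intro divide_left_mono) auto
    qed
    ultimately have "ennreal (norm (Phi x * indicator (ball 0 1) x)) \<le> ?f k x"
      using in_ball False Phi_nonneg[of x] by (auto intro!: ennreal_leI simp: abs_mult)
    also have "\<dots> \<le> (\<Sum>k. ?f k x)"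
      using sum_le_suminf[of "\<lambda>k. ?f k x" "{k}"]
      by (simp only: sum.insert sum.empty finite.emptyI empty_iff add_0_right not_False_eq_True finite_insert) simp
    finally show ?thesis .
  qed
  have "(\<integral>\<^sup>+x. ennreal (norm (Phi x * indicator (ball 0 1) x)) \<partial>lborel) \<le> (\<integral>\<^sup>+x. (\<Sum>k. ?f k x) \<partial>lborel)"
    by (intro nn_integral_mono *)
  also have "\<dots> = (\<Sum>k. \<integral>\<^sup>+x. ?f k x \<partial>lborel)"
    by (intro nn_integral_suminf borel_measurable_times_ennreal borel_measurable_const borel_measurable_indicator) simp
  also have "\<dots> = (\<Sum>k. ennreal (2 * 2 ^ k) * ennreal (pi * ((1 / 2) ^ k)\<^sup>2))"
    by (intro suminf_cong) (simp add: nn_integral_cmult_indicator emeasure_ball_plane)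
  also have "\<dots> = (\<Sum>k. ennreal (2 * pi * (1 / 2) ^ k))"
  proof (intro suminf_cong)
    fix k :: nat
    have "2 * 2 ^ k * (pi * ((1 / 2) ^ k)\<^sup>2) = 2 * pi * (1 / 2 :: real) ^ k"
      by (simp add: power_divide power2_eq_square)
    then show "ennreal (2 * 2 ^ k) * ennreal (pi * ((1 / 2) ^ k)\<^sup>2) = ennreal (2 * pi * (1 / 2) ^ k)"
      by (subst ennreal_mult'[symmetric]) auto
  qed
  also have "\<dots> = ennreal (\<Sum>k. 2 * pi * (1 / 2) ^ k)"
    by (intro suminf_ennreal2) (auto intro!: summable_mult summable_geometric)
  also have "\<dots> < \<infinity>" by simp
  finally show "(\<integral>\<^sup>+x. ennreal (norm (Phi x * indicator (ball 0 1) x)) \<partial>lborel) < \<infinity>" .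
qed (auto intro!: borel_measurable_times borel_measurable_indicator)

definition Phi_mass :: real where "Phi_mass = (LBINT x. Phi x * indicator (ball 0 1) x)"

text \<open>Splitting at the unit circle: inside, the sup bound leaves the integrable singularity;
  outside, \<open>Phi\<close> is at most 1.\<close>

lemma Phi_le: "\<bar>a\<bar> \<le> B \<Longrightarrow> Phi y * \<bar>a\<bar> \<le> B * (Phi y * indicator (ball 0 1) y) + \<bar>a\<bar>"
proof (cases "norm y < 1")
  case True
  assume "\<bar>a\<bar> \<le> B"
  then have "Phi y * \<bar>a\<bar> \<le> Phi y * B" by (intro mult_left_mono Phi_nonneg)
  then show ?thesis using True by (simp add: mult.commute)
next
  case False
  have "1 * 1 \<le> 2 * pi * norm y" using pi_gt3 False by (intro mult_mono) auto
  then have "Phi y \<le> 1 / 1" unfolding Phi_def by (intro divide_left_mono) auto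
  then have "Phi y \<le> 1" by simp
  then have "Phi y * \<bar>a\<bar> \<le> 1 * \<bar>a\<bar>" by (intro mult_right_mono) auto
  then show ?thesis using False by simp
qed

lemma Phi_integrable:
  assumes "integrable lborel g" "\<And>x. \<bar>g x\<bar> \<le> B"
  shows "integrable lborel (\<lambda>y. Phi y * g (x - y))"
    and "(LBINT y. Phi y * \<bar>g (x - y)\<bar>) \<le> B * Phi_mass + (LBINT y. \<bar>g y\<bar>)"
proof -
  have [measurable]: "g \<in> borel_measurable borel" using assms by auto
  have gi: "integrable lborel (\<lambda>y. g (x - y))" using assms(1) by (simp add: integrable_lborel_reflect)
  have wi: "integrable lborel (\<lambda>y. B * (Phi y * indicator (ball 0 1) y) + \<bar>g (x - y)\<bar>)"
    using gi integrable_Phi_ball by simp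
  show "integrable lborel (\<lambda>y. Phi y * g (x - y))"
  proof (rule Bochner_Integration.integrable_bound[OF wi])
    show "AE y in lborel. norm (Phi y * g (x - y)) \<le> norm (B * (Phi y * indicator (ball 0 1) y) + \<bar>g (x - y)\<bar>)"
    proof (rule AE_I2)
      fix y
      show "norm (Phi y * g (x - y)) \<le> norm (B * (Phi y * indicator (ball 0 1) y) + \<bar>g (x - y)\<bar>)"
        using Phi_le[OF assms(2)[of "x - y"], of y] Phi_nonneg[of y] by (simp add: abs_mult)
    qed
  qed measurable
  have "(LBINT y. Phi y * \<bar>g (x - y)\<bar>) \<le> (LBINT y. B * (Phi y * indicator (ball 0 1) y) + \<bar>g (x - y)\<bar>)"
    using Phi_le[OF assms(2)] Phi_nonneg order_trans[OF abs_ge_zero assms(2)[of 0]]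
    by (intro integral_mono_AE' AE_I2 wi) auto
  also have "\<dots> = B * Phi_mass + (LBINT y. \<bar>g y\<bar>)"
    using gi integrable_Phi_ball integral_lborel_reflect[of "\<lambda>y. \<bar>g y\<bar>" x]
    by (subst Bochner_Integration.integral_add) (simp_all add: Phi_mass_def)
  finally show "(LBINT y. Phi y * \<bar>g (x - y)\<bar>) \<le> B * Phi_mass + (LBINT y. \<bar>g y\<bar>)" .
qed

lemma Phi_integrable_kernel:
  assumes "kernel g" shows "integrable lborel (\<lambda>y. Phi y * g (x - y))"
proof -
  obtain B where "\<And>x. \<bar>g x\<bar> \<le> B" using kernel_boundedE[OF assms] by auto
  then show ?thesis by (intro Phi_integrable(1)[of g B] kernel_integrable assms)
qed

lemma decay_local:
  fixes x h :: "real^2"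
  assumes "\<And>x. norm (g x) \<le> C / (1 + norm x) ^ 3" "C > 0" "norm h \<le> 1"
  shows "norm (g (x + h)) \<le> (C * 8) / (1 + norm x) ^ 3"
proof -
  have "norm (g (x + h)) \<le> C * (1 + norm h) ^ 3 / (1 + norm x) ^ 3"
    using order_trans[OF assms(1) decay_shift] assms(2) by simp
  also have "\<dots> \<le> C * 2 ^ 3 / (1 + norm x) ^ 3"
    using assms(2,3) by (intro divide_right_mono mult_left_mono power_mono) auto
  finally show ?thesis by simp
qed

lemma kernel_inverse_cube: "kernel (\<lambda>x. C / (1 + norm x) ^ 3)"
proof (rule kernelI[where C="\<bar>C\<bar>"])
  have nz: "1 + norm x \<noteq> 0" for x :: "real^2" using norm_ge_zero[of x] by linarith
  then show "continuous_on UNIV (\<lambda>x::real^2. C / (1 + norm x) ^ 3)"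
    by (intro continuous_intros) simp
  show "norm (C / (1 + norm x) ^ 3) \<le> \<bar>C\<bar> / (1 + norm x) ^ 3" for x :: "real^2"
    by (simp add: abs_divide)
qed

lemma continuous_on_Riesz: assumes "kernel f" shows "continuous_on UNIV (Riesz f)"
proof -
  obtain C where C: "C > 0" "\<And>x. norm (f x) \<le> C / (1 + norm x) ^ 3" using kernelE[OF assms] by blast
  have "continuous_on (ball x0 1) (Riesz f)" for x0
    unfolding Riesz_def
  proof (rule continuous_on_integral_param[where w="\<lambda>y. Phi y * (C * 8 / (1 + norm (x0 - y)) ^ 3)"])
    have [measurable]: "f \<in> borel_measurable borel" by (rule kernel_measurable[OF assms])
    show "(\<lambda>y. Phi y * f (x - y)) \<in> borel_measurable borel" for x by measurable
    show "continuous_on (ball x0 1) (\<lambda>x. Phi y * f (x - y))" for y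
      by (intro continuous_intros continuous_on_compose2[OF kernel_continuous[OF assms, of UNIV]]) auto
    show "integrable lborel (\<lambda>y. Phi y * (C * 8 / (1 + norm (x0 - y)) ^ 3))"
      by (rule Phi_integrable_kernel[OF kernel_inverse_cube])
    fix x y assume "x \<in> ball x0 1"
    then have "norm (f ((x0 - y) + (x - x0))) \<le> C * 8 / (1 + norm (x0 - y)) ^ 3"
      using C by (intro decay_local) (auto simp: dist_norm norm_minus_commute)
    from mult_left_mono[OF this Phi_nonneg[of y]]
    show "norm (Phi y * f (x - y)) \<le> Phi y * (C * 8 / (1 + norm (x0 - y)) ^ 3)"
      by (simp add: abs_mult Phi_nonneg)
  qed
  then have "isCont (Riesz f) x" for x
    by (metis centre_in_ball continuous_on_eq_continuous_at open_ball zero_less_one)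
  then show ?thesis by (simp add: continuous_at_imp_continuous_on)
qed

text \<open>The derivative must fall on \<open>f\<close>, because the gradient of \<open>Phi\<close>
  is of order |x|^(-2) and not locally integrable in the plane. The difference quotients of
  \<open>f\<close> keep the cubic decay for increments up to 1, which gives the majorant.\<close>

lemma has_pd_Riesz:
  assumes pd: "has_pd n f f'" and f: "kernel f" and f': "kernel f'"
  shows "has_pd n (Riesz f) (Riesz f')"
  unfolding has_pd_def has_real_derivative_iff_has_vector_derivative[symmetric] has_field_derivative_iff tendsto_at_iff_sequentially comp_def
proof (intro allI impI)
  fix x :: "real^2" and X :: "nat \<Rightarrow> real"
  let ?e = "axis n 1 :: real^2"
  assume "\<forall>i. X i \<in> UNIV - {0}" and X: "X \<longlonglongrightarrow> 0"
  then have X0: "X i \<noteq> 0" for i by auto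
  from X obtain N where N: "\<And>i. i \<ge> N \<Longrightarrow> \<bar>X i\<bar> \<le> 1"
    using LIMSEQ_D[OF X, of 1] by (auto intro: less_imp_le)
  obtain C where C: "C > 0" "\<And>x. norm (f' x) \<le> C / (1 + norm x) ^ 3" using kernelE[OF f'] by blast
  have [measurable]: "f \<in> borel_measurable borel" "f' \<in> borel_measurable borel" using kernel_measurable f f' by auto
  have "(\<lambda>i. LBINT y. Phi y * ((f (x - y + X (i + N) *\<^sub>R ?e) - f (x - y)) /\<^sub>R X (i + N))) \<longlonglongrightarrow> (LBINT y. Phi y * f' (x - y))"
  proof (rule integral_dominated_convergence[where w="\<lambda>y. Phi y * (C * 8 / (1 + norm (x - y)) ^ 3)"])
    show "integrable lborel (\<lambda>y. Phi y * (C * 8 / (1 + norm (x - y)) ^ 3))"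
      by (rule Phi_integrable_kernel[OF kernel_inverse_cube])
    show "AE y in lborel. (\<lambda>i. Phi y * ((f (x - y + X (i + N) *\<^sub>R ?e) - f (x - y)) /\<^sub>R X (i + N))) \<longlonglongrightarrow> Phi y * f' (x - y)"
    proof (intro AE_I2 tendsto_mult tendsto_const)
      fix y
      have "((\<lambda>h. (f (x - y + h *\<^sub>R ?e) - f (x - y)) /\<^sub>R h) \<longlongrightarrow> f' (x - y)) (at 0)"
        using pd unfolding has_pd_def by (intro has_vector_derivative_quotient) auto
      moreover have "filterlim (\<lambda>i. X (i + N)) (at 0) sequentially"
        using LIMSEQ_ignore_initial_segment[OF X] X0 by (intro filterlim_atI) auto
      ultimately show "(\<lambda>i. (f (x - y + X (i + N) *\<^sub>R ?e) - f (x - y)) /\<^sub>R X (i + N)) \<longlonglongrightarrow> f' (x - y)"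
        by (rule filterlim_compose)
    qed
    show "AE y in lborel. norm (Phi y * ((f (x - y + X (i + N) *\<^sub>R ?e) - f (x - y)) /\<^sub>R X (i + N))) \<le> Phi y * (C * 8 / (1 + norm (x - y)) ^ 3)" for i
    proof (rule AE_I2)
      fix y
      have "norm (f (x - y + X (i + N) *\<^sub>R ?e) - f (x - y)) \<le> (C * 8 / (1 + norm (x - y)) ^ 3) * \<bar>X (i + N)\<bar>"
      proof (rule has_pd_lipschitz[OF pd])
        fix s assume "s \<in> closed_segment 0 (X (i + N))"
        then have "\<bar>s\<bar> \<le> 1" using N[of "i + N"] by (auto simp: closed_segment_eq_real_ivl split: if_splits)
        then show "norm (f' (x - y + s *\<^sub>R ?e)) \<le> C * 8 / (1 + norm (x - y)) ^ 3"
          by (intro decay_local C) simp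
      qed
      then have "norm ((f (x - y + X (i + N) *\<^sub>R ?e) - f (x - y)) /\<^sub>R X (i + N)) \<le> C * 8 / (1 + norm (x - y)) ^ 3"
        using X0[of "i + N"] by (simp add: abs_mult field_simps)
      from mult_left_mono[OF this Phi_nonneg[of y]]
      show "norm (Phi y * ((f (x - y + X (i + N) *\<^sub>R ?e) - f (x - y)) /\<^sub>R X (i + N))) \<le> Phi y * (C * 8 / (1 + norm (x - y)) ^ 3)"
        by (simp only: norm_mult real_norm_def abs_mult abs_of_nonneg[OF Phi_nonneg])
    qed
  qed measurable
  moreover have "(LBINT y. Phi y * ((f (x - y + X i *\<^sub>R ?e) - f (x - y)) /\<^sub>R X i)) = (Riesz f (x + X i *\<^sub>R ?e) - Riesz f (x + 0 *\<^sub>R ?e)) / (X i - 0)" for i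
  proof -
    have "(Riesz f (x + X i *\<^sub>R ?e) - Riesz f x) / X i = (LBINT y. (Phi y * f (x + X i *\<^sub>R ?e - y) - Phi y * f (x - y)) / X i)"
      unfolding Riesz_def by (subst integral_divide_zero, subst Bochner_Integration.integral_diff) (auto intro: Phi_integrable_kernel f)
    also have "\<dots> = (LBINT y. Phi y * ((f (x - y + X i *\<^sub>R ?e) - f (x - y)) /\<^sub>R X i))"
    proof (intro Bochner_Integration.integral_cong refl)
      fix y
      have e: "x + X i *\<^sub>R ?e - y = x - y + X i *\<^sub>R ?e" by simp
      show "(Phi y * f (x + X i *\<^sub>R ?e - y) - Phi y * f (x - y)) / X i = Phi y * ((f (x - y + X i *\<^sub>R ?e) - f (x - y)) /\<^sub>R X i)"
        unfolding e by (simp add: divide_inverse right_diff_distrib[symmetric] mult_ac)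
    qed
    finally show ?thesis by simp
  qed
  ultimately have "(\<lambda>i. (Riesz f (x + X (i + N) *\<^sub>R ?e) - Riesz f (x + 0 *\<^sub>R ?e)) / (X (i + N) - 0)) \<longlonglongrightarrow> Riesz f' x"
    by (simp only: Riesz_def)
  then show "(\<lambda>i. (Riesz f (x + X i *\<^sub>R ?e) - Riesz f (x + 0 *\<^sub>R ?e)) / (X i - 0)) \<longlonglongrightarrow> Riesz f' x"
    by (rule LIMSEQ_offset)
qed

text \<open>Second order Taylor expansion of \<open>Phi\<close> at \<open>x\<close>, with a bound that is uniform in \<open>y\<close>.\<close>

lemma Phi_taylor:
  assumes "x \<noteq> 0" "y \<noteq> x"
  shows "norm x ^ 3 * \<bar>Phi (x - y) - Phi x - (x \<bullet> y) / (2 * pi * norm x ^ 3)\<bar>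
    \<le> 3 * ((norm y)\<^sup>2 / (2 * pi) + norm y ^ 3 * Phi (x - y))"
proof -
  define r where "r = norm x"
  define a where "a = norm (x - y)"
  define p where "p = x \<bullet> y"
  define s where "s = norm y"
  have pos: "r > 0" "a > 0" "s \<ge> 0" using assms by (auto simp: r_def a_def s_def)
  have a2: "a\<^sup>2 = r\<^sup>2 - 2 * p + s\<^sup>2"
    by (simp add: a_def r_def s_def p_def power2_norm_eq_inner inner_diff inner_commute algebra_simps)
  have ps: "\<bar>p\<bar> \<le> r * s" unfolding p_def r_def s_def by (rule Cauchy_Schwarz_ineq2)
  have ra: "\<bar>r - a\<bar> \<le> s"
    using norm_triangle_ineq3[of x "x - y"] by (simp add: r_def a_def s_def)
  \<comment> \<open>The difference of reciprocals is rationalised by means of \<open>a2\<close>.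
    After subtraction of the linear term, what is left of the part in \<open>p\<close> contains the
    factor \<open>r - a\<close>, which is bounded by \<open>s\<close>, so both summands are of
    second order in \<open>s\<close>.\<close>
  have e1: "1 / a - 1 / r - p / r ^ 3 = p * (r - a) * (2 * r + a) / (a * r ^ 3 * (a + r)) - s\<^sup>2 / (a * r * (a + r))"
  proof -
    have "1 / a - 1 / r = (r\<^sup>2 - a\<^sup>2) / (a * r * (a + r))"
      using pos by (simp add: divide_simps) (simp add: power2_eq_square algebra_simps)
    also have "\<dots> = (2 * p - s\<^sup>2) / (a * r * (a + r))" by (simp add: a2)
    finally have *: "1 / a - 1 / r = 2 * p / (a * r * (a + r)) - s\<^sup>2 / (a * r * (a + r))" by (simp add: diff_divide_distrib)
    have "2 * p / (a * r * (a + r)) - p / r ^ 3 = p * (r - a) * (2 * r + a) / (a * r ^ 3 * (a + r))"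
      using pos by (simp add: divide_simps) (simp add: power2_eq_square power3_eq_cube algebra_simps)
    then show ?thesis using * by simp
  qed
  have b1: "\<bar>p * (r - a) * (2 * r + a) / (a * r ^ 3 * (a + r))\<bar> \<le> 2 * s\<^sup>2 / (a * r\<^sup>2)"
  proof -
    have "\<bar>p * (r - a) * (2 * r + a) / (a * r ^ 3 * (a + r))\<bar> = (\<bar>p\<bar> * \<bar>r - a\<bar>) * (2 * r + a) / (a * r ^ 3 * (a + r))"
      using pos by (simp add: abs_mult abs_divide)
    also have "\<dots> \<le> ((r * s) * s) * (2 * (a + r)) / (a * r ^ 3 * (a + r))"
      using pos ps ra by (intro divide_right_mono mult_mono) auto
    also have "\<dots> = 2 * s\<^sup>2 / (a * r\<^sup>2)"
      using pos by (simp add: divide_simps) (simp add: power2_eq_square power3_eq_cube)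
    finally show ?thesis .
  qed
  have b2: "\<bar>s\<^sup>2 / (a * r * (a + r))\<bar> \<le> s\<^sup>2 / (a * r\<^sup>2)"
  proof -
    have "s\<^sup>2 / (a * r * (a + r)) \<le> s\<^sup>2 / (a * r * r)"
      using pos by (intro divide_left_mono mult_left_mono) auto
    then show ?thesis using pos by (simp add: power2_eq_square mult.assoc)
  qed
  have "\<bar>1 / a - 1 / r - p / r ^ 3\<bar> \<le> 3 * s\<^sup>2 / (a * r\<^sup>2)"
    unfolding e1 using b1 b2 abs_triangle_ineq4[of "p * (r - a) * (2 * r + a) / (a * r ^ 3 * (a + r))" "s\<^sup>2 / (a * r * (a + r))"]
    by (simp add: add_divide_distrib[symmetric])
  then have "r ^ 3 * \<bar>1 / a - 1 / r - p / r ^ 3\<bar> \<le> r ^ 3 * (3 * s\<^sup>2 / (a * r\<^sup>2))"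
    using pos by (intro mult_left_mono) auto
  also have "\<dots> = 3 * s\<^sup>2 * r / a" using pos by (simp add: divide_simps power2_eq_square power3_eq_cube)
  \<comment> \<open>Replacing the spare factor \<open>r\<close> by \<open>a + s\<close> keeps the
    bound useful for \<open>y\<close> near \<open>x\<close>: the price is the term s^3 / a, whose
    singularity is integrable.\<close>
  also have "\<dots> \<le> 3 * s\<^sup>2 * (a + s) / a" using pos ra by (intro divide_right_mono mult_left_mono) auto
  also have "\<dots> = 3 * (s\<^sup>2 + s ^ 3 / a)" using pos by (simp add: divide_simps) (simp add: power2_eq_square power3_eq_cube algebra_simps)
  finally have main: "r ^ 3 * \<bar>1 / a - 1 / r - p / r ^ 3\<bar> \<le> 3 * (s\<^sup>2 + s ^ 3 / a)" .
  have "r ^ 3 * \<bar>Phi (x - y) - Phi x - p / (2 * pi * r ^ 3)\<bar> = (r ^ 3 * \<bar>1 / a - 1 / r - p / r ^ 3\<bar>) / (2 * pi)"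
  proof -
    have "Phi (x - y) - Phi x - p / (2 * pi * r ^ 3) = (1 / a - 1 / r - p / r ^ 3) / (2 * pi)"
      by (simp add: Phi_def a_def r_def diff_divide_distrib mult_ac)
    then show ?thesis by (simp add: abs_divide)
  qed
  also have "\<dots> \<le> (3 * (s\<^sup>2 + s ^ 3 / a)) / (2 * pi)" by (intro divide_right_mono main) auto
  also have "\<dots> = 3 * (s\<^sup>2 / (2 * pi) + s ^ 3 * Phi (x - y))" by (simp add: Phi_def a_def add_divide_distrib)
  finally show ?thesis unfolding r_def p_def s_def .
qed

text \<open>The cancellations of \<open>f\<close> remove the first two terms of the expansion of \<open>Phi\<close> at infinity.\<close>

lemma kernel_Riesz:
  assumes f: "rapid f" and m0: "(LBINT y. f y) = 0" and m1: "\<And>i. (LBINT y. y $ i * f y) = 0"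
  shows "kernel (Riesz f)"
proof -
  have k: "kernel f" by (rule rapid_kernel[OF f])
  have fi: "integrable lborel f" by (rule kernel_integrable[OF k])
  have [measurable]: "f \<in> borel_measurable borel" by (rule kernel_measurable[OF k])
  have k2: "kernel (\<lambda>y. (norm y)\<^sup>2 * \<bar>f y\<bar>)" and k3: "kernel (\<lambda>y. norm y ^ 3 * \<bar>f y\<bar>)" and k1: "kernel (\<lambda>y. y $ i * f y)" for i
  proof -
    have "rapid (\<lambda>y. (norm y) ^ n * f y)" for n
      by (rule rapid_mult_growth[OF f, of _ 1 n]) (auto intro!: continuous_intros power_mono)
    then have "kernel (\<lambda>y. norm y ^ n * f y)" for n by (rule rapid_kernel)
    then have *: "kernel (\<lambda>y. norm y ^ n * \<bar>f y\<bar>)" for n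
    proof -
      assume *: "\<And>n. kernel (\<lambda>y. norm y ^ n * f y)"
      have "continuous_on UNIV (\<lambda>y. norm y ^ n * \<bar>f y\<bar>)"
        by (intro continuous_intros kernel_continuous[OF k])
      then show ?thesis using *[of n] unfolding kernel_def by (simp add: abs_mult)
    qed
    then show "kernel (\<lambda>y. (norm y)\<^sup>2 * \<bar>f y\<bar>)" "kernel (\<lambda>y. norm y ^ 3 * \<bar>f y\<bar>)" by blast+
    have "rapid (\<lambda>y. y $ i * f y)"
      by (rule rapid_mult_growth[OF f, of _ 1 1]) (auto intro!: continuous_intros order_trans[OF component_le_norm_cart])
    then show "kernel (\<lambda>y. y $ i * f y)" by (rule rapid_kernel)
  qed
  obtain B where B: "\<And>x. \<bar>f x\<bar> \<le> B" using kernel_boundedE[OF k] by auto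
  obtain B3 where B3: "\<And>x. \<bar>norm x ^ 3 * \<bar>f x\<bar>\<bar> \<le> B3" using kernel_boundedE[OF k3] by auto
  \<comment> \<open>\<open>M0\<close> bounds the potential itself and \<open>M3\<close> its product
    with |x|^3; together they give the cubic decay with the factor 2^3 of
    \<open>one_plus_power_le\<close>.\<close>
  define M0 where "M0 = B * Phi_mass + (LBINT y. \<bar>f y\<bar>)"
  define M3 where "M3 = 3 * ((LBINT y. (norm y)\<^sup>2 * \<bar>f y\<bar>) / (2 * pi) + (B3 * Phi_mass + (LBINT y. \<bar>norm y ^ 3 * \<bar>f y\<bar>\<bar>)))"
  have b0: "\<bar>Riesz f x\<bar> \<le> M0" for x
  proof -
    have "\<bar>Riesz f x\<bar> \<le> (LBINT y. Phi y * \<bar>f (x - y)\<bar>)"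
      unfolding Riesz_def using integral_norm_bound[of lborel "\<lambda>y. Phi y * f (x - y)"] Phi_nonneg by (simp add: abs_mult)
    also have "\<dots> \<le> M0" unfolding M0_def by (rule Phi_integrable(2)[OF fi B])
    finally show ?thesis .
  qed
  have b3: "norm x ^ 3 * \<bar>Riesz f x\<bar> \<le> M3" for x
  proof (cases "x = 0")
    case True
    have "0 \<le> M3" unfolding M3_def
      using order_trans[OF abs_ge_zero B3[of 0]] Phi_nonneg
      by (intro mult_nonneg_nonneg add_nonneg_nonneg divide_nonneg_nonneg integral_nonneg) (auto simp: Phi_mass_def intro!: integral_nonneg)
    then show ?thesis using True by simp
  next
    case False
    let ?T = "\<lambda>y. Phi (x - y) - Phi x - (x \<bullet> y) / (2 * pi * norm x ^ 3)"
    have xy: "x \<bullet> y = (\<Sum>i\<in>UNIV. x $ i * y $ i)" for y by (simp add: inner_vec_def)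
    have ixy: "integrable lborel (\<lambda>y. (x \<bullet> y) * f y)" and exy: "(LBINT y. (x \<bullet> y) * f y) = 0"
      unfolding xy sum_distrib_right mult.assoc using kernel_integrable[OF k1] m1 by simp_all
    have iP: "integrable lborel (\<lambda>y. Phi (x - y) * f y)"
      using Phi_integrable(1)[OF fi B, of x] integrable_lborel_reflect[of "\<lambda>y. Phi y * f (x - y)" x] by simp
    have "Riesz f x = (LBINT y. Phi (x - y) * f y)"
      unfolding Riesz_def using integral_lborel_reflect[of "\<lambda>y. Phi y * f (x - y)" x] by simp
    also have "\<dots> = (LBINT y. ?T y * f y)"
    proof -
      have "(LBINT y. ?T y * f y) = (LBINT y. Phi (x - y) * f y - Phi x * f y - (1 / (2 * pi * norm x ^ 3)) * ((x \<bullet> y) * f y))"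
        by (intro Bochner_Integration.integral_cong refl) (simp add: algebra_simps)
      also have "\<dots> = (LBINT y. Phi (x - y) * f y)"
        using ixy exy iP fi m0 by simp
      finally show ?thesis ..
    qed
    finally have "norm x ^ 3 * \<bar>Riesz f x\<bar> = \<bar>LBINT y. norm x ^ 3 * (?T y * f y)\<bar>" by (simp add: abs_mult)
    also have "\<dots> \<le> (LBINT y. \<bar>norm x ^ 3 * (?T y * f y)\<bar>)"
      using integral_norm_bound[of lborel "\<lambda>y. norm x ^ 3 * (?T y * f y)"] by simp
    also have "\<dots> \<le> (LBINT y. 3 * (((norm y)\<^sup>2 * \<bar>f y\<bar>) / (2 * pi) + Phi (x - y) * (norm y ^ 3 * \<bar>f y\<bar>)))"
    proof (rule integral_mono_AE')
      have "integrable lborel (\<lambda>y. Phi (x - y) * (norm y ^ 3 * \<bar>f y\<bar>))"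
        using Phi_integrable_kernel[OF k3, of x] integrable_lborel_reflect[of "\<lambda>y. Phi y * (norm (x - y) ^ 3 * \<bar>f (x - y)\<bar>)" x] by simp
      then show "integrable lborel (\<lambda>y. 3 * (((norm y)\<^sup>2 * \<bar>f y\<bar>) / (2 * pi) + Phi (x - y) * (norm y ^ 3 * \<bar>f y\<bar>)))"
        using kernel_integrable[OF k2] by simp
      have "AE y in lborel. y \<noteq> x" by (rule AE_lborel_singleton)
      then show "AE y in lborel. \<bar>norm x ^ 3 * (?T y * f y)\<bar> \<le> 3 * (((norm y)\<^sup>2 * \<bar>f y\<bar>) / (2 * pi) + Phi (x - y) * (norm y ^ 3 * \<bar>f y\<bar>))"
      proof eventually_elim
        fix y assume "y \<noteq> x"
        from mult_right_mono[OF Phi_taylor[OF False this] abs_ge_zero[of "f y"]]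
        have "norm x ^ 3 * \<bar>?T y\<bar> * \<bar>f y\<bar> \<le> 3 * ((norm y)\<^sup>2 / (2 * pi) + norm y ^ 3 * Phi (x - y)) * \<bar>f y\<bar>" .
        moreover have "\<bar>norm x ^ 3 * (t * f y)\<bar> = norm x ^ 3 * \<bar>t\<bar> * \<bar>f y\<bar>" for t
          by (simp add: abs_mult)
        moreover have "3 * ((norm y)\<^sup>2 / (2 * pi) + norm y ^ 3 * P) * \<bar>f y\<bar> = 3 * (((norm y)\<^sup>2 * \<bar>f y\<bar>) / (2 * pi) + P * (norm y ^ 3 * \<bar>f y\<bar>))" for P
          by (simp add: field_simps)
        ultimately show "\<bar>norm x ^ 3 * (?T y * f y)\<bar> \<le> 3 * (((norm y)\<^sup>2 * \<bar>f y\<bar>) / (2 * pi) + Phi (x - y) * (norm y ^ 3 * \<bar>f y\<bar>))"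
          by (simp only:)
      qed
      show "AE y in lborel. 0 \<le> 3 * (((norm y)\<^sup>2 * \<bar>f y\<bar>) / (2 * pi) + Phi (x - y) * (norm y ^ 3 * \<bar>f y\<bar>))"
        by (intro AE_I2 mult_nonneg_nonneg add_nonneg_nonneg Phi_nonneg divide_nonneg_nonneg) auto
    qed
    also have "\<dots> = 3 * ((LBINT y. (norm y)\<^sup>2 * \<bar>f y\<bar>) / (2 * pi) + (LBINT y. Phi y * \<bar>norm (x - y) ^ 3 * \<bar>f (x - y)\<bar>\<bar>))"
    proof -
      have "integrable lborel (\<lambda>y. Phi (x - y) * (norm y ^ 3 * \<bar>f y\<bar>))"
        using Phi_integrable_kernel[OF k3, of x] integrable_lborel_reflect[of "\<lambda>y. Phi y * (norm (x - y) ^ 3 * \<bar>f (x - y)\<bar>)" x] by simp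
      moreover have "(LBINT y. Phi (x - y) * (norm y ^ 3 * \<bar>f y\<bar>)) = (LBINT y. Phi y * \<bar>norm (x - y) ^ 3 * \<bar>f (x - y)\<bar>\<bar>)"
        using integral_lborel_reflect[of "\<lambda>y. Phi y * \<bar>norm (x - y) ^ 3 * \<bar>f (x - y)\<bar>\<bar>" x] by (simp add: abs_mult)
      ultimately show ?thesis using kernel_integrable[OF k2] by simp
    qed
    also have "\<dots> \<le> M3"
      unfolding M3_def using Phi_integrable(2)[OF kernel_integrable[OF k3] B3, of x] by (intro mult_left_mono add_left_mono) auto
    finally show ?thesis .
  qed
  have "norm (Riesz f x) \<le> (8 * (M0 + M3)) / (1 + norm x) ^ 3" for x
  proof -
    have "\<bar>Riesz f x\<bar> * (1 + norm x) ^ 3 \<le> \<bar>Riesz f x\<bar> * (2 ^ 3 * (1 + norm x ^ 3))"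
      by (intro mult_left_mono one_plus_power_le) auto
    also have "\<dots> \<le> 8 * (M0 + M3)" using b0[of x] b3[of x] by (simp add: algebra_simps)
    finally show ?thesis by (simp add: pos_le_divide_eq add_pos_nonneg)
  qed
  then show ?thesis by (intro kernelI[OF continuous_on_Riesz[OF k]])
qed


section \<open>The kernel of the constitutive law and its mollifications\<close>

text \<open>This supplies the moments for \<open>kernel_Riesz\<close>: a derivative has mean zero,
  and its first moments reduce to the mean of the function. So one derivative is enough if the
  function has mean zero, and two are always enough.\<close>

lemma integral_schwartz_pd:
  assumes "schwartz f"
  shows "(LBINT y. pd n f y) = 0" "(LBINT y. y $ i * pd n f y) = - (if i = n then LBINT y. f y else 0)"
proof -
  have k: "kernel f" "kernel (pd n f)" using assms schwartz_pd schwartz_kernel by auto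
  have r: "rapid f" "rapid (pd n f)" using assms schwartz_pd schwartz_rapid by auto
  show "(LBINT y. pd n f y) = 0"
    by (rule integral_has_pd_eq_0[OF schwartz_has_pd[OF assms] k])
  have m: "kernel (\<lambda>y. y $ i * g y)" if "rapid g" for g
    by (intro rapid_kernel rapid_mult_growth[OF that, of _ 1 1])
       (auto intro!: continuous_intros order_trans[OF component_le_norm_cart])
  have k': "kernel (\<lambda>x. (if i = n then 1 else 0) * f x)" by (rule kernel_mult_left[OF k(1)])
  have "(LBINT y. y $ i * pd n f y + (if i = n then 1 else 0) * f y) = 0"
    by (rule integral_has_pd_eq_0[OF has_pd_mult[OF has_pd_nth schwartz_has_pd[OF assms]] m[OF r(1)] kernel_add[OF m[OF r(2)] k']])
  then show "(LBINT y. y $ i * pd n f y) = - (if i = n then LBINT y. f y else 0)"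
    using kernel_integrable[OF m[OF r(2)]] kernel_integrable[OF k'] by (auto split: if_splits)
qed

lemma Riesz_add: "kernel f \<Longrightarrow> kernel g \<Longrightarrow> Riesz (\<lambda>x. f x + g x) x = Riesz f x + Riesz g x"
  unfolding Riesz_def distrib_left by (intro Bochner_Integration.integral_add Phi_integrable_kernel)

lemma Riesz_mult_left: "Riesz (\<lambda>x. c * f x) x = c * Riesz f x"
  unfolding Riesz_def by (subst integral_mult_right_zero[symmetric]) (simp add: mult_ac)

lemma Riesz_dilate: "Riesz (dilate f j) x = 2 powi j * Riesz f (2 powi j *\<^sub>R x)"
proof -
  let ?c = "2 powi j :: real"
  have "Riesz (dilate f j) x = (1 / ?c)\<^sup>2 * (LBINT z. Phi ((1 / ?c) *\<^sub>R z) * (?c\<^sup>2 * f (?c *\<^sub>R (x - (1 / ?c) *\<^sub>R z))))"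
    unfolding Riesz_def dilate_eq using integral_lborel_affine[of "1 / ?c" "\<lambda>y. Phi y * (?c\<^sup>2 * f (?c *\<^sub>R (x - y)))" 0]
    by (simp add: power_int_abs power_divide)
  also have "\<dots> = (LBINT z. ?c * (Phi z * f (?c *\<^sub>R x - z)))"
    by (subst integral_mult_right_zero[symmetric])
       (simp add: Phi_def power_int_abs power_divide scaleR_diff_right mult_ac)
  finally show ?thesis by (simp add: Riesz_def)
qed

text \<open>The function \<open>\<psi> * K\<close>, with the derivatives of \<open>K\<close> moved to \<open>\<psi>\<close>.\<close>

definition mollK :: "(real^2 \<Rightarrow> real) \<Rightarrow> real^2 \<Rightarrow> real^2" where
  "mollK \<psi> x = Riesz (pd 1 \<psi>) x *\<^sub>R axis 2 1 - Riesz (pd 2 \<psi>) x *\<^sub>R axis 1 1"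

lemma vector_2_axis: "(vector [a, b] :: real^2) = a *\<^sub>R axis 1 1 + b *\<^sub>R axis 2 1"
  by (simp add: vec_eq_iff forall_2 axis_def)

text \<open>The sign of the distributional derivative in \<open>K\<close> cancels the sign from
  reflecting the test function. The form with \<open>has_pd\<close> also covers
  \<open>laplacian \<psi>\<close>, whose derivatives are given as sums.\<close>

lemma mollify_K_pd:
  assumes "\<And>n. has_pd n \<psi> (\<psi>' n)" "\<And>n. kernel (\<psi>' n)"
  shows "mollify \<psi> K x = Riesz (\<psi>' 1) x *\<^sub>R axis 2 1 - Riesz (\<psi>' 2) x *\<^sub>R axis 1 1"
proof -
  have "grad_perp (\<lambda>y. \<psi> (x - y)) y = \<psi>' 2 (x - y) *\<^sub>R axis 1 1 - \<psi>' 1 (x - y) *\<^sub>R axis 2 1" for y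
    unfolding grad_perp_def vector_2_axis has_pd_imp_pd[OF has_pd_reflect[OF assms(1)]] by simp
  then have "mollify \<psi> K x = - (LBINT y. (Phi y * \<psi>' 2 (x - y)) *\<^sub>R axis 1 1 - (Phi y * \<psi>' 1 (x - y)) *\<^sub>R axis 2 1)"
    by (simp add: mollify_def K_def scaleR_diff_right)
  also have "\<dots> = Riesz (\<psi>' 1) x *\<^sub>R axis 2 1 - Riesz (\<psi>' 2) x *\<^sub>R axis 1 1"
    using Phi_integrable_kernel[OF assms(2)] by (simp add: Riesz_def)
  finally show ?thesis .
qed

lemma mollify_K: "schwartz \<psi> \<Longrightarrow> mollify \<psi> K = mollK \<psi>"
  by (rule ext) (simp add: mollK_def mollify_K_pd[of \<psi> "\<lambda>n. pd n \<psi>"] schwartz_has_pd schwartz_pd schwartz_kernel)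

lemma has_pd_mollK:
  assumes "schwartz \<psi>" shows "has_pd n (mollK \<psi>) (mollK (pd n \<psi>))"
proof -
  have "has_pd n (\<lambda>x. Riesz (pd 1 \<psi>) x *\<^sub>R axis 2 1 - Riesz (pd 2 \<psi>) x *\<^sub>R axis 1 1 :: real^2)
     (\<lambda>x. Riesz (pd n (pd 1 \<psi>)) x *\<^sub>R axis 2 1 - Riesz (pd n (pd 2 \<psi>)) x *\<^sub>R axis 1 1)"
    using assms by (intro has_pd_diff has_pd_linear[OF bounded_linear_scaleR_left] has_pd_Riesz schwartz_has_pd schwartz_pd schwartz_kernel)
  then show ?thesis
    unfolding mollK_def[abs_def] using schwartz_pd_commute[OF assms] by simp
qed

text \<open>Mean zero holds for the blocks \<open>dilate \<phi> j\<close> and for every derivative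
  \<open>pd n \<psi>\<close>, but not for the low-pass kernels, which have mean one.\<close>

lemma kernel_mollK:
  assumes "schwartz \<psi>" "(LBINT y. \<psi> y) = 0" shows "kernel (mollK \<psi>)"
proof -
  have "kernel (Riesz (pd n \<psi>))" for n
    using assms by (intro kernel_Riesz schwartz_rapid schwartz_pd) (auto simp: integral_schwartz_pd)
  then show ?thesis unfolding mollK_def[abs_def] by (intro kernel_diff kernel_scaleR_const)
qed

lemma mollK_add:
  assumes "schwartz \<psi>1" "schwartz \<psi>2" "\<And>x. \<psi> x = \<psi>1 x + \<psi>2 x"
  shows "mollK \<psi> x = mollK \<psi>1 x + mollK \<psi>2 x"
proof -
  have "\<psi> = (\<lambda>x. \<psi>1 x + \<psi>2 x)" using assms(3) by auto
  then have "pd n \<psi> = (\<lambda>x. pd n \<psi>1 x + pd n \<psi>2 x)" for n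
    using has_pd_imp_pd[OF has_pd_add[OF schwartz_has_pd schwartz_has_pd]] assms(1,2) by simp
  then show ?thesis
    using assms(1,2) by (simp add: mollK_def Riesz_add schwartz_pd schwartz_kernel scaleR_left_distrib)
qed

lemma pd_dilate: "schwartz \<psi> \<Longrightarrow> pd n (dilate \<psi> j) = (\<lambda>x. 2 powi j * dilate (pd n \<psi>) j x)"
  by (rule has_pd_imp_pd[OF has_pd_dilate[OF schwartz_has_pd]])

lemma pd_mult_left: "schwartz \<psi> \<Longrightarrow> pd n (\<lambda>x. c * \<psi> x) = (\<lambda>x. c * pd n \<psi> x)"
  by (rule has_pd_imp_pd[OF has_pd_linear[OF bounded_linear_mult_right schwartz_has_pd]])

lemma mollK_mult_left: "schwartz \<psi> \<Longrightarrow> mollK (\<lambda>x. c * \<psi> x) x = c *\<^sub>R mollK \<psi> x"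
  by (simp add: mollK_def pd_mult_left Riesz_mult_left scaleR_diff_right)

text \<open>K is homogeneous of degree -2, so its mollification is dilated in the way that preserves
  the L1 norm.\<close>

lemma mollK_dilate: "schwartz \<psi> \<Longrightarrow> mollK (dilate \<psi> j) x = (2 powi j)\<^sup>2 *\<^sub>R mollK \<psi> (2 powi j *\<^sub>R x)"
  by (simp add: mollK_def pd_dilate Riesz_mult_left Riesz_dilate scaleR_diff_right power2_eq_square mult.assoc)

text \<open>The function \<open>\<psi> * \<Delta>K\<close>.\<close>

definition mollLapK :: "(real^2 \<Rightarrow> real) \<Rightarrow> real^2 \<Rightarrow> real^2" where
  "mollLapK \<psi> x = (\<Sum>i\<in>UNIV. mollK (pd i (pd i \<psi>)) x)"

lemma mollify_laplacian_K:
  assumes "schwartz \<psi>" shows "mollify \<psi> (laplacian_distr K) = mollLapK \<psi>"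
proof
  fix x
  have s: "has_pd n (pd i f) (pd n (pd i f))" "has_pd n f (pd n f)" if "schwartz f" for f n i
    using that by (auto intro: schwartz_has_pd schwartz_pd)
  let ?L = "laplacian \<psi>"
  have p: "pd i (pd i (\<lambda>y. \<psi> (x - y))) = (\<lambda>y. pd i (pd i \<psi>) (x - y))" for i
  proof -
    have "pd i (\<lambda>y. \<psi> (x - y)) = (\<lambda>y. - pd i \<psi> (x - y))"
      by (rule has_pd_imp_pd[OF has_pd_reflect[OF s(2)[OF assms]]])
    moreover have "has_pd i (\<lambda>y. - pd i \<psi> (x - y)) (\<lambda>y. - (- pd i (pd i \<psi>) (x - y)))"
      by (intro has_pd_linear[OF bounded_linear_minus[OF bounded_linear_ident]] has_pd_reflect s assms)
    ultimately show ?thesis by (simp add: has_pd_imp_pd)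
  qed
  have "laplacian (\<lambda>y. \<psi> (x - y)) = (\<lambda>y. ?L (x - y))"
    by (rule ext) (simp add: laplacian_def p)
  then have "mollify \<psi> (laplacian_distr K) x = mollify ?L K x"
    by (simp add: mollify_def laplacian_distr_def)
  also have "\<dots> = Riesz (\<lambda>x. \<Sum>i\<in>UNIV. pd 1 (pd i (pd i \<psi>)) x) x *\<^sub>R axis 2 1 - Riesz (\<lambda>x. \<Sum>i\<in>UNIV. pd 2 (pd i (pd i \<psi>)) x) x *\<^sub>R axis 1 1"
    unfolding laplacian_def[abs_def] using assms
    by (intro mollify_K_pd has_pd_sum kernel_sum schwartz_has_pd schwartz_kernel schwartz_pd)
  also have "\<dots> = mollLapK \<psi> x"
    using assms by (simp add: mollLapK_def mollK_def sum_2 Riesz_add schwartz_pd schwartz_kernel scaleR_left_distrib)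
  finally show "mollify \<psi> (laplacian_distr K) x = mollLapK \<psi> x" .
qed

lemma kernel_mollLapK: "schwartz \<psi> \<Longrightarrow> kernel (mollLapK \<psi>)"
  unfolding mollLapK_def[abs_def] by (intro kernel_sum kernel_mollK schwartz_pd) (auto simp: integral_schwartz_pd schwartz_pd)

lemma kernel_mollK_pd: "schwartz \<psi> \<Longrightarrow> kernel (mollK (pd n \<psi>))"
  by (intro kernel_mollK schwartz_pd) (auto simp: integral_schwartz_pd)

lemma mollK_pd_add:
  assumes "schwartz \<psi>1" "schwartz \<psi>2" "\<And>x. \<psi> x = \<psi>1 x + \<psi>2 x"
  shows "mollK (pd n \<psi>) x = mollK (pd n \<psi>1) x + mollK (pd n \<psi>2) x" "mollLapK \<psi> x = mollLapK \<psi>1 x + mollLapK \<psi>2 x"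
proof -
  have p: "pd n f x = pd n g x + pd n h x" if "schwartz g" "schwartz h" "\<And>x. f x = g x + h x" for f g h n x
  proof -
    have "f = (\<lambda>x. g x + h x)" using that(3) by auto
    then show ?thesis using has_pd_imp_pd[OF has_pd_add[OF schwartz_has_pd[OF that(1), of n] schwartz_has_pd[OF that(2), of n]]] by simp
  qed
  show "mollK (pd n \<psi>) x = mollK (pd n \<psi>1) x + mollK (pd n \<psi>2) x"
    using assms by (intro mollK_add schwartz_pd p)
  show "mollLapK \<psi> x = mollLapK \<psi>1 x + mollLapK \<psi>2 x"
    unfolding mollLapK_def sum.distrib[symmetric] using assms by (intro sum.cong refl mollK_add schwartz_pd p)
qed

text \<open>Each derivative of K costs one more factor 2^j. The powers 3 and 4 exceed the
  L1-invariant power 2, so these kernels become small in L1 at low frequencies.\<close>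

lemma mollK_pd_dilate:
  assumes "schwartz \<psi>"
  shows "mollK (pd n (dilate \<psi> j)) x = (2 powi j) ^ 3 *\<^sub>R mollK (pd n \<psi>) (2 powi j *\<^sub>R x)"
    and "mollLapK (dilate \<psi> j) x = (2 powi j) ^ 4 *\<^sub>R mollLapK \<psi> (2 powi j *\<^sub>R x)"
proof -
  let ?c = "2 powi j :: real"
  show *: "mollK (pd n (dilate \<psi> j)) x = ?c ^ 3 *\<^sub>R mollK (pd n \<psi>) (?c *\<^sub>R x)"
    using assms by (simp add: pd_dilate mollK_mult_left schwartz_dilate schwartz_pd mollK_dilate power2_eq_square power3_eq_cube)
  have "pd i (pd i (dilate \<psi> j)) = (\<lambda>x. ?c * (?c * dilate (pd i (pd i \<psi>)) j x))" for i
    using assms by (simp add: pd_dilate pd_mult_left schwartz_dilate schwartz_pd)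
  then have "pd i (pd i (dilate \<psi> j)) = (\<lambda>x. ?c\<^sup>2 * dilate (pd i (pd i \<psi>)) j x)" for i
    by (simp add: power2_eq_square mult.assoc)
  then show "mollLapK (dilate \<psi> j) x = ?c ^ 4 *\<^sub>R mollLapK \<psi> (?c *\<^sub>R x)"
    using assms by (simp add: mollLapK_def mollK_mult_left schwartz_dilate schwartz_pd mollK_dilate scaleR_sum_right power_add[symmetric])
qed

lemma integral_norm_scaled:
  fixes F :: "real^2 \<Rightarrow> 'b::{banach,second_countable_topology}"
  assumes "c > 0" shows "(LBINT x. norm (F (c *\<^sub>R x))) = (LBINT x. norm (F x)) / c\<^sup>2"
  using integral_lborel_affine[of c "\<lambda>x. norm (F x)" 0] assms by simp

section \<open>Convolution of a kernel with a bounded function\<close>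

text \<open>Equal to \<^const>\<open>conv\<close>, but with the translation on the bounded factor, where the derivatives in
  space and time fall.\<close>

definition kconv :: "(real^2 \<Rightarrow> 'b::{banach,second_countable_topology}) \<Rightarrow> (real^2 \<Rightarrow> real) \<Rightarrow> real^2 \<Rightarrow> 'b" where
  "kconv G f x = (LBINT y. f (x - y) *\<^sub>R G y)"

lemma conv_eq_kconv: "conv G f x = kconv G f x"
  unfolding conv_def kconv_def using integral_lborel_reflect[of "\<lambda>y. f y *\<^sub>R G (x - y)" x] by simp

lemma kconv_integrable:
  fixes G :: "real^2 \<Rightarrow> 'b::{banach,second_countable_topology}"
  assumes G: "integrable lborel G" and f: "f \<in> borel_measurable borel" "\<And>x. \<bar>f x\<bar> \<le> B"
  shows "integrable lborel (\<lambda>y. f (x - y) *\<^sub>R G y)"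
proof (rule Bochner_Integration.integrable_bound)
  have [measurable]: "G \<in> borel_measurable borel" "f \<in> borel_measurable borel" using G f by auto
  show "integrable lborel (\<lambda>y. B * norm (G y))" using G by simp
  show "(\<lambda>y. f (x - y) *\<^sub>R G y) \<in> borel_measurable lborel" by measurable
  show "AE y in lborel. norm (f (x - y) *\<^sub>R G y) \<le> norm (B * norm (G y))"
    using f(2) by (intro AE_I2) (auto simp: abs_mult intro!: mult_right_mono order_trans[OF f(2) abs_ge_self])
qed

lemma kconv_norm_le:
  fixes G :: "real^2 \<Rightarrow> 'b::{banach,second_countable_topology}"
  assumes G: "integrable lborel G" and f: "f \<in> borel_measurable borel" "\<And>x. \<bar>f x\<bar> \<le> B"
  shows "norm (kconv G f x) \<le> B * (LBINT y. norm (G y))"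
proof -
  have "norm (kconv G f x) \<le> (LBINT y. norm (f (x - y) *\<^sub>R G y))"
    unfolding kconv_def by (rule integral_norm_bound)
  also have "\<dots> \<le> (LBINT y. B * norm (G y))"
  proof (rule integral_mono)
    show "integrable lborel (\<lambda>y. norm (f (x - y) *\<^sub>R G y))" by (intro integrable_norm kconv_integrable[OF assms])
  qed (use G f(2) in \<open>auto intro!: mult_right_mono\<close>)
  finally show ?thesis by simp
qed

lemma kconv_by_parts:
  fixes G :: "real^2 \<Rightarrow> 'b::{banach,second_countable_topology}"
  assumes G: "has_pd n G G'" "kernel G" "kernel G'"
    and g: "has_pd n g g'" "continuous_on UNIV g" "continuous_on UNIV g'" "\<And>x. \<bar>g x\<bar> \<le> B" "\<And>x. \<bar>g' x\<bar> \<le> B'"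
  shows "kconv G g' z = kconv G' g z"
proof -
  have "(LBINT y. g (z - y) *\<^sub>R G' y) = - (LBINT y. (- g' (z - y)) *\<^sub>R G y)"
  proof (rule integral_by_parts_pd[OF G has_pd_reflect[OF g(1)]])
    show "continuous_on UNIV (\<lambda>y. g (z - y))" "continuous_on UNIV (\<lambda>y. - g' (z - y))"
      by (intro continuous_intros continuous_on_compose2[OF g(2)] continuous_on_compose2[OF g(3)]; simp)+
  qed (use g in auto)
  then show ?thesis by (simp add: kconv_def)
qed

lemma kconv_add_kernel:
  fixes G H :: "real^2 \<Rightarrow> 'b::{banach,second_countable_topology}"
  assumes "integrable lborel G" "integrable lborel H" "f \<in> borel_measurable borel" "\<And>x. \<bar>f x\<bar> \<le> B"
  shows "kconv (\<lambda>x. G x + H x) f x = kconv G f x + kconv H f x"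
  unfolding kconv_def scaleR_right_distrib using assms by (intro Bochner_Integration.integral_add kconv_integrable)

lemma kconv_diff:
  fixes G :: "real^2 \<Rightarrow> 'b::{banach,second_countable_topology}"
  assumes "integrable lborel G" "f \<in> borel_measurable borel" "\<And>x. \<bar>f x\<bar> \<le> B" "g \<in> borel_measurable borel" "\<And>x. \<bar>g x\<bar> \<le> B'"
  shows "kconv G (\<lambda>y. f y - g y) x = kconv G f x - kconv G g x"
  unfolding kconv_def scaleR_left_diff_distrib using assms by (intro Bochner_Integration.integral_diff kconv_integrable)

section \<open>Littlewood--Paley projections\<close>

lemma kernel_fourier_injective:
  fixes f g :: "real^2 \<Rightarrow> real"
  assumes "kernel f" "kernel g" "\<And>\<xi>. fourier f \<xi> = fourier g \<xi>"
  shows "f = g"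
proof -
  obtain B where "\<And>x. \<bar>f x\<bar> \<le> B" using kernel_boundedE[OF assms(1)] by auto
  moreover obtain B' where "\<And>x. \<bar>g x\<bar> \<le> B'" using kernel_boundedE[OF assms(2)] by auto
  ultimately show ?thesis
    using assms by (intro fourier_injective[of f B g B'] kernel_integrable kernel_continuous) auto
qed

lemma fourier_0: "fourier f 0 = complex_of_real (LBINT x. f x)"
  by (simp add: fourier_def)

locale LP =
  fixes chi \<phi> :: "real^2 \<Rightarrow> real" and chis :: "int \<Rightarrow> real^2 \<Rightarrow> real"
  assumes lp: "littlewood_paley chi \<phi> chis"
begin

section \<open>The kernels of the decomposition: moments and scaling\<close>

lemma schwartz_\<phi>: "schwartz \<phi>" and radial_\<phi>: "radial \<phi>"
  and supp_\<phi>: "closure {\<xi>. fourier \<phi> \<xi> \<noteq> 0} \<subseteq> {\<xi>. 3/5 \<le> norm \<xi> \<and> norm \<xi> \<le> 5/3}"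
  using lp[unfolded littlewood_paley_def, THEN conjunct2, THEN conjunct2]
  by (rule conjunct1, rule conjunct1[OF conjunct2], rule conjunct1[OF conjunct2[OF conjunct2[OF conjunct2]]])

lemma schwartz_chis: "schwartz (chis n)"
  and chis_sums: "(\<lambda>j::nat. fourier \<phi> (2 powi (- (n + int j)) *\<^sub>R \<xi>)) sums (1 - fourier (chis n) \<xi>)"
proof -
  have "schwartz (chis n) \<and> (\<forall>\<xi>. (\<lambda>j::nat. fourier \<phi> (2 powi (- (n + int j)) *\<^sub>R \<xi>)) sums (1 - fourier (chis n) \<xi>))"
    using lp[unfolded littlewood_paley_def, THEN conjunct2, THEN conjunct2, THEN conjunct2, THEN conjunct2, THEN conjunct2, THEN conjunct2, THEN conjunct2]
    by (rule spec)
  then show "schwartz (chis n)" "(\<lambda>j::nat. fourier \<phi> (2 powi (- (n + int j)) *\<^sub>R \<xi>)) sums (1 - fourier (chis n) \<xi>)"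
    by (rule conjunct1, rule spec[OF conjunct2])
qed

lemma schwartz_dilate_\<phi>: "schwartz (dilate \<phi> j)"
  by (rule schwartz_dilate[OF schwartz_\<phi>])

lemma fourier_\<phi>_0: "fourier \<phi> 0 = 0"
proof (rule ccontr)
  assume "fourier \<phi> 0 \<noteq> 0"
  then have "0 \<in> closure {\<xi>. fourier \<phi> \<xi> \<noteq> 0}" by (intro closure_subset[THEN subsetD]) simp
  from subsetD[OF supp_\<phi> this] show False by simp
qed

lemma integral_\<phi>: "(LBINT x. \<phi> x) = 0"
  using fourier_\<phi>_0 unfolding fourier_0 by (simp only: of_real_eq_0_iff)

text \<open>A radial function is even. This second cancellation makes \<open>Riesz \<phi>\<close>,
  without any derivative, an integrable kernel.\<close>

lemma moment_\<phi>: "(LBINT x. x $ i * \<phi> x) = 0"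
proof -
  have "(LBINT x. x $ i * \<phi> x) = (LBINT x. (0 - x) $ i * \<phi> (0 - x))"
    by (rule integral_lborel_reflect[symmetric])
  also have "\<dots> = (LBINT x. - (x $ i * \<phi> x))"
  proof (intro Bochner_Integration.integral_cong refl)
    fix x :: "real^2"
    have "\<phi> (- x) = \<phi> x" using radial_\<phi> unfolding radial_def by (metis norm_minus_cancel)
    then show "(0 - x) $ i * \<phi> (0 - x) = - (x $ i * \<phi> x)" by simp
  qed
  finally show ?thesis by simp
qed

lemma integral_chis: "(LBINT x. chis n x) = 1"
proof -
  have "(\<lambda>j::nat. 0) sums (1 - fourier (chis n) 0)"
    using chis_sums[of n 0] by (simp add: fourier_\<phi>_0)
  then have "1 - fourier (chis n) 0 = 0" using sums_unique2[OF _ sums_zero] by blast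
  then have "complex_of_real (LBINT x. chis n x) = complex_of_real 1" by (simp add: fourier_0)
  then show ?thesis by (simp only: of_real_eq_iff)
qed

lemma fourier_add_kernel:
  fixes f g :: "real^2 \<Rightarrow> real"
  assumes "kernel f" "kernel g"
  shows "fourier (\<lambda>x. f x + g x) \<xi> = fourier f \<xi> + fourier g \<xi>"
  unfolding fourier_def of_real_add distrib_left
  by (intro Bochner_Integration.integral_add integrable_fourier kernel_integrable assms)

text \<open>The low-pass kernels are known only through their frequency series. Splitting off the
  first term of the series for \<open>n\<close> leaves the series for \<open>n + 1\<close>, and
  injectivity of the transform brings the identity back to physical space.\<close>

lemma chis_Suc: "chis (n + 1) x = chis n x + dilate \<phi> n x"
proof -
  have "chis (n + 1) = (\<lambda>x. chis n x + dilate \<phi> n x)"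
  proof (rule kernel_fourier_injective)
    show "kernel (chis (n + 1))" "kernel (\<lambda>x. chis n x + dilate \<phi> n x)"
      by (intro kernel_add schwartz_kernel schwartz_chis schwartz_dilate_\<phi>)+
    fix \<xi>
    have "(\<lambda>j::nat. fourier \<phi> (2 powi (- (n + int (Suc j))) *\<^sub>R \<xi>)) sums (1 - fourier (chis n) \<xi> - fourier \<phi> (2 powi (- n) *\<^sub>R \<xi>))"
      using chis_sums[of n \<xi>] by (subst sums_Suc_iff) simp
    moreover have "(\<lambda>j::nat. fourier \<phi> (2 powi (- (n + int (Suc j))) *\<^sub>R \<xi>)) sums (1 - fourier (chis (n + 1)) \<xi>)"
      using chis_sums[of "n + 1" \<xi>] by (simp add: algebra_simps)
    ultimately have "1 - fourier (chis n) \<xi> - fourier \<phi> (2 powi (- n) *\<^sub>R \<xi>) = 1 - fourier (chis (n + 1)) \<xi>"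
      by (rule sums_unique2)
    then show "fourier (chis (n + 1)) \<xi> = fourier (\<lambda>x. chis n x + dilate \<phi> n x) \<xi>"
      by (simp add: fourier_add_kernel schwartz_kernel schwartz_chis schwartz_dilate_\<phi> fourier_dilate algebra_simps)
  qed
  then show ?thesis by simp
qed

text \<open>Rescaling the frequency shifts the index of the defining series. All bounds on low-pass
  kernels thereby reduce to \<open>chis 0\<close>.\<close>

lemma chis_dilate: "chis n = dilate (chis 0) n"
proof (rule kernel_fourier_injective)
  show "kernel (chis n)" "kernel (dilate (chis 0) n)"
    by (intro schwartz_kernel schwartz_chis schwartz_dilate)+
  fix \<xi>
  have "(\<lambda>j::nat. fourier \<phi> (2 powi (- (0 + int j)) *\<^sub>R (2 powi (- n) *\<^sub>R \<xi>))) sums (1 - fourier (chis 0) (2 powi (- n) *\<^sub>R \<xi>))"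
    by (rule chis_sums)
  moreover have "2 powi (- (0 + int j)) *\<^sub>R (2 powi (- n) *\<^sub>R \<xi>) = 2 powi (- (n + int j)) *\<^sub>R \<xi>" for j
    by (simp add: power_int_add[symmetric] add.commute)
  ultimately have "(\<lambda>j::nat. fourier \<phi> (2 powi (- (n + int j)) *\<^sub>R \<xi>)) sums (1 - fourier (chis 0) (2 powi (- n) *\<^sub>R \<xi>))"
    by (simp only:)
  from sums_unique2[OF chis_sums this]
  show "fourier (chis n) \<xi> = fourier (dilate (chis 0) n) \<xi>" by (simp add: fourier_dilate)
qed

text \<open>The low-frequency cut-off \<open>S\<^sub>n f\<close>.\<close>

definition lowpass :: "int \<Rightarrow> (real^2 \<Rightarrow> 'b::{banach,second_countable_topology}) \<Rightarrow> real^2 \<Rightarrow> 'b" where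
  "lowpass n f x = (LBINT y. chis n (x - y) *\<^sub>R f y)"

lemma kernel_conv_integrable:
  fixes f :: "real^2 \<Rightarrow> 'b::{banach,second_countable_topology}"
  assumes k: "integrable lborel k" and f: "f \<in> borel_measurable borel" "\<And>x. norm (f x) \<le> B"
  shows "integrable lborel (\<lambda>y. k (x - y) *\<^sub>R f y)"
proof (rule Bochner_Integration.integrable_bound)
  have [measurable]: "k \<in> borel_measurable borel" "f \<in> borel_measurable borel" using k f by auto
  show "integrable lborel (\<lambda>y. B * k (x - y))" using k by (simp add: integrable_lborel_reflect)
  show "(\<lambda>y. k (x - y) *\<^sub>R f y) \<in> borel_measurable lborel" by measurable
  show "AE y in lborel. norm (k (x - y) *\<^sub>R f y) \<le> norm (B * k (x - y))"
    using f(2) by (intro AE_I2) (auto simp: abs_mult mult.commute intro!: mult_right_mono order_trans[OF f(2) abs_ge_self])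
qed

lemma norm_kernel_conv_le:
  fixes f :: "real^2 \<Rightarrow> 'b::{banach,second_countable_topology}"
  assumes k: "integrable lborel k" and f: "f \<in> borel_measurable borel" "\<And>x. norm (f x) \<le> B"
  shows "norm (LBINT y. k (x - y) *\<^sub>R f y) \<le> B * (LBINT y. \<bar>k y\<bar>)"
proof -
  have "norm (LBINT y. k (x - y) *\<^sub>R f y) \<le> (LBINT y. norm (k (x - y) *\<^sub>R f y))" by (rule integral_norm_bound)
  also have "\<dots> \<le> (LBINT y. B * \<bar>k (x - y)\<bar>)"
  proof (rule integral_mono)
    show "integrable lborel (\<lambda>y. norm (k (x - y) *\<^sub>R f y))" by (intro integrable_norm kernel_conv_integrable[OF assms])
    show "integrable lborel (\<lambda>y. B * \<bar>k (x - y)\<bar>)" using k by (simp add: integrable_lborel_reflect)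
    show "norm (k (x - y) *\<^sub>R f y) \<le> B * \<bar>k (x - y)\<bar>" for y
      using mult_left_mono[OF f(2)[of y], of "\<bar>k (x - y)\<bar>"] by (simp add: mult.commute)
  qed
  also have "\<dots> = B * (LBINT y. \<bar>k y\<bar>)" using integral_lborel_reflect[of "\<lambda>y. \<bar>k y\<bar>" x] by simp
  finally show ?thesis .
qed

lemma chis_integrable: "integrable lborel (chis n)" and dilate_\<phi>_integrable: "integrable lborel (dilate \<phi> n)"
  by (intro kernel_integrable schwartz_kernel schwartz_chis schwartz_dilate_\<phi>)+

lemma integral_abs_chis: "(LBINT y. \<bar>chis n y\<bar>) = (LBINT y. \<bar>chis 0 y\<bar>)"
proof -
  have "\<bar>chis n y\<bar> = dilate (\<lambda>x. \<bar>chis 0 x\<bar>) n y" for y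
    unfolding chis_dilate[of n] by (simp add: dilate_eq abs_mult)
  then have "(LBINT y. \<bar>chis n y\<bar>) = (LBINT y. dilate (\<lambda>x. \<bar>chis 0 x\<bar>) n y)"
    by presburger
  then show ?thesis unfolding integral_dilate .
qed

context
  fixes f :: "real^2 \<Rightarrow> 'b::{banach,second_countable_topology}" and B
  assumes f: "continuous_on UNIV f" "\<And>x. norm (f x) \<le> B"
begin

lemma f_measurable: "f \<in> borel_measurable borel"
  by (rule borel_measurable_continuous_onI[OF f(1)])

lemma lowpass_Suc: "lowpass (n + 1) f x = lowpass n f x + LP_block \<phi> n f x"
proof -
  have e: "chis (n + 1) (x - y) *\<^sub>R f y = chis n (x - y) *\<^sub>R f y + dilate \<phi> n (x - y) *\<^sub>R f y" for y
    unfolding chis_Suc scaleR_left_distrib ..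
  show ?thesis
    unfolding lowpass_def LP_block_def e
    by (rule Bochner_Integration.integral_add)
       (rule kernel_conv_integrable[OF chis_integrable f_measurable f(2)], rule kernel_conv_integrable[OF dilate_\<phi>_integrable f_measurable f(2)])
qed

lemma lowpass_le: "norm (lowpass n f x) \<le> B * (LBINT y. \<bar>chis 0 y\<bar>)"
  unfolding lowpass_def using norm_kernel_conv_le[OF chis_integrable f_measurable f(2), of n x]
  unfolding integral_abs_chis[of n] .

lemma lowpass_tendsto: "(\<lambda>m. lowpass (int m + N) f x) \<longlonglongrightarrow> f x"
proof -
  have "(\<lambda>m. lowpass (int m) f x) \<longlonglongrightarrow> f x"
    using approx_identity[OF chis_integrable f, of 0 x] unfolding lowpass_def chis_dilate[of "int _", symmetric] integral_chis by simp
  note * = LIMSEQ_ignore_initial_segment[OF this, of "nat N"] this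
  show ?thesis
  proof (cases "N \<ge> 0")
    case True then show ?thesis using *(1) by simp
  next
    case False
    have "(\<lambda>m. lowpass (int (m + nat (- N)) + N) f x) \<longlonglongrightarrow> f x"
      using *(2) False by simp
    then show ?thesis by (rule LIMSEQ_offset)
  qed
qed

lemma lowpass_sum: "lowpass (n + int m) f x = lowpass n f x + (\<Sum>j<m. LP_block \<phi> (n + int j) f x)"
proof (induction m)
  case (Suc m)
  have "lowpass (n + int (Suc m)) f x = lowpass ((n + int m) + 1) f x" by (simp add: algebra_simps)
  then show ?case by (simp only: lowpass_Suc Suc) simp
qed simp

lemma lowpass_continuous: "continuous_on UNIV (lowpass n f)"
proof -
  have eq: "lowpass n f x = (LBINT y. chis n y *\<^sub>R f (x - y))" for x
    unfolding lowpass_def using integral_lborel_reflect[of "\<lambda>y. chis n (x - y) *\<^sub>R f y" x] by simp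
  show ?thesis
    unfolding eq[abs_def]
  proof (rule continuous_on_integral_param[where w="\<lambda>y. \<bar>chis n y\<bar> * B"])
    have [measurable]: "f \<in> borel_measurable borel" "chis n \<in> borel_measurable borel"
      using f_measurable chis_integrable by auto
    show "(\<lambda>y. chis n y *\<^sub>R f (x - y)) \<in> borel_measurable borel" for x by measurable
    show "continuous_on UNIV (\<lambda>x. chis n y *\<^sub>R f (x - y))" for y
      by (intro continuous_intros continuous_on_compose2[OF f(1)]) auto
    show "integrable lborel (\<lambda>y. \<bar>chis n y\<bar> * B)" using chis_integrable by simp
    show "norm (chis n y *\<^sub>R f (x - y)) \<le> \<bar>chis n y\<bar> * B" for x y
      using f(2) by (auto intro!: mult_left_mono)
  qed
qed

text \<open>After rescaling by 2^m the two points are at distance 2^(-m) |x - x'|, and the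
  difference of the translated kernels has the L1 norm \<open>\<omega>\<close> of that displacement,
  where \<open>\<omega>\<close> is the L1 modulus of continuity of \<open>chis 0\<close>.\<close>

lemma lowpass_diff_tendsto_0: "(\<lambda>m. lowpass (- int m) f x - lowpass (- int m) f x') \<longlonglongrightarrow> 0"
proof -
  obtain C where C: "C > 0" "\<And>x. norm (chis 0 x) \<le> C / (1 + norm x) ^ 3"
    using kernelE[OF schwartz_kernel[OF schwartz_chis]] by blast
  define \<omega> where "\<omega> h = (LBINT z. norm (chis 0 (h + z) - chis 0 z))" for h
  have [measurable]: "chis 0 \<in> borel_measurable borel" using chis_integrable by auto
  have cont: "continuous_on (ball 0 1) \<omega>"
    unfolding \<omega>_def
  proof (rule continuous_on_integral_param[where w="\<lambda>z. (C * 8) / (1 + norm z) ^ 3 + C / (1 + norm z) ^ 3"])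
    show "(\<lambda>z. norm (chis 0 (h + z) - chis 0 z)) \<in> borel_measurable borel" for h by measurable
    show "continuous_on (ball 0 1) (\<lambda>h. norm (chis 0 (h + z) - chis 0 z))" for z
      by (intro continuous_intros continuous_on_compose2[OF kernel_continuous[OF schwartz_kernel[OF schwartz_chis], of UNIV]]) auto
    show "integrable lborel (\<lambda>z::real^2. (C * 8) / (1 + norm z) ^ 3 + C / (1 + norm z) ^ 3)"
      by (intro Bochner_Integration.integrable_add kernel_integrable kernel_inverse_cube)
    show "norm (norm (chis 0 (h + z) - chis 0 z)) \<le> (C * 8) / (1 + norm z) ^ 3 + C / (1 + norm z) ^ 3" if "h \<in> ball 0 1" for h z
      using decay_local[of "chis 0", OF C(2,1), of h z] C(2)[of z] that norm_triangle_ineq4[of "chis 0 (h + z)" "chis 0 z"]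
      by (simp add: add.commute)
  qed
  have "\<omega> 0 = 0" by (simp add: \<omega>_def)
  have h: "(\<lambda>m. (1 / 2) ^ m *\<^sub>R (x - x')) \<longlonglongrightarrow> 0 *\<^sub>R (x - x')"
    by (intro tendsto_scaleR tendsto_const LIMSEQ_power_zero) simp
  have "isCont \<omega> 0" using cont by (rule continuous_on_interior) simp
  then have "(\<lambda>m. \<omega> ((1 / 2) ^ m *\<^sub>R (x - x'))) \<longlonglongrightarrow> \<omega> 0"
    using h by (intro isCont_tendsto_compose[of 0 \<omega>]) simp_all
  then have lim: "(\<lambda>m. B * \<omega> ((1 / 2) ^ m *\<^sub>R (x - x'))) \<longlonglongrightarrow> B * 0" unfolding \<open>\<omega> 0 = 0\<close> by (intro tendsto_mult tendsto_const)
  have le: "norm (lowpass (- int m) f x - lowpass (- int m) f x') \<le> B * \<omega> ((1 / 2) ^ m *\<^sub>R (x - x'))" for m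
  proof -
    let ?c = "(1 / 2) ^ m :: real"
    have c: "2 powi (- int m) = ?c" by (simp add: power_int_minus power_one_over inverse_eq_divide)
    define k where "k y = chis (- int m) (x - x' + y) - chis (- int m) y" for y
    have ki: "integrable lborel k"
    proof -
      have "integrable lborel (\<lambda>y. chis (- int m) (x - x' + 1 *\<^sub>R y))"
        by (rule integrable_lborel_affine[OF chis_integrable]) simp
      then show ?thesis unfolding k_def using chis_integrable by (intro Bochner_Integration.integrable_diff) simp_all
    qed
    have "lowpass (- int m) f x - lowpass (- int m) f x' = (LBINT y. k (x' - y) *\<^sub>R f y)"
    proof -
      have e: "k (x' - y) *\<^sub>R f y = chis (- int m) (x - y) *\<^sub>R f y - chis (- int m) (x' - y) *\<^sub>R f y" for y
        by (simp add: k_def scaleR_left_diff_distrib)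
      show ?thesis
        unfolding lowpass_def e
        by (rule Bochner_Integration.integral_diff[symmetric]) (rule kernel_conv_integrable[OF chis_integrable f_measurable f(2)])+
    qed
    then have "norm (lowpass (- int m) f x - lowpass (- int m) f x') \<le> B * (LBINT y. \<bar>k y\<bar>)"
      using norm_kernel_conv_le[OF ki f_measurable f(2), of x'] by simp
    also have "(LBINT y. \<bar>k y\<bar>) = \<omega> (?c *\<^sub>R (x - x'))"
    proof -
      have "\<bar>k y\<bar> = dilate (\<lambda>z. norm (chis 0 (?c *\<^sub>R (x - x') + z) - chis 0 z)) (- int m) y" for y
        unfolding k_def chis_dilate[of "- int m"] by (simp add: dilate_eq c scaleR_add_right right_diff_distrib[symmetric] abs_mult)
      then have "(LBINT y. \<bar>k y\<bar>) = (LBINT y. dilate (\<lambda>z. norm (chis 0 (?c *\<^sub>R (x - x') + z) - chis 0 z)) (- int m) y)"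
        by presburger
      then show ?thesis unfolding \<omega>_def integral_dilate .
    qed
    finally show ?thesis .
  qed
  show ?thesis
  proof (rule Lim_null_comparison)
    show "\<forall>\<^sub>F m in sequentially. norm (lowpass (- int m) f x - lowpass (- int m) f x') \<le> B * \<omega> ((1 / 2) ^ m *\<^sub>R (x - x'))"
      by (intro always_eventually allI le)
    show "(\<lambda>m. B * \<omega> ((1 / 2) ^ m *\<^sub>R (x - x'))) \<longlonglongrightarrow> 0"
      using lim unfolding mult_zero_right .
  qed
qed

end

lemma kernel_mollK_dilate_\<phi>: "kernel (mollK (dilate \<phi> j))"
  by (intro kernel_mollK schwartz_dilate_\<phi>) (simp only: integral_dilate integral_\<phi>)

text \<open>By scaling these norms are 2^(-m) and 4^(-m) times the norms at frequency zero.\<close>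

lemma kconv_low_freq_tendsto_0:
  shows "(\<lambda>m. LBINT y. norm (mollK (pd n (chis (- int m))) y)) \<longlonglongrightarrow> 0"
    and "(\<lambda>m. LBINT y. norm (mollLapK (chis (- int m)) y)) \<longlonglongrightarrow> 0"
proof -
  have c: "2 powi (- int m) = (1 / 2 :: real) ^ m" for m by (simp add: power_int_minus power_one_over inverse_eq_divide)
  have e1: "(LBINT y. norm (mollK (pd n (chis (- int m))) y)) = (1 / 2) ^ m * (LBINT y. norm (mollK (pd n (chis 0)) y))" for m
    using integral_norm_scaled[of "(1 / 2) ^ m" "mollK (pd n (chis 0))"]
    unfolding chis_dilate[of "- int m"] by (simp add: mollK_pd_dilate schwartz_chis c power2_eq_square power3_eq_cube)
  show "(\<lambda>m. LBINT y. norm (mollK (pd n (chis (- int m))) y)) \<longlonglongrightarrow> 0"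
    unfolding e1 by (rule tendsto_mult_left_zero) (rule LIMSEQ_power_zero, simp)
  have e2: "(LBINT y. norm (mollLapK (chis (- int m)) y)) = (1 / 2) ^ m * ((1 / 2) ^ m * (LBINT y. norm (mollLapK (chis 0) y)))" for m
    using integral_norm_scaled[of "(1 / 2) ^ m" "mollLapK (chis 0)"]
    unfolding chis_dilate[of "- int m"] by (simp add: mollK_pd_dilate schwartz_chis c power2_eq_square power4_eq_xxxx)
  show "(\<lambda>m. LBINT y. norm (mollLapK (chis (- int m)) y)) \<longlonglongrightarrow> 0"
    unfolding e2 by (intro tendsto_mult_zero tendsto_mult_left_zero LIMSEQ_power_zero) auto
qed

end


section \<open>Spaces of bounded differentiable functions\<close>

lemma Cb_has_pd: "Cb k f \<Longrightarrow> length is < k \<Longrightarrow> has_pd n (pds is f) (pd n (pds is f))"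
  unfolding Cb_def by (intro differentiable_imp_has_pd) blast

lemma Cb_continuous: "Cb k f \<Longrightarrow> length is \<le> k \<Longrightarrow> continuous_on UNIV (pds is f)"
  unfolding Cb_def by blast

lemma Cb_bounded: assumes "Cb k f" "length is \<le> k" obtains B where "B \<ge> 0" "\<And>x. norm (pds is f x) \<le> B"
proof -
  have "bounded (range (pds is f))" using assms unfolding Cb_def by blast
  then obtain B where "\<And>x. norm (pds is f x) \<le> B" by (auto simp: bounded_iff)
  then show ?thesis using that order_trans[OF norm_ge_zero] by blast
qed

lemma pds_diff:
  assumes "Cb k f" "Cb k g" "length is \<le> k"
  shows "pds is (\<lambda>x. f x - g x) = (\<lambda>x. pds is f x - pds is g x)"
  using assms(3)
proof (induction "is")
  case (Cons i "is")
  then have "pds (i # is) (\<lambda>x. f x - g x) = pd i (\<lambda>x. pds is f x - pds is g x)" by simp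
  also have "\<dots> = (\<lambda>x. pd i (pds is f) x - pd i (pds is g) x)"
    using Cons.prems assms by (intro has_pd_imp_pd has_pd_diff Cb_has_pd) auto
  finally show ?case by simp
qed simp

lemma pds_scaleR:
  assumes "Cb k f" "length is \<le> k"
  shows "pds is (\<lambda>x. c *\<^sub>R f x) = (\<lambda>x. c *\<^sub>R pds is f x)"
  using assms(2)
proof (induction "is")
  case (Cons i "is")
  then have "pds (i # is) (\<lambda>x. c *\<^sub>R f x) = pd i (\<lambda>x. c *\<^sub>R pds is f x)" by simp
  also have "\<dots> = (\<lambda>x. c *\<^sub>R pd i (pds is f) x)"
    using Cons.prems assms by (intro has_pd_imp_pd has_pd_linear[OF bounded_linear_scaleR_right] Cb_has_pd) auto
  finally show ?case by simp
qed simp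

lemma Cb_diff: assumes "Cb k f" "Cb k g" shows "Cb k (\<lambda>x. f x - g x)"
  unfolding Cb_def
proof (intro conjI allI impI)
  fix "is" :: "2 list"
  show "pds is (\<lambda>x. f x - g x) differentiable_on UNIV" if "length is < k"
    using assms that unfolding Cb_def by (subst pds_diff[OF assms]) (auto intro!: derivative_intros)
  assume l: "length is \<le> k"
  show "continuous_on UNIV (pds is (\<lambda>x. f x - g x))"
    unfolding pds_diff[OF assms l] using assms l by (intro continuous_intros Cb_continuous)
  show "bounded (range (pds is (\<lambda>x. f x - g x)))"
    unfolding pds_diff[OF assms l] using assms l unfolding Cb_def by (intro bounded_minus_comp) blast+
qed

lemma Cb_scaleR: assumes "Cb k f" shows "Cb k (\<lambda>x. c *\<^sub>R f x)"
  unfolding Cb_def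
proof (intro conjI allI impI)
  fix "is" :: "2 list"
  show "pds is (\<lambda>x. c *\<^sub>R f x) differentiable_on UNIV" if "length is < k"
    using assms that unfolding Cb_def by (subst pds_scaleR[OF assms]) (auto intro!: derivative_intros)
  assume l: "length is \<le> k"
  show "continuous_on UNIV (pds is (\<lambda>x. c *\<^sub>R f x))"
    unfolding pds_scaleR[OF assms l] using assms l by (intro continuous_intros Cb_continuous)
  show "bounded (range (pds is (\<lambda>x. c *\<^sub>R f x)))"
    unfolding pds_scaleR[OF assms l] using assms l unfolding Cb_def by (intro bounded_scaleR_comp) blast
qed

lemma norm_le_Cb_norm: assumes "Cb k f" shows "norm (f x) \<le> Cb_norm k f"
proof -
  have "finite {is. set is \<subseteq> (UNIV::2 set) \<and> length is \<le> k}" by (rule finite_lists_length_le) simp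
  then have fin: "finite {is::2 list. length is \<le> k}" by simp
  have bdd: "bdd_above (range (\<lambda>x. norm (pds is f x)))" if "length is \<le> k" for "is"
    using assms that unfolding Cb_def by (simp add: bdd_above_norm[symmetric] image_image)
  have "norm (f x) \<le> (SUP x. norm (pds [] f x))"
    using bdd[of "[]"] by (intro cSUP_upper2[of _ _ x]) auto
  also have "\<dots> \<le> Cb_norm k f"
    unfolding Cb_norm_def
  proof (rule member_le_sum[OF _ _ fin])
    fix "is" :: "2 list" assume "is \<in> {is. length is \<le> k} - {[]}"
    then have "norm (pds is f 0) \<le> (SUP x. norm (pds is f x))" using bdd by (intro cSUP_upper2[of _ _ 0]) auto
    then show "0 \<le> (SUP x. norm (pds is f x))" by (rule order_trans[OF norm_ge_zero])
  qed simp
  finally show ?thesis .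
qed

lemma has_vector_derivative_quotientI:
  fixes f :: "real \<Rightarrow> 'b::real_normed_vector"
  assumes "((\<lambda>h. (f (s + h) - f s) /\<^sub>R h) \<longlongrightarrow> D) (at 0)"
  shows "(f has_vector_derivative D) (at s)"
  unfolding has_vector_derivative_def has_derivative_at
proof
  have "((\<lambda>h. (f (s + h) - f s) /\<^sub>R h - D) \<longlongrightarrow> 0) (at 0)"
    using tendsto_diff[OF assms tendsto_const[of D]] by simp
  then have "((\<lambda>h. norm ((f (s + h) - f s) /\<^sub>R h - D)) \<longlongrightarrow> 0) (at 0)" by (rule tendsto_norm_zero)
  then show "((\<lambda>h. norm (f (s + h) - f s - h *\<^sub>R D) / norm h) \<longlongrightarrow> 0) (at 0)"
  proof (rule Lim_transform_eventually)
    have "norm ((f (s + h) - f s) /\<^sub>R h - D) = norm (f (s + h) - f s - h *\<^sub>R D) / norm h" if "h \<noteq> 0" for h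
    proof -
      have "(f (s + h) - f s) /\<^sub>R h - D = (f (s + h) - f s - h *\<^sub>R D) /\<^sub>R h"
        using that by (simp add: scaleR_diff_right)
      then show ?thesis by (simp add: divide_inverse mult.commute)
    qed
    then show "\<forall>\<^sub>F h in at 0. norm ((f (s + h) - f s) /\<^sub>R h - D) = norm (f (s + h) - f s - h *\<^sub>R D) / norm h"
      by (auto simp: eventually_at_filter)
  qed
qed (rule bounded_linear_scaleR_left)

lemma has_vector_derivative_along_curve:
  fixes f :: "real^2 \<Rightarrow> 'b::real_normed_vector"
  assumes f: "f differentiable_on UNIV" and c: "(c has_vector_derivative v) (at t)"
  shows "((\<lambda>t. f (c t)) has_vector_derivative (\<Sum>i\<in>UNIV. v $ i *\<^sub>R pd i f (c t))) (at t)"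
proof -
  obtain D where D: "(f has_derivative D) (at (c t))"
    using f by (auto simp: differentiable_on_def differentiable_def)
  interpret D: bounded_linear D using D by (rule has_derivative_bounded_linear)
  have p: "pd i f (c t) = D (axis i 1)" for i
  proof -
    have "((\<lambda>h. c t + h *\<^sub>R axis i 1) has_derivative (\<lambda>h. h *\<^sub>R axis i 1)) (at 0)"
      by (auto intro!: derivative_eq_intros)
    moreover have "(f has_derivative D) (at (c t + 0 *\<^sub>R axis i 1))" using D by simp
    ultimately have "((\<lambda>h. f (c t + h *\<^sub>R axis i 1)) has_derivative (\<lambda>h. D (h *\<^sub>R axis i 1))) (at 0)"
      by (rule has_derivative_compose)
    then have "((\<lambda>h. f (c t + h *\<^sub>R axis i 1)) has_vector_derivative D (axis i 1)) (at 0)"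
      by (simp add: has_vector_derivative_def D.scaleR)
    then show ?thesis unfolding pd_def by (rule vector_derivative_at)
  qed
  have "((\<lambda>t. f (c t)) has_derivative (\<lambda>h. D (h *\<^sub>R v))) (at t)"
    using c D unfolding has_vector_derivative_def by (rule has_derivative_compose)
  moreover have "v = (\<Sum>i\<in>UNIV. v $ i *\<^sub>R axis i 1)"
    by (simp add: vec_eq_iff axis_def if_distrib[of "\<lambda>x. _ * x"] cong: if_cong)
  then have "D v = (\<Sum>i\<in>UNIV. v $ i *\<^sub>R pd i f (c t))"
    by (metis (no_types, lifting) D.sum D.scaleR p sum.cong)
  ultimately show ?thesis by (simp add: has_vector_derivative_def D.scaleR)
qed

lemma continuous_on_slice:
  assumes "continuous_on (I \<times> UNIV) (\<lambda>(s, x). w s x)" "s \<in> I"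
  shows "continuous_on UNIV (w s)"
proof -
  have "continuous_on UNIV (\<lambda>x. case (s, x) of (s, x) \<Rightarrow> w s x)"
    by (rule continuous_on_compose2[OF assms(1) continuous_on_Pair[OF continuous_on_const continuous_on_id]]) (use assms(2) in auto)
  then show ?thesis by simp
qed

text \<open>Time and point both depend on one parameter, so the lemma yields joint continuity,
  continuity along a moving frame, and continuity in space at a fixed time.\<close>

lemma kconv_continuous_param:
  fixes G :: "real^2 \<Rightarrow> 'b::{banach,second_countable_topology}" and tt :: "'p::metric_space \<Rightarrow> real"
  assumes G: "integrable lborel G"
    and w: "continuous_on (I \<times> UNIV) (\<lambda>(s, x). w s x)" "\<And>s x. s \<in> I \<Longrightarrow> \<bar>w s x\<bar> \<le> B"
    and t: "continuous_on S tt" "tt ` S \<subseteq> I" and z: "continuous_on S zz"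
  shows "continuous_on S (\<lambda>p. kconv G (w (tt p)) (zz p))"
  unfolding kconv_def
proof (rule continuous_on_integral_param[where w="\<lambda>y. B * norm (G y)"])
  have [measurable]: "G \<in> borel_measurable borel" using G by auto
  have c: "continuous_on UNIV (w s)" if "s \<in> I" for s
    by (rule continuous_on_slice[OF w(1) that])
  show "(\<lambda>y. w (tt p) (zz p - y) *\<^sub>R G y) \<in> borel_measurable borel" if "p \<in> S" for p
  proof -
    have [measurable]: "w (tt p) \<in> borel_measurable borel"
      using c t that by (intro borel_measurable_continuous_onI) auto
    show ?thesis by measurable
  qed
  show "continuous_on S (\<lambda>p. w (tt p) (zz p - y) *\<^sub>R G y)" for y
  proof -
    have "continuous_on S (\<lambda>p. case (tt p, zz p - y) of (s, x) \<Rightarrow> w s x)"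
      by (rule continuous_on_compose2[OF w(1)]) (use t in \<open>auto intro!: continuous_intros t(1) z\<close>)
    then show ?thesis by (intro continuous_on_scaleR continuous_on_const) simp
  qed
  show "norm (w (tt p) (zz p - y) *\<^sub>R G y) \<le> B * norm (G y)" if "p \<in> S" for p y
    using w(2)[of "tt p"] t that by (auto intro!: mult_right_mono)
qed (use G in simp)

lemma kconv_scale: "kconv G (\<lambda>y. c * f y) x = c *\<^sub>R kconv G f x"
  unfolding kconv_def by (simp add: scaleR_scaleR[symmetric] del: scaleR_scaleR)

lemma kconv_add:
  fixes G :: "real^2 \<Rightarrow> 'b::{banach,second_countable_topology}"
  assumes "integrable lborel G" "f \<in> borel_measurable borel" "\<And>x. \<bar>f x\<bar> \<le> B" "g \<in> borel_measurable borel" "\<And>x. \<bar>g x\<bar> \<le> B'"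
  shows "kconv G (\<lambda>y. f y + g y) x = kconv G f x + kconv G g x"
  unfolding kconv_def scaleR_left_distrib using assms by (intro Bochner_Integration.integral_add kconv_integrable)

section \<open>The transport equation tested against a kernel\<close>

locale solution = LP chi \<phi> chis
  for chi \<phi> :: "real^2 \<Rightarrow> real" and chis :: "int \<Rightarrow> real^2 \<Rightarrow> real" +
  fixes k :: nat and \<nu> T :: real and \<theta>0 :: "real^2 \<Rightarrow> real" and u0 :: "real^2 \<Rightarrow> real^2"
    and \<theta> :: "real \<Rightarrow> real^2 \<Rightarrow> real" and u :: "real \<Rightarrow> real^2 \<Rightarrow> real^2"
  assumes k: "2 \<le> k" and \<nu>: "0 < \<nu>" and T: "0 < T"
    and sol: "smooth_nondecaying_solution \<phi> k \<nu> T \<theta>0 u0 \<theta> u"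
begin

lemma sol_facts:
  shows init: "Cb k \<theta>0" "Cb k u0" "hom_law \<phi> \<theta>0 u0" "\<theta> 0 = \<theta>0" "u 0 = u0"
    and C1: "C1_Cb k {0<..T} \<theta>" and C0: "C0_Cb k {0<..T} u"
    and eq: "\<forall>t\<in>{0<..T}. \<forall>x. ((\<lambda>s. \<theta> s x) has_real_derivative
           \<nu> * laplacian (\<theta> t) x - (\<Sum>i\<in>UNIV. u t x $ i * pd i (\<theta> t) x)) (at t within {0<..T})"
    and law: "\<forall>t\<in>{0<..T}. hom_law \<phi> (\<theta> t) (u t)"
    and div_u: "\<forall>t\<in>{0<..T}. \<forall>x. divergence (u t) x = 0"
    and max_principle: "\<forall>t\<in>{0..T}. Linf_norm (\<theta> t) \<le> Linf_norm \<theta>0"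
    and \<theta>_cont: "continuous_on ({0..T} \<times> UNIV) (\<lambda>(t, x). \<theta> t x)"
    and u_cont: "continuous_on ({0..T} \<times> UNIV) (\<lambda>(t, x). u t x)"
    and \<theta>_bdd: "bounded ((\<lambda>(t, x). \<theta> t x) ` ({0..T} \<times> UNIV))"
    and u_bdd: "bounded ((\<lambda>(t, x). u t x) ` ({0..T} \<times> UNIV))"
  by (insert sol[unfolded smooth_nondecaying_solution_def]) (elim conjE, assumption)+

text \<open>Qualitative bounds from the boundedness of the solution. They serve integrability and
  limits, and do not enter the constant of the final estimate.\<close>

definition M\<theta> :: real where "M\<theta> = (SOME B. B \<ge> 0 \<and> (\<forall>t\<in>{0..T}. \<forall>x. \<bar>\<theta> t x\<bar> \<le> B))"
definition Mu :: real where "Mu = (SOME B. B \<ge> 0 \<and> (\<forall>t\<in>{0..T}. \<forall>x. norm (u t x) \<le> B))"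

lemma M\<theta>: "M\<theta> \<ge> 0" "t \<in> {0..T} \<Longrightarrow> \<bar>\<theta> t x\<bar> \<le> M\<theta>"
proof -
  obtain B where B: "B > 0" "\<forall>v\<in>(\<lambda>(t, x). \<theta> t x) ` ({0..T} \<times> UNIV). norm v \<le> B"
    using \<theta>_bdd unfolding bounded_pos by blast
  then have "B \<ge> 0 \<and> (\<forall>t\<in>{0..T}. \<forall>x. \<bar>\<theta> t x\<bar> \<le> B)" by force
  then have "M\<theta> \<ge> 0 \<and> (\<forall>t\<in>{0..T}. \<forall>x. \<bar>\<theta> t x\<bar> \<le> M\<theta>)" unfolding M\<theta>_def by (rule someI)
  then show "M\<theta> \<ge> 0" "t \<in> {0..T} \<Longrightarrow> \<bar>\<theta> t x\<bar> \<le> M\<theta>" by blast+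
qed

lemma Mu: "Mu \<ge> 0" "t \<in> {0..T} \<Longrightarrow> norm (u t x) \<le> Mu"
proof -
  obtain B where B: "B > 0" "\<forall>v\<in>(\<lambda>(t, x). u t x) ` ({0..T} \<times> UNIV). norm v \<le> B"
    using u_bdd unfolding bounded_pos by blast
  then have "B \<ge> 0 \<and> (\<forall>t\<in>{0..T}. \<forall>x. norm (u t x) \<le> B)" by force
  then have "Mu \<ge> 0 \<and> (\<forall>t\<in>{0..T}. \<forall>x. norm (u t x) \<le> Mu)" unfolding Mu_def by (rule someI)
  then show "Mu \<ge> 0" "t \<in> {0..T} \<Longrightarrow> norm (u t x) \<le> Mu" by blast+
qed

lemma \<theta>_continuous: "t \<in> {0..T} \<Longrightarrow> continuous_on UNIV (\<theta> t)"
  by (rule continuous_on_slice[OF \<theta>_cont])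

lemma u_continuous: "t \<in> {0..T} \<Longrightarrow> continuous_on UNIV (u t)"
  by (rule continuous_on_slice[OF u_cont])

lemma \<theta>_measurable: "t \<in> {0..T} \<Longrightarrow> \<theta> t \<in> borel_measurable borel"
  by (intro borel_measurable_continuous_onI \<theta>_continuous)

lemma \<theta>_Cb: "t \<in> {0<..T} \<Longrightarrow> Cb k (\<theta> t)" and u_Cb: "t \<in> {0<..T} \<Longrightarrow> Cb k (u t)"
  using C1 C0 unfolding C1_Cb_def C0_Cb_def by blast+

text \<open>The velocity enters relative to a frame moving with velocity \<open>U\<close>.\<close>

definition flux :: "(real \<Rightarrow> real^2) \<Rightarrow> 2 \<Rightarrow> real \<Rightarrow> real^2 \<Rightarrow> real" where
  "flux U i s y = \<theta> s y * (u s y $ i - U s $ i)"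

lemma flux_le:
  assumes "s \<in> {0..T}" "norm (U s) \<le> B"
  shows "\<bar>flux U i s y\<bar> \<le> M\<theta> * (Mu + B)"
proof -
  have "\<bar>u s y $ i - U s $ i\<bar> \<le> norm (u s y) + norm (U s)"
    using component_le_norm_cart[of "u s y" i] component_le_norm_cart[of "U s" i] by linarith
  then show ?thesis
    using M\<theta> Mu(2)[OF assms(1), of y] assms unfolding flux_def abs_mult by (intro mult_mono) auto
qed

lemma flux_cont:
  assumes "continuous_on {0..T} U"
  shows "continuous_on ({0..T} \<times> UNIV) (\<lambda>(s, x). flux U i s x)"
proof -
  have "continuous_on ({0..T} \<times> UNIV) (\<lambda>p. (case p of (s, x) \<Rightarrow> \<theta> s x) * ((case p of (s, x) \<Rightarrow> u s x) $ i - U (fst p) $ i))"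
    by (intro continuous_intros \<theta>_cont u_cont continuous_on_compose2[OF assms]) auto
  then show ?thesis by (simp add: flux_def case_prod_unfold)
qed

text \<open>The difference quotient splits into an increment in time at the moved point and an
  increment in space at fixed time. The first converges uniformly in space thanks to
  \<open>C1_Cb\<close>; the second converges pointwise and is bounded by a Lipschitz estimate. So
  dominated convergence against \<open>G\<close> applies, and \<open>D\<close> is the time
  derivative plus the drift of the frame.\<close>

lemma deriv_kconv:
  fixes G :: "real^2 \<Rightarrow> 'b::{banach,second_countable_topology}"
  assumes s: "s \<in> {0<..<T}" and G: "kernel G" and X: "(X has_vector_derivative U) (at s)"
  defines "D \<equiv> \<lambda>y. \<nu> * laplacian (\<theta> s) y - (\<Sum>i\<in>UNIV. u s y $ i * pd i (\<theta> s) y) + (\<Sum>i\<in>UNIV. U $ i * pd i (\<theta> s) y)"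
  shows "((\<lambda>s. kconv G (\<theta> s) (x + X s)) has_vector_derivative kconv G D (x + X s)) (at s)"
proof -
  have sT: "s \<in> {0<..T}" "s \<in> {0..T}" using s by auto
  have at: "at s within {0<..<T} = at s" by (rule at_within_open[OF s]) simp
  obtain w' where w': "C0_Cb k {0<..T} w'"
    and lim: "\<forall>t\<in>{0<..T}. ((\<lambda>r. Cb_norm k (\<lambda>x. (\<theta> r x - \<theta> t x) /\<^sub>R (r - t) - w' t x)) \<longlongrightarrow> 0) (at t within {0<..T})"
    using C1 unfolding C1_Cb_def by blast
  have w'Cb: "Cb k (w' s)" using w' sT unfolding C0_Cb_def by blast
  define e where "e r = Cb_norm k (\<lambda>x. (\<theta> r x - \<theta> s x) /\<^sub>R (r - s) - w' s x)" for r
  have "(e \<longlongrightarrow> 0) (at s within {0<..<T})"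
    unfolding e_def using lim sT by (auto intro: tendsto_within_subset[of _ _ s "{0<..T}" "{0<..<T}"])
  then have e0: "(e \<longlongrightarrow> 0) (at s)" unfolding at .
  have eb: "\<bar>(\<theta> r y - \<theta> s y) / (r - s) - w' s y\<bar> \<le> e r" if "r \<in> {0<..<T}" for r y
  proof -
    have "r \<in> {0<..T}" using that by auto
    then have "Cb k (\<lambda>x. (\<theta> r x - \<theta> s x) /\<^sub>R (r - s) - w' s x)"
      by (intro Cb_diff Cb_scaleR \<theta>_Cb w'Cb sT)
    from norm_le_Cb_norm[OF this, of y] show ?thesis by (simp add: e_def divide_inverse mult.commute)
  qed
  have ev: "\<forall>\<^sub>F r in at s. r \<in> {0<..<T}"
    using s eventually_at_topological by (metis open_greaterThanLessThan)
  \<comment> \<open>The derivative in the norm of bounded functions agrees with the pointwise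
    derivative from the equation, by uniqueness of limits.\<close>
  have w'eq: "w' s y = \<nu> * laplacian (\<theta> s) y - (\<Sum>i\<in>UNIV. u s y $ i * pd i (\<theta> s) y)" for y
  proof (rule tendsto_unique[of "at s"])
    show "((\<lambda>r. (\<theta> r y - \<theta> s y) / (r - s)) \<longlongrightarrow> w' s y) (at s)"
    proof (rule Lim_transform[OF tendsto_const])
      show "((\<lambda>r. (\<theta> r y - \<theta> s y) / (r - s) - w' s y) \<longlongrightarrow> 0) (at s)"
        by (rule Lim_null_comparison[OF _ e0]) (use ev eb in \<open>auto elim!: eventually_mono\<close>)
    qed
    have "((\<lambda>s. \<theta> s y) has_real_derivative \<nu> * laplacian (\<theta> s) y - (\<Sum>i\<in>UNIV. u s y $ i * pd i (\<theta> s) y)) (at s within {0<..<T})"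
      by (rule has_field_derivative_subset[of _ _ s "{0<..T}"]) (use eq sT in auto)
    then show "((\<lambda>r. (\<theta> r y - \<theta> s y) / (r - s)) \<longlongrightarrow> \<nu> * laplacian (\<theta> s) y - (\<Sum>i\<in>UNIV. u s y $ i * pd i (\<theta> s) y)) (at s)"
      unfolding at by (simp add: has_field_derivative_iff)
  qed simp
  obtain W where W: "\<And>y. \<bar>w' s y\<bar> \<le> W" using Cb_bounded[OF w'Cb, of "[]"] by auto
  have w'c: "continuous_on UNIV (w' s)" using Cb_continuous[OF w'Cb, of "[]"] by simp
  have \<theta>d: "\<theta> s differentiable_on UNIV" using \<theta>_Cb[OF sT(1)] k unfolding Cb_def by (metis list.size(3) less_le_trans pos2 pds.simps(1))
  obtain L where L: "L \<ge> 0" "\<And>i y. \<bar>pd i (\<theta> s) y\<bar> \<le> L"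
  proof -
    obtain L1 where 1: "L1 \<ge> 0" "\<And>y. \<bar>pd 1 (\<theta> s) y\<bar> \<le> L1" using Cb_bounded[OF \<theta>_Cb[OF sT(1)], of "[1]"] k by auto
    obtain L2 where 2: "L2 \<ge> 0" "\<And>y. \<bar>pd 2 (\<theta> s) y\<bar> \<le> L2" using Cb_bounded[OF \<theta>_Cb[OF sT(1)], of "[2]"] k by auto
    have "\<bar>pd i (\<theta> s) y\<bar> \<le> L1 + L2" for i y
      using 1 2 exhaust_2[of i] by (auto intro: add_increasing add_increasing2)
    then show ?thesis using that[of "L1 + L2"] 1 2 by simp
  qed
  \<comment> \<open>One moves from \<open>b\<close> to \<open>a\<close> along the two coordinate
    directions; each leg is at most the distance, hence the factor 2.\<close>
  have lip: "\<bar>\<theta> s a - \<theta> s b\<bar> \<le> 2 * L * norm (a - b)" for a b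
  proof -
    have ab: "a = (b + (a $ 1 - b $ 1) *\<^sub>R axis 1 1) + (a $ 2 - b $ 2) *\<^sub>R axis 2 1"
      by (simp add: vec_eq_iff forall_2 axis_def)
    have p: "has_pd n (\<theta> s) (pd n (\<theta> s))" for n by (rule differentiable_imp_has_pd[OF \<theta>d])
    have "\<bar>\<theta> s ((b + (a $ 1 - b $ 1) *\<^sub>R axis 1 1) + (a $ 2 - b $ 2) *\<^sub>R axis 2 1) - \<theta> s (b + (a $ 1 - b $ 1) *\<^sub>R axis 1 1)\<bar> \<le> L * \<bar>a $ 2 - b $ 2\<bar>"
      using has_pd_lipschitz[OF p, of "a $ 2 - b $ 2" 2 _ L] L by simp
    moreover have "\<bar>\<theta> s (b + (a $ 1 - b $ 1) *\<^sub>R axis 1 1) - \<theta> s b\<bar> \<le> L * \<bar>a $ 1 - b $ 1\<bar>"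
      using has_pd_lipschitz[OF p, of "a $ 1 - b $ 1" 1 _ L] L by simp
    ultimately have "\<bar>\<theta> s a - \<theta> s b\<bar> \<le> L * \<bar>a $ 2 - b $ 2\<bar> + L * \<bar>a $ 1 - b $ 1\<bar>"
      unfolding ab[symmetric] by linarith
    also have "\<dots> \<le> L * norm (a - b) + L * norm (a - b)"
      using component_le_norm_cart[of "a - b" 1] component_le_norm_cart[of "a - b" 2] L(1)
      by (intro add_mono mult_left_mono) auto
    finally show ?thesis by simp
  qed
  define z where "z r = x + X r" for r
  have zd: "(z has_vector_derivative U) (at s)" unfolding z_def using X by (auto intro!: derivative_eq_intros)
  have zq: "((\<lambda>r. (z r - z s) /\<^sub>R (r - s)) \<longlongrightarrow> U) (at s)"
  proof -
    have "((\<lambda>h. (z (s + h *\<^sub>R 1) - z s) /\<^sub>R h) \<longlongrightarrow> U) (at 0)"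
    proof (rule has_vector_derivative_quotient)
      have "((\<lambda>h. s + h) has_vector_derivative 1) (at (0::real))" by (auto intro!: derivative_eq_intros)
      from vector_diff_chain_at[OF this, of z U] zd
      show "((\<lambda>h. z (s + h *\<^sub>R 1)) has_vector_derivative U) (at 0)" by (simp add: o_def)
    qed
    then show ?thesis by (simp add: LIM_offset_zero_iff[of s])
  qed
  have zc: "(z \<longlongrightarrow> z s) (at s)"
    using has_vector_derivative_continuous[OF zd] by (simp add: continuous_within)
  define q where "q r y = (\<theta> r (z r - y) - \<theta> s (z s - y)) / (r - s)" for r y
  have qlim: "((\<lambda>r. q r y) \<longlongrightarrow> D (z s - y)) (at s)" for y
  proof -
    have zcy: "((\<lambda>r. z r - y) \<longlongrightarrow> z s - y) (at s)" using zc by (intro tendsto_intros)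
    have 0: "((\<lambda>r. w' s (z r - y)) \<longlongrightarrow> w' s (z s - y)) (at s)"
      by (rule continuous_on_tendsto_compose[OF w'c zcy]) auto
    have d: "((\<lambda>r. (\<theta> r (z r - y) - \<theta> s (z r - y)) / (r - s) - w' s (z r - y)) \<longlongrightarrow> 0) (at s)"
      by (rule Lim_null_comparison[OF _ e0]) (use ev eb in \<open>auto elim!: eventually_mono\<close>)
    have 1: "((\<lambda>r. (\<theta> r (z r - y) - \<theta> s (z r - y)) / (r - s)) \<longlongrightarrow> w' s (z s - y)) (at s)"
      by (rule Lim_transform[OF 0 d])
    have "((\<lambda>r. z r - y) has_vector_derivative U) (at s)" using zd by (auto intro!: derivative_eq_intros)
    from has_vector_derivative_along_curve[OF \<theta>d this]
    have "((\<lambda>r. \<theta> s (z r - y)) has_field_derivative (\<Sum>i\<in>UNIV. U $ i * pd i (\<theta> s) (z s - y))) (at s)"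
      by (simp add: has_real_derivative_iff_has_vector_derivative)
    then have 2: "((\<lambda>r. (\<theta> s (z r - y) - \<theta> s (z s - y)) / (r - s)) \<longlongrightarrow> (\<Sum>i\<in>UNIV. U $ i * pd i (\<theta> s) (z s - y))) (at s)"
      by (simp add: has_field_derivative_iff)
    have "((\<lambda>r. (\<theta> r (z r - y) - \<theta> s (z r - y)) / (r - s) + (\<theta> s (z r - y) - \<theta> s (z s - y)) / (r - s)) \<longlongrightarrow> D (z s - y)) (at s)"
      using tendsto_add[OF 1 2] unfolding D_def w'eq .
    then show ?thesis unfolding q_def by (simp add: add_divide_distrib[symmetric])
  qed
  have qbound: "\<forall>\<^sub>F r in at s. \<forall>y. \<bar>q r y\<bar> \<le> W + 1 + 2 * L * (norm U + 1)"
  proof -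
    have "\<forall>\<^sub>F r in at s. e r < 1" by (rule order_tendstoD(2)[OF e0]) simp
    moreover have "\<forall>\<^sub>F r in at s. norm ((z r - z s) /\<^sub>R (r - s)) < norm U + 1"
      by (rule order_tendstoD(2)[OF tendsto_norm[OF zq]]) simp
    ultimately show ?thesis using ev
    proof eventually_elim
      case (elim r)
      show ?case
      proof
        fix y
        have 1: "\<bar>(\<theta> r (z r - y) - \<theta> s (z r - y)) / (r - s)\<bar> \<le> W + 1"
          using eb[OF elim(3), of "z r - y"] W[of "z r - y"] elim(1) by linarith
        have "\<bar>\<theta> s (z r - y) - \<theta> s (z s - y)\<bar> / \<bar>r - s\<bar> \<le> (2 * L * norm (z r - z s)) / \<bar>r - s\<bar>"
          using lip[of "z r - y" "z s - y"] by (intro divide_right_mono) auto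
        also have "\<dots> = 2 * L * norm ((z r - z s) /\<^sub>R (r - s))" by (simp add: divide_inverse mult_ac)
        also have "\<dots> \<le> 2 * L * (norm U + 1)" using elim(2) L by (intro mult_left_mono) auto
        finally have 2: "\<bar>(\<theta> s (z r - y) - \<theta> s (z s - y)) / (r - s)\<bar> \<le> 2 * L * (norm U + 1)" by (simp add: abs_divide)
        have "q r y = (\<theta> r (z r - y) - \<theta> s (z r - y)) / (r - s) + (\<theta> s (z r - y) - \<theta> s (z s - y)) / (r - s)"
          unfolding q_def by (simp add: add_divide_distrib[symmetric])
        then show "\<bar>q r y\<bar> \<le> W + 1 + 2 * L * (norm U + 1)" using 1 2 by linarith
      qed
    qed
  qed
  have Gi: "integrable lborel G" by (rule kernel_integrable[OF G])
  have [measurable]: "G \<in> borel_measurable borel" using Gi by auto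
  have F: "((\<lambda>r. (kconv G (\<theta> r) (z r) - kconv G (\<theta> s) (z s)) /\<^sub>R (r - s)) \<longlongrightarrow> kconv G D (z s)) (at s)"
    unfolding tendsto_at_iff_sequentially comp_def
  proof (intro allI impI)
    fix R assume R: "\<forall>i. R i \<in> UNIV - {s}" "R \<longlonglongrightarrow> s"
    then have Rs: "filterlim R (at s) sequentially" by (intro filterlim_atI) auto
    obtain N where N: "\<And>i. i \<ge> N \<Longrightarrow> (\<forall>y. \<bar>q (R i) y\<bar> \<le> W + 1 + 2 * L * (norm U + 1)) \<and> R i \<in> {0<..<T}"
      using filterlim_iff[THEN iffD1, OF Rs, rule_format, OF eventually_conj[OF qbound ev]] by (auto simp: eventually_sequentially)
    let ?R = "\<lambda>i. R (i + N)"
    have RT: "?R i \<in> {0..T}" for i using N[of "i + N"] by auto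
    have Rs': "filterlim ?R (at s) sequentially"
      using R by (intro filterlim_atI LIMSEQ_ignore_initial_segment) auto
    have "(\<lambda>i. LBINT y. q (?R i) y *\<^sub>R G y) \<longlonglongrightarrow> (LBINT y. D (z s - y) *\<^sub>R G y)"
    proof (rule integral_dominated_convergence[where w="\<lambda>y. (W + 1 + 2 * L * (norm U + 1)) * norm (G y)"])
      have qm: "q (?R i) \<in> borel_measurable borel" for i
      proof -
        have [measurable]: "\<theta> (?R i) \<in> borel_measurable borel" "\<theta> s \<in> borel_measurable borel"
          using RT sT by (auto intro: \<theta>_measurable)
        show ?thesis unfolding q_def by measurable
      qed
      have qi: "(\<lambda>i. q (?R i) y) \<longlonglongrightarrow> D (z s - y)" for y
        by (rule filterlim_compose[OF qlim Rs'])
      then have "(\<lambda>y. D (z s - y)) \<in> borel_measurable borel"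
        by (rule borel_measurable_LIMSEQ_real) (rule qm)
      then show "(\<lambda>y. D (z s - y) *\<^sub>R G y) \<in> borel_measurable lborel" by measurable
      show "(\<lambda>y. q (?R i) y *\<^sub>R G y) \<in> borel_measurable lborel" for i using qm[of i] by measurable
      show "integrable lborel (\<lambda>y. (W + 1 + 2 * L * (norm U + 1)) * norm (G y))" using Gi by simp
      show "AE y in lborel. (\<lambda>i. q (?R i) y *\<^sub>R G y) \<longlonglongrightarrow> D (z s - y) *\<^sub>R G y"
        by (intro AE_I2 tendsto_scaleR tendsto_const qi)
      show "AE y in lborel. norm (q (?R i) y *\<^sub>R G y) \<le> (W + 1 + 2 * L * (norm U + 1)) * norm (G y)" for i
        using N[of "i + N"] by (auto intro!: AE_I2 mult_right_mono)
    qed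
    moreover have "(LBINT y. q (?R i) y *\<^sub>R G y) = (kconv G (\<theta> (?R i)) (z (?R i)) - kconv G (\<theta> s) (z s)) /\<^sub>R (?R i - s)" for i
    proof -
      have i1: "integrable lborel (\<lambda>y. \<theta> (?R i) (z (?R i) - y) *\<^sub>R G y)"
        by (rule kconv_integrable[OF Gi \<theta>_measurable[OF RT] M\<theta>(2)[OF RT]])
      have i2: "integrable lborel (\<lambda>y. \<theta> s (z s - y) *\<^sub>R G y)"
        by (rule kconv_integrable[OF Gi \<theta>_measurable[OF sT(2)] M\<theta>(2)[OF sT(2)]])
      have "q (?R i) y *\<^sub>R G y = (\<theta> (?R i) (z (?R i) - y) *\<^sub>R G y - \<theta> s (z s - y) *\<^sub>R G y) /\<^sub>R (?R i - s)" for y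
        by (simp add: q_def scaleR_left_diff_distrib[symmetric] divide_inverse mult.commute)
      then show ?thesis unfolding kconv_def using i1 i2 by simp
    qed
    ultimately have "(\<lambda>i. (kconv G (\<theta> (?R i)) (z (?R i)) - kconv G (\<theta> s) (z s)) /\<^sub>R (?R i - s)) \<longlonglongrightarrow> kconv G D (z s)"
      by (simp add: kconv_def)
    then show "(\<lambda>i. (kconv G (\<theta> (R i)) (z (R i)) - kconv G (\<theta> s) (z s)) /\<^sub>R (R i - s)) \<longlonglongrightarrow> kconv G D (z s)"
      by (rule LIMSEQ_offset)
  qed
  then have "((\<lambda>s. kconv G (\<theta> s) (z s)) has_vector_derivative kconv G D (z s)) (at s)"
    by (intro has_vector_derivative_quotientI) (simp add: LIM_offset_zero_iff[of s])
  then show ?thesis unfolding z_def .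
qed

text \<open>As \<open>u\<close> is divergence free and \<open>U s\<close> is constant in space,
  transport and drift together are the divergence of the flux with relative velocity;
  \<open>fp i\<close> is its i-th term. All space derivatives are then moved onto \<open>G\<close>,
  where two are at hand, while the solution is used with at most two derivatives.\<close>

lemma kconv_transport_rhs:
  fixes G :: "real^2 \<Rightarrow> 'b::{banach,second_countable_topology}"
  assumes s: "s \<in> {0<..<T}" and G: "kernel G" "\<And>i. has_pd i G (G' i)" "\<And>i. kernel (G' i)" "\<And>i. has_pd i (G' i) (G'' i)" "\<And>i. kernel (G'' i)"
  shows "kconv G (\<lambda>y. \<nu> * laplacian (\<theta> s) y - (\<Sum>i\<in>UNIV. u s y $ i * pd i (\<theta> s) y) + (\<Sum>i\<in>UNIV. U s $ i * pd i (\<theta> s) y)) z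
    = \<nu> *\<^sub>R (\<Sum>i\<in>UNIV. kconv (G'' i) (\<theta> s) z) - (\<Sum>i\<in>UNIV. kconv (G' i) (flux U i s) z)"
proof -
  have sT: "s \<in> {0<..T}" "s \<in> {0..T}" using s by auto
  have c\<theta>: "Cb k (\<theta> s)" and cu: "Cb k (u s)" using \<theta>_Cb u_Cb sT by auto
  have d\<theta>: "has_pd i (\<theta> s) (pd i (\<theta> s))" "has_pd i (pd i (\<theta> s)) (pd i (pd i (\<theta> s)))" for i
    using Cb_has_pd[OF c\<theta>, of "[]" i] Cb_has_pd[OF c\<theta>, of "[i]" i] k by auto
  have con: "continuous_on UNIV (\<theta> s)" "continuous_on UNIV (pd i (\<theta> s))" "continuous_on UNIV (pd i (pd i (\<theta> s)))"
     "continuous_on UNIV (u s)" "continuous_on UNIV (pd i (u s))" for i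
    using Cb_continuous[OF c\<theta>, of "[]"] Cb_continuous[OF c\<theta>, of "[i]"] Cb_continuous[OF c\<theta>, of "[i, i]"]
      Cb_continuous[OF cu, of "[]"] Cb_continuous[OF cu, of "[i]"] k by auto
  have bdd: "\<exists>B. \<forall>y. \<bar>pd i (\<theta> s) y\<bar> \<le> B" "\<exists>B. \<forall>y. \<bar>pd i (pd i (\<theta> s)) y\<bar> \<le> B" "\<exists>B. \<forall>y. norm (pd i (u s) y) \<le> B" for i
    using Cb_bounded[OF c\<theta>, of "[i]"] Cb_bounded[OF c\<theta>, of "[i, i]"] Cb_bounded[OF cu, of "[i]"] k
    by (metis One_nat_def Suc_1 le_trans length_Cons list.size(3) pds.simps real_norm_def one_le_numeral numeral_2_eq_2 order_refl)+
  have b\<theta>: "\<bar>\<theta> s y\<bar> \<le> M\<theta>" for y using M\<theta> sT by simp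
  define fp where "fp i y = \<theta> s y * pd i (u s) y $ i + pd i (\<theta> s) y * (u s y $ i - U s $ i)" for i y
  have fpd: "has_pd i (flux U i s) (fp i)" for i
  proof -
    have "has_pd i (\<lambda>y. u s y $ i - U s $ i) (\<lambda>y. pd i (u s) y $ i - 0)"
      using has_pd_diff[OF has_pd_linear[OF bounded_linear_vec_nth Cb_has_pd[OF cu, of "[]" i]] has_pd_const] k by simp
    from has_pd_mult[OF d\<theta>(1)[of i] this] show ?thesis unfolding flux_def[abs_def] fp_def[abs_def] by simp
  qed
  have fc: "continuous_on UNIV (flux U i s)" "continuous_on UNIV (fp i)" for i
    unfolding flux_def[abs_def] fp_def[abs_def] by (intro continuous_intros con)+
  have fb: "\<bar>flux U i s y\<bar> \<le> M\<theta> * (Mu + norm (U s))" for i y by (rule flux_le[OF sT(2)]) simp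
  have fpb: "\<exists>B. \<forall>y. \<bar>fp i y\<bar> \<le> B" for i
  proof -
    obtain B1 where B1: "\<And>y. \<bar>pd i (\<theta> s) y\<bar> \<le> B1" using bdd(1) by blast
    obtain B2 where B2: "\<And>y. norm (pd i (u s) y) \<le> B2" using bdd(3) by blast
    have "\<bar>fp i y\<bar> \<le> M\<theta> * B2 + B1 * (Mu + norm (U s))" for y
    proof -
      have "\<bar>\<theta> s y * pd i (u s) y $ i\<bar> \<le> M\<theta> * B2"
        unfolding abs_mult using b\<theta>[of y] M\<theta> order_trans[OF component_le_norm_cart B2] by (intro mult_mono) auto
      moreover have "\<bar>u s y $ i - U s $ i\<bar> \<le> Mu + norm (U s)"
        using component_le_norm_cart[of "u s y" i] component_le_norm_cart[of "U s" i] Mu(2)[OF sT(2), of y] by linarith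
      then have "\<bar>pd i (\<theta> s) y * (u s y $ i - U s $ i)\<bar> \<le> B1 * (Mu + norm (U s))"
        unfolding abs_mult using B1[of y] by (intro mult_mono) auto
      ultimately show ?thesis unfolding fp_def by linarith
    qed
    then show ?thesis by blast
  qed
  have e: "(\<lambda>y. \<nu> * laplacian (\<theta> s) y - (\<Sum>i\<in>UNIV. u s y $ i * pd i (\<theta> s) y) + (\<Sum>i\<in>UNIV. U s $ i * pd i (\<theta> s) y))
    = (\<lambda>y. \<nu> * (pd 1 (pd 1 (\<theta> s)) y + pd 2 (pd 2 (\<theta> s)) y) - (fp 1 y + fp 2 y))"
  proof
    fix y
    have "pd i (\<lambda>y. u s y $ i) = (\<lambda>y. pd i (u s) y $ i)" for i
      using has_pd_imp_pd[OF has_pd_linear[OF bounded_linear_vec_nth Cb_has_pd[OF cu, of "[]" i]]] k by simp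
    moreover have "divergence (u s) y = 0" using div_u sT by blast
    ultimately have dv: "pd 2 (u s) y $ 2 = - pd 1 (u s) y $ 1" unfolding divergence_def sum_2 by simp
    show "\<nu> * laplacian (\<theta> s) y - (\<Sum>i\<in>UNIV. u s y $ i * pd i (\<theta> s) y) + (\<Sum>i\<in>UNIV. U s $ i * pd i (\<theta> s) y)
      = \<nu> * (pd 1 (pd 1 (\<theta> s)) y + pd 2 (pd 2 (\<theta> s)) y) - (fp 1 y + fp 2 y)"
      unfolding laplacian_def sum_2 fp_def dv by (simp add: algebra_simps)
  qed
  have Gi: "integrable lborel G" by (rule kernel_integrable[OF G(1)])
  obtain P where P: "\<And>i y. \<bar>pd i (pd i (\<theta> s)) y\<bar> \<le> P"
    using bdd(2)[of 1] bdd(2)[of 2] by (metis exhaust_2 linorder_le_cases order_trans)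
  obtain Q where Q: "\<And>i y. \<bar>fp i y\<bar> \<le> Q"
    using fpb[of 1] fpb[of 2] by (metis exhaust_2 linorder_le_cases order_trans)
  have m: "fp i \<in> borel_measurable borel" "pd i (pd i (\<theta> s)) \<in> borel_measurable borel" for i
    by (intro borel_measurable_continuous_onI fc con)+
  have "kconv G (\<lambda>y. \<nu> * (pd 1 (pd 1 (\<theta> s)) y + pd 2 (pd 2 (\<theta> s)) y) - (fp 1 y + fp 2 y)) z
    = \<nu> *\<^sub>R (kconv G (pd 1 (pd 1 (\<theta> s))) z + kconv G (pd 2 (pd 2 (\<theta> s))) z) - (kconv G (fp 1) z + kconv G (fp 2) z)"
  proof -
    have pp: "\<bar>pd 1 (pd 1 (\<theta> s)) y + pd 2 (pd 2 (\<theta> s)) y\<bar> \<le> P + P" for y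
      using P[of 1 y] P[of 2 y] by linarith
    have qq: "\<bar>fp 1 y + fp 2 y\<bar> \<le> Q + Q" for y using Q[of 1 y] Q[of 2 y] by linarith
    have "\<bar>\<nu> * (pd 1 (pd 1 (\<theta> s)) y + pd 2 (pd 2 (\<theta> s)) y)\<bar> \<le> \<nu> * (P + P)" for y
      using pp[of y] \<nu> by (simp add: abs_mult)
    then have "kconv G (\<lambda>y. \<nu> * (pd 1 (pd 1 (\<theta> s)) y + pd 2 (pd 2 (\<theta> s)) y) - (fp 1 y + fp 2 y)) z
      = kconv G (\<lambda>y. \<nu> * (pd 1 (pd 1 (\<theta> s)) y + pd 2 (pd 2 (\<theta> s)) y)) z - kconv G (\<lambda>y. fp 1 y + fp 2 y) z"
      using m qq by (intro kconv_diff[OF Gi]) (auto intro!: borel_measurable_times borel_measurable_add)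
    also have "\<dots> = \<nu> *\<^sub>R kconv G (\<lambda>y. pd 1 (pd 1 (\<theta> s)) y + pd 2 (pd 2 (\<theta> s)) y) z - kconv G (\<lambda>y. fp 1 y + fp 2 y) z"
      by (simp only: kconv_scale)
    also have "kconv G (\<lambda>y. pd 1 (pd 1 (\<theta> s)) y + pd 2 (pd 2 (\<theta> s)) y) z = kconv G (pd 1 (pd 1 (\<theta> s))) z + kconv G (pd 2 (pd 2 (\<theta> s))) z"
      by (rule kconv_add[OF Gi m(2) P m(2) P])
    also have "kconv G (\<lambda>y. fp 1 y + fp 2 y) z = kconv G (fp 1) z + kconv G (fp 2) z"
      by (rule kconv_add[OF Gi m(1) Q m(1) Q])
    finally show ?thesis .
  qed
  moreover have "kconv G (pd i (pd i (\<theta> s))) z = kconv (G'' i) (\<theta> s) z" for i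
  proof -
    obtain B where B: "\<And>y. \<bar>pd i (\<theta> s) y\<bar> \<le> B" using bdd(1) by blast
    have "kconv G (pd i (pd i (\<theta> s))) z = kconv (G' i) (pd i (\<theta> s)) z"
      by (rule kconv_by_parts[OF G(2) G(1) G(3) d\<theta>(2) con(2) con(3) B P])
    also have "\<dots> = kconv (G'' i) (\<theta> s) z"
      by (rule kconv_by_parts[OF G(4) G(3) G(5) d\<theta>(1) con(1) con(2) b\<theta> B])
    finally show ?thesis .
  qed
  moreover have "kconv G (fp i) z = kconv (G' i) (flux U i s) z" for i
    by (rule kconv_by_parts[OF G(2) G(1) G(3) fpd fc fb Q])
  ultimately show ?thesis unfolding e by (simp only: sum_2)
qed

text \<open>At time 0 only continuity of the solution is available, and the differentiation lemma
  covers interior times. The fundamental theorem of calculus is therefore used in the form that asks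
  for the derivative in the open interval and for continuity on the closed one.\<close>

lemma integrated_transport:
  fixes G :: "real^2 \<Rightarrow> 'b::euclidean_space" and x :: "real^2"
  assumes t: "t \<in> {0..T}" and G: "kernel G" "\<And>i. has_pd i G (G' i)" "\<And>i. kernel (G' i)" "\<And>i. has_pd i (G' i) (G'' i)" "\<And>i. kernel (G'' i)"
    and U: "continuous_on {0..T} U" and X: "\<And>s. s \<in> {0..T} \<Longrightarrow> X s = integral {0..s} U"
  defines "f \<equiv> \<lambda>s. \<nu> *\<^sub>R (\<Sum>i\<in>UNIV. kconv (G'' i) (\<theta> s) (x + X s)) - (\<Sum>i\<in>UNIV. kconv (G' i) (flux U i s) (x + X s))"
  shows "kconv G (\<theta> t) (x + X t) - kconv G \<theta>0 x = (LBINT s:{0..t}. f s)"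
proof -
  obtain BU where "\<forall>v\<in>U ` {0..T}. norm v \<le> BU"
    using compact_imp_bounded[OF compact_continuous_image[OF U compact_Icc]] unfolding bounded_iff by blast
  then have BU: "norm (U s) \<le> BU" if "s \<in> {0..T}" for s using that by blast
  have Xc: "continuous_on {0..T} X"
    by (rule continuous_on_eq[OF indefinite_integral_continuous_1[OF integrable_continuous_real[OF U]]]) (simp add: X)
  have Xd: "(X has_vector_derivative U s) (at s)" if "s \<in> {0<..<T}" for s
  proof -
    have "((\<lambda>s. integral {0..s} U) has_vector_derivative U s) (at s within {0..T})"
      using integral_has_vector_derivative[OF U] that by simp
    then have "(X has_vector_derivative U s) (at s within {0..T})"
      by (rule has_vector_derivative_transform[rotated 2]) (use X that in auto)
    then have "(X has_vector_derivative U s) (at s within {0<..<T})"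
      by (rule has_vector_derivative_within_subset) auto
    then show ?thesis using at_within_open[OF that] by simp
  qed
  have zc: "continuous_on {0..T} (\<lambda>s. x + X s)" by (intro continuous_intros Xc)
  have Fc: "continuous_on {0..T} (\<lambda>s. kconv H (\<theta> s) (x + X s))" if "kernel H" for H :: "real^2 \<Rightarrow> 'b"
    by (rule kconv_continuous_param[OF kernel_integrable[OF that] \<theta>_cont, where B=M\<theta>]) (use M\<theta> zc in \<open>auto intro!: continuous_intros\<close>)
  have Fl: "continuous_on {0..T} (\<lambda>s. kconv H (flux U i s) (x + X s))" if "kernel H" for H :: "real^2 \<Rightarrow> 'b" and i
    by (rule kconv_continuous_param[OF kernel_integrable[OF that] flux_cont[OF U], where B="M\<theta> * (Mu + BU)"])
       (use flux_le BU zc in \<open>auto intro!: continuous_intros\<close>)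
  have fc: "continuous_on {0..T} f" unfolding f_def by (intro continuous_intros Fc Fl G)
  have "(f has_integral (kconv G (\<theta> t) (x + X t) - kconv G (\<theta> 0) (x + X 0))) {0..t}"
  proof (rule fundamental_theorem_of_calculus_interior)
    show "0 \<le> t" using t by simp
    show "continuous_on {0..t} (\<lambda>s. kconv G (\<theta> s) (x + X s))"
      using t by (intro continuous_on_subset[OF Fc[OF G(1)]]) auto
    fix s assume "s \<in> {0<..<t}"
    then have s: "s \<in> {0<..<T}" using t by auto
    show "((\<lambda>s. kconv G (\<theta> s) (x + X s)) has_vector_derivative f s) (at s)"
      using deriv_kconv[OF s G(1) Xd[OF s], of x] unfolding kconv_transport_rhs[OF s G] f_def .
  qed
  moreover have "set_integrable lborel {0..t} f"
    using t by (intro borel_integrable_atLeastAtMost' continuous_on_subset[OF fc]) auto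
  then have "(f has_integral (LBINT s:{0..t}. f s)) {0..t}"
    using set_borel_integral_eq_integral[of "{0..t}" f] by (simp add: has_integral_integral)
  ultimately have "kconv G (\<theta> t) (x + X t) - kconv G (\<theta> 0) (x + X 0) = (LBINT s:{0..t}. f s)"
    by (rule has_integral_unique)
  moreover have "X 0 = 0" using X[of 0] T by simp
  ultimately show ?thesis by (simp add: init)
qed

end


section \<open>The representation formula\<close>

context solution
begin

lemma u0_facts: "continuous_on UNIV u0" "norm (u0 x) \<le> Mu" "continuous_on UNIV \<theta>0" "\<bar>\<theta>0 x\<bar> \<le> M\<theta>"
  using u_continuous[of 0] Mu(2)[of 0 x] \<theta>_continuous[of 0] M\<theta>(2)[of 0 x] T by (simp_all add: init)

lemma hom_law_t: assumes "t \<in> {0..T}" shows "LP_block \<phi> j (u t) x = kconv (mollK (dilate \<phi> j)) (\<theta> t) x"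
proof -
  have "hom_law \<phi> (\<theta> t) (u t)"
    using law init assms by (cases "t = 0") auto
  then show ?thesis
    by (simp add: hom_law_def mollify_K[OF schwartz_dilate_\<phi>] conv_eq_kconv)
qed

text \<open>The integrand of the representation formula, seen from the curve \<open>X\<close> with
  the flux relative to \<open>U\<close>; the frame at rest gives back the original integrand, see
  \<open>source_O\<close>.\<close>

definition source :: "int \<Rightarrow> (real \<Rightarrow> real^2) \<Rightarrow> (real \<Rightarrow> real^2) \<Rightarrow> real \<Rightarrow> real^2 \<Rightarrow> real^2" where
  "source N U X s x = (\<Sum>i\<in>UNIV. kconv (mollK (pd i (chis N))) (flux U i s) (x + X s)) - \<nu> *\<^sub>R kconv (mollLapK (chis N)) (\<theta> s) (x + X s)"

text \<open>The low-frequency part of the formula, in a frame following the curve \<open>X\<close>.\<close>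

definition balance :: "int \<Rightarrow> (real \<Rightarrow> real^2) \<Rightarrow> (real \<Rightarrow> real^2) \<Rightarrow> real \<Rightarrow> real^2 \<Rightarrow> real^2" where
  "balance N U X t x = lowpass N (u t) (x + X t) - lowpass N u0 x + (LBINT s:{0..t}. source N U X s x)"

context
  fixes U X :: "real \<Rightarrow> real^2"
  assumes U: "continuous_on {0..T} U" and X: "\<And>s. s \<in> {0..T} \<Longrightarrow> X s = integral {0..s} U"
begin

lemma X_continuous: "continuous_on {0..T} X"
  by (rule continuous_on_eq[OF indefinite_integral_continuous_1[OF integrable_continuous_real[OF U]]]) (simp add: X)

lemma U_bounded: obtains B where "\<And>s. s \<in> {0..T} \<Longrightarrow> norm (U s) \<le> B" "B \<ge> 0"
proof -
  obtain B where B: "\<forall>v\<in>U ` {0..T}. norm v \<le> B"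
    using compact_imp_bounded[OF compact_continuous_image[OF U compact_Icc]] unfolding bounded_iff by blast
  have "norm (U 0) \<le> B" using B T by auto
  then have "0 \<le> B" using norm_ge_zero order_trans by blast
  then show ?thesis using that B by blast
qed

lemma kconv_flux_continuous:
  assumes "kernel H"
  shows "continuous_on ({0..T} \<times> UNIV) (\<lambda>p. kconv H (flux U i (fst p)) (snd p + X (fst p)))"
    and "continuous_on ({0..T} \<times> UNIV) (\<lambda>p. kconv H (\<theta> (fst p)) (snd p + X (fst p)))"
proof -
  obtain B where B: "\<And>s. s \<in> {0..T} \<Longrightarrow> norm (U s) \<le> B" using U_bounded by blast
  have z: "continuous_on ({0..T} \<times> UNIV) (\<lambda>p. snd p + X (fst p))"
    by (intro continuous_intros continuous_on_compose2[OF X_continuous]) auto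
  show "continuous_on ({0..T} \<times> UNIV) (\<lambda>p. kconv H (flux U i (fst p)) (snd p + X (fst p)))"
    by (rule kconv_continuous_param[OF kernel_integrable[OF assms] flux_cont[OF U], where B="M\<theta> * (Mu + B)"])
       (use flux_le B z in \<open>auto intro!: continuous_intros\<close>)
  show "continuous_on ({0..T} \<times> UNIV) (\<lambda>p. kconv H (\<theta> (fst p)) (snd p + X (fst p)))"
    by (rule kconv_continuous_param[OF kernel_integrable[OF assms] \<theta>_cont, where B=M\<theta>])
       (use M\<theta> z in \<open>auto intro!: continuous_intros\<close>)
qed

lemma source_continuous2: "continuous_on ({0..T} \<times> UNIV) (\<lambda>p. source N U X (fst p) (snd p))"
  unfolding source_def
  by (intro continuous_on_diff continuous_on_sum continuous_on_scaleR continuous_on_const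
      kconv_flux_continuous[OF kernel_mollK_pd[OF schwartz_chis]] kconv_flux_continuous[OF kernel_mollLapK[OF schwartz_chis]])

lemma source_continuous: "continuous_on {0..T} (\<lambda>s. source N U X s x)"
proof -
  have "continuous_on {0..T} (\<lambda>s. source N U X (fst (s, x)) (snd (s, x)))"
    by (rule continuous_on_compose2[OF source_continuous2]) (auto intro!: continuous_on_Pair continuous_on_id continuous_on_const)
  then show ?thesis by simp
qed

lemma source_integrable: "t \<in> {0..T} \<Longrightarrow> set_integrable lborel {0..t} (\<lambda>s. source N U X s x)"
  by (intro borel_integrable_atLeastAtMost' continuous_on_subset[OF source_continuous]) auto

lemma flux_measurable: "s \<in> {0..T} \<Longrightarrow> flux U i s \<in> borel_measurable borel"
  by (intro borel_measurable_continuous_onI continuous_on_slice[OF flux_cont[OF U]])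

lemma balance_Suc:
  assumes t: "t \<in> {0..T}" shows "balance (N + 1) U X t x = balance N U X t x"
proof -
  let ?p = "dilate \<phi> N"
  obtain B where B: "\<And>s. s \<in> {0..T} \<Longrightarrow> norm (U s) \<le> B" using U_bounded by blast
  \<comment> \<open>The rate of change of the block of K convolved with the scalar along the curve.
    It is the amount by which the integrand drops from frequency \<open>N\<close> to
    \<open>N + 1\<close>.\<close>
  define f where "f s = \<nu> *\<^sub>R (\<Sum>i\<in>UNIV. kconv (mollK (pd i (pd i ?p))) (\<theta> s) (x + X s)) - (\<Sum>i\<in>UNIV. kconv (mollK (pd i ?p)) (flux U i s) (x + X s))" for s
  note sp = schwartz_dilate_\<phi>
  have int: "kconv (mollK ?p) (\<theta> t) (x + X t) - kconv (mollK ?p) \<theta>0 x = (LBINT s:{0..t}. f s)"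
    unfolding f_def
    by (rule integrated_transport[OF t kernel_mollK_dilate_\<phi> has_pd_mollK[OF sp] kernel_mollK_pd[OF sp] has_pd_mollK[OF schwartz_pd[OF sp]] kernel_mollK_pd[OF schwartz_pd[OF sp]] U X])
  have Js: "source (N + 1) U X s x = source N U X s x - f s" if s: "s \<in> {0..T}" for s
  proof -
    have 1: "kconv (mollK (pd i (chis (N + 1)))) (flux U i s) z = kconv (mollK (pd i (chis N))) (flux U i s) z + kconv (mollK (pd i ?p)) (flux U i s) z" for i z
    proof -
      have "mollK (pd i (chis (N + 1))) = (\<lambda>x. mollK (pd i (chis N)) x + mollK (pd i ?p) x)"
        by (rule ext) (rule mollK_pd_add(1)[OF schwartz_chis sp chis_Suc])
      then show ?thesis
        using kconv_add_kernel[OF kernel_integrable[OF kernel_mollK_pd[OF schwartz_chis]] kernel_integrable[OF kernel_mollK_pd[OF sp]] flux_measurable[OF s] flux_le[where U=U, OF s B[OF s]]]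
        by simp
    qed
    have 2: "kconv (mollLapK (chis (N + 1))) (\<theta> s) z = kconv (mollLapK (chis N)) (\<theta> s) z + kconv (mollLapK ?p) (\<theta> s) z" for z
    proof -
      have "mollLapK (chis (N + 1)) = (\<lambda>x. mollLapK (chis N) x + mollLapK ?p x)"
        by (rule ext) (rule mollK_pd_add(2)[OF schwartz_chis sp chis_Suc])
      then show ?thesis
        using kconv_add_kernel[OF kernel_integrable[OF kernel_mollLapK[OF schwartz_chis]] kernel_integrable[OF kernel_mollLapK[OF sp]] \<theta>_measurable[OF s] M\<theta>(2)[OF s]]
        by simp
    qed
    have 3: "kconv (mollLapK ?p) (\<theta> s) z = (\<Sum>i\<in>UNIV. kconv (mollK (pd i (pd i ?p))) (\<theta> s) z)" for z
      using kconv_add_kernel[OF kernel_integrable[OF kernel_mollK_pd[OF schwartz_pd[OF sp]]] kernel_integrable[OF kernel_mollK_pd[OF schwartz_pd[OF sp]]] \<theta>_measurable[OF s] M\<theta>(2)[OF s]]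
      unfolding mollLapK_def[abs_def] sum_2 by blast
    show ?thesis unfolding source_def f_def 1 2 3 sum.distrib by (simp add: algebra_simps)
  qed
  have fc: "continuous_on {0..T} f"
    by (rule continuous_on_eq[OF continuous_on_diff[OF source_continuous[of N x] source_continuous[of "N + 1" x]]]) (simp add: Js)
  have fi: "set_integrable lborel {0..t} f"
    using t by (intro borel_integrable_atLeastAtMost' continuous_on_subset[OF fc]) auto
  have "(LBINT s:{0..t}. source (N + 1) U X s x) = (LBINT s:{0..t}. source N U X s x - f s)"
    by (rule set_lebesgue_integral_cong) (use Js t in auto)
  also have "\<dots> = (LBINT s:{0..t}. source N U X s x) - (LBINT s:{0..t}. f s)"
    by (rule set_integral_diff(2)[OF source_integrable[OF t] fi])
  finally have "(LBINT s:{0..t}. source (N + 1) U X s x) = (LBINT s:{0..t}. source N U X s x) - (kconv (mollK ?p) (\<theta> t) (x + X t) - kconv (mollK ?p) \<theta>0 x)"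
    unfolding int .
  moreover have "lowpass (N + 1) (u t) z = lowpass N (u t) z + kconv (mollK ?p) (\<theta> t) z" for z
    using lowpass_Suc[OF u_continuous[OF t] Mu(2)[OF t]] hom_law_t[OF t] by simp
  moreover have "lowpass (N + 1) u0 z = lowpass N u0 z + kconv (mollK ?p) \<theta>0 z" for z
    using lowpass_Suc[OF u0_facts(1,2)] hom_law_t[of 0] T by (simp add: init)
  ultimately show ?thesis unfolding balance_def by simp
qed

lemma balance_eq_0: assumes "t \<in> {0..T}" shows "balance N U X t x = balance 0 U X t x"
proof (induction N rule: int_induct[where k=0])
  case (step1 i)
  then show ?case by (simp only: balance_Suc[OF assms])
next
  case (step2 i)
  then show ?case using balance_Suc[OF assms, of "i - 1" x] by simp
qed simp

text \<open>Flux and scalar are bounded uniformly in time and space, so the L1 norms of the two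
  low-frequency kernels control the integrand.\<close>

lemma source_tendsto_0:
  assumes t: "t \<in> {0..T}" shows "(\<lambda>m. LBINT s:{0..t}. source (- int m) U X s x) \<longlonglongrightarrow> 0"
proof -
  obtain B where B: "\<And>s. s \<in> {0..T} \<Longrightarrow> norm (U s) \<le> B" using U_bounded by blast
  define b where "b m = (\<Sum>i\<in>UNIV. (M\<theta> * (Mu + B)) * (LBINT y. norm (mollK (pd i (chis (- int m))) y))) + \<nu> * (M\<theta> * (LBINT y. norm (mollLapK (chis (- int m)) y)))" for m
  have "b \<longlonglongrightarrow> (\<Sum>i\<in>(UNIV::2 set). (M\<theta> * (Mu + B)) * 0) + \<nu> * (M\<theta> * 0)"
    unfolding b_def[abs_def] by (intro tendsto_intros kconv_low_freq_tendsto_0)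
  then have b0: "b \<longlonglongrightarrow> 0" by simp
  have le: "norm (source (- int m) U X s x) \<le> b m" if s: "s \<in> {0..T}" for m s
  proof -
    have "norm (source (- int m) U X s x) \<le> norm (\<Sum>i\<in>UNIV. kconv (mollK (pd i (chis (- int m)))) (flux U i s) (x + X s)) + norm (\<nu> *\<^sub>R kconv (mollLapK (chis (- int m))) (\<theta> s) (x + X s))"
      unfolding source_def by (rule norm_triangle_ineq4)
    also have "\<dots> \<le> b m"
      unfolding b_def
    proof (rule add_mono)
      show "norm (\<Sum>i\<in>UNIV. kconv (mollK (pd i (chis (- int m)))) (flux U i s) (x + X s)) \<le> (\<Sum>i\<in>UNIV. (M\<theta> * (Mu + B)) * (LBINT y. norm (mollK (pd i (chis (- int m))) y)))"
        by (intro sum_norm_le kconv_norm_le kernel_integrable kernel_mollK_pd schwartz_chis flux_measurable flux_le s B)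
      show "norm (\<nu> *\<^sub>R kconv (mollLapK (chis (- int m))) (\<theta> s) (x + X s)) \<le> \<nu> * (M\<theta> * (LBINT y. norm (mollLapK (chis (- int m)) y)))"
        using \<nu> kconv_norm_le[OF kernel_integrable[OF kernel_mollLapK[OF schwartz_chis]] \<theta>_measurable[OF s] M\<theta>(2)[OF s]]
        by (auto intro!: mult_left_mono)
    qed
    finally show ?thesis .
  qed
  have nb: "norm (LBINT s:{0..t}. source (- int m) U X s x) \<le> t * b m" for m
  proof -
    have "norm (LBINT s:{0..t}. source (- int m) U X s x) \<le> (LBINT s:{0..t}. norm (source (- int m) U X s x))"
      by (rule set_integral_norm_bound[OF source_integrable[OF t]])
    also have "\<dots> \<le> (LBINT s:{0..t}. b m)"
    proof (rule set_integral_mono)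
      show "set_integrable lborel {0..t} (\<lambda>s. norm (source (- int m) U X s x))"
        using source_integrable[OF t] by (rule set_integrable_norm)
      show "set_integrable lborel {0..t} (\<lambda>s. b m)" by (rule borel_integrable_atLeastAtMost') simp
    qed (use le t in auto)
    also have "\<dots> = t * b m" using t by (simp add: set_lebesgue_integral_def)
    finally show ?thesis .
  qed
  show ?thesis
    by (rule Lim_null_comparison[OF always_eventually[OF allI[OF nb]] tendsto_mult_right_zero[OF b0]])
qed

end

section \<open>The velocity at infinity\<close>

definition Uinf :: "real \<Rightarrow> real^2" where
  "Uinf t = balance 0 (\<lambda>_. 0) (\<lambda>_. 0) t 0"

text \<open>The frame along \<open>X\<close> at the point \<open>x\<close> is compared with the
  frame at rest at the origin, both at frequency index -m. As m grows, the low-pass terms forget the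
  point and the sources vanish, while the difference of the two balances does not depend on m. Hence
  the choice of frequency, point and frame in the definition of \<open>Uinf\<close> is
  immaterial.\<close>

lemma balance_eq_Uinf:
  assumes U: "continuous_on {0..T} U" and X: "\<And>s. s \<in> {0..T} \<Longrightarrow> X s = integral {0..s} U" and t: "t \<in> {0..T}"
  shows "balance N U X t x = Uinf t"
proof -
  let ?O = "\<lambda>_::real. 0 :: real^2"
  have O: "continuous_on {0..T} ?O" "\<And>s. s \<in> {0..T} \<Longrightarrow> ?O s = integral {0..s} ?O" by auto
  have "(\<lambda>m. (lowpass (- int m) (u t) (x + X t) - lowpass (- int m) (u t) 0) - (lowpass (- int m) u0 x - lowpass (- int m) u0 0)
     + (LBINT s:{0..t}. source (- int m) U X s x) - (LBINT s:{0..t}. source (- int m) ?O ?O s 0)) \<longlonglongrightarrow> 0 - 0 + 0 - 0"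
    by (intro tendsto_diff tendsto_add lowpass_diff_tendsto_0[OF u_continuous[OF t] Mu(2)[OF t]] lowpass_diff_tendsto_0[OF u0_facts(1,2)]
        source_tendsto_0[OF U X t] source_tendsto_0[OF O t])
  moreover have "(lowpass (- int m) (u t) (x + X t) - lowpass (- int m) (u t) 0) - (lowpass (- int m) u0 x - lowpass (- int m) u0 0)
     + (LBINT s:{0..t}. source (- int m) U X s x) - (LBINT s:{0..t}. source (- int m) ?O ?O s 0) = balance 0 U X t x - Uinf t" for m
  proof -
    have "balance 0 U X t x - Uinf t = balance (- int m) U X t x - balance (- int m) ?O ?O t 0"
      unfolding Uinf_def using balance_eq_0[OF U X t, of "- int m" x] balance_eq_0[OF O t, of "- int m" 0] by simp
    then show ?thesis by (simp add: balance_def algebra_simps)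
  qed
  ultimately have "balance 0 U X t x - Uinf t = 0"
    by (simp add: LIMSEQ_const_iff)
  then show ?thesis using balance_eq_0[OF U X t, of N x] by simp
qed

lemma O_facts: "continuous_on {0..T} (\<lambda>_::real. 0 :: real^2)" "s \<in> {0..T} \<Longrightarrow> (0 :: real^2) = integral {0..s} (\<lambda>_::real. 0)"
  by auto

lemma Uinf_0: "Uinf 0 = 0"
proof -
  have "(LBINT s:{0..0}. source 0 (\<lambda>_. 0) (\<lambda>_. 0) s 0) = integral {0..0} (\<lambda>s. source 0 (\<lambda>_. 0) (\<lambda>_. 0) s 0)"
    using T by (intro set_borel_integral_eq_integral source_integrable[OF O_facts]) auto
  then show ?thesis unfolding Uinf_def balance_def by (simp add: init)
qed

lemma Uinf_continuous: "continuous_on {0..T} Uinf"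
proof -
  have 1: "continuous_on {0..T} (\<lambda>t. lowpass 0 (u t) 0)"
    unfolding lowpass_def
  proof (rule continuous_on_integral_param[where w="\<lambda>y. \<bar>chis 0 (0 - y)\<bar> * Mu"])
    have [measurable]: "chis 0 \<in> borel_measurable borel" using chis_integrable by auto
    show "(\<lambda>y. chis 0 (0 - y) *\<^sub>R u t y) \<in> borel_measurable borel" if "t \<in> {0..T}" for t
    proof -
      have [measurable]: "u t \<in> borel_measurable borel" by (intro borel_measurable_continuous_onI u_continuous that)
      show ?thesis by measurable
    qed
    show "continuous_on {0..T} (\<lambda>t. chis 0 (0 - y) *\<^sub>R u t y)" for y
    proof -
      have "continuous_on {0..T} (\<lambda>t. case (t, y) of (t, y) \<Rightarrow> u t y)"
        by (rule continuous_on_compose2[OF u_cont]) (auto intro!: continuous_intros)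
      then show ?thesis by (intro continuous_intros) simp
    qed
    show "integrable lborel (\<lambda>y. \<bar>chis 0 (0 - y)\<bar> * Mu)"
      using chis_integrable integrable_lborel_reflect[of "chis 0" 0] by (intro integrable_mult_left integrable_abs) blast
    show "norm (chis 0 (0 - y) *\<^sub>R u t y) \<le> \<bar>chis 0 (0 - y)\<bar> * Mu" if "t \<in> {0..T}" for t y
      using Mu(2)[OF that] by (auto intro!: mult_left_mono)
  qed
  have "continuous_on {0..T} (\<lambda>t. integral {0..t} (\<lambda>s. source 0 (\<lambda>_. 0) (\<lambda>_. 0) s 0))"
    by (intro indefinite_integral_continuous_1 integrable_continuous_real source_continuous[OF O_facts])
  then have 2: "continuous_on {0..T} (\<lambda>t. LBINT s:{0..t}. source 0 (\<lambda>_. 0) (\<lambda>_. 0) s 0)"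
    by (rule continuous_on_eq) (use set_borel_integral_eq_integral(2)[OF source_integrable[OF O_facts]] in auto)
  show ?thesis unfolding Uinf_def[abs_def] balance_def using 1 2 by (intro continuous_intros) auto
qed

lemma lowpass_diff:
  assumes "t \<in> {0..T}" shows "lowpass N (\<lambda>y. u t y - u0 y) x = lowpass N (u t) x - lowpass N u0 x"
  unfolding lowpass_def scaleR_diff_right
  by (rule Bochner_Integration.integral_diff)
     (rule kernel_conv_integrable[OF chis_integrable borel_measurable_continuous_onI[OF u_continuous[OF assms]] Mu(2)[OF assms]],
      rule kernel_conv_integrable[OF chis_integrable borel_measurable_continuous_onI[OF u0_facts(1)] u0_facts(2)])

lemma source_O: "source N (\<lambda>_. 0) (\<lambda>_. 0) s x = SN_gradK_conv (chis N) (\<lambda>y. \<theta> s y *\<^sub>R u s y) x - \<nu> *\<^sub>R SN_lapK_conv (chis N) (\<theta> s) x"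
  by (simp add: source_def SN_gradK_conv_def SN_lapK_conv_def conv_eq_kconv mollify_laplacian_K[OF schwartz_chis]
      mollify_K[OF schwartz_chis] has_pd_imp_pd[OF has_pd_mollK[OF schwartz_chis]] flux_def[abs_def])

lemma representation:
  assumes t: "t \<in> {0..T}"
  shows "\<exists>HNK. is_HN_conv \<phi> N (\<lambda>y. \<theta> t y - \<theta>0 y) HNK \<and>
        (\<forall>x. u t x - u0 x = Uinf t
          - (LBINT s:{0..t}. SN_gradK_conv (chis N) (\<lambda>y. \<theta> s y *\<^sub>R u s y) x - \<nu> *\<^sub>R SN_lapK_conv (chis N) (\<theta> s) x)
          + HNK x)"
proof (intro exI conjI allI)
  define w where "w y = u t y - u0 y" for y
  have wc: "continuous_on UNIV w" unfolding w_def by (intro continuous_intros u_continuous t u0_facts)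
  have wb: "norm (w x) \<le> 2 * Mu" for x
    using norm_triangle_ineq4[of "u t x" "u0 x"] Mu(2)[OF t, of x] u0_facts(2)[of x] by (simp add: w_def)
  define C where "C = 2 * Mu * (LBINT y. \<bar>chis 0 y\<bar>)"
  have SC: "norm (lowpass n w x) \<le> C" for n x unfolding C_def by (rule lowpass_le[OF wc wb])
  have C0: "0 \<le> C" using SC[of 0 0] norm_ge_zero order_trans by blast
  let ?H = "\<lambda>x. w x - lowpass N w x"
  show "u t x - u0 x = Uinf t
          - (LBINT s:{0..t}. SN_gradK_conv (chis N) (\<lambda>y. \<theta> s y *\<^sub>R u s y) x - \<nu> *\<^sub>R SN_lapK_conv (chis N) (\<theta> s) x)
          + ?H x" for x
  proof -
    have "Uinf t = lowpass N (u t) x - lowpass N u0 x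
      + (LBINT s:{0..t}. SN_gradK_conv (chis N) (\<lambda>y. \<theta> s y *\<^sub>R u s y) x - \<nu> *\<^sub>R SN_lapK_conv (chis N) (\<theta> s) x)"
      using balance_eq_Uinf[OF O_facts t, of N x] unfolding balance_def source_O by simp
    moreover have "lowpass N w x = lowpass N (u t) x - lowpass N u0 x"
      using lowpass_diff[OF t, of N x] unfolding w_def[abs_def] .
    ultimately show ?thesis by (simp add: w_def)
  qed
  have blk: "conv (mollify (dilate \<phi> j) K) (\<lambda>y. \<theta> t y - \<theta>0 y) x = LP_block \<phi> j w x" for j x
  proof -
    have "conv (mollify (dilate \<phi> j) K) (\<lambda>y. \<theta> t y - \<theta>0 y) x = kconv (mollK (dilate \<phi> j)) (\<theta> t) x - kconv (mollK (dilate \<phi> j)) \<theta>0 x"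
      unfolding conv_eq_kconv mollify_K[OF schwartz_dilate_\<phi>]
      by (rule kconv_diff[OF kernel_integrable[OF kernel_mollK_dilate_\<phi>] \<theta>_measurable[OF t] M\<theta>(2)[OF t] borel_measurable_continuous_onI[OF u0_facts(3)] u0_facts(4)])
    also have "\<dots> = LP_block \<phi> j (u t) x - LP_block \<phi> j u0 x"
      using hom_law_t[OF t] hom_law_t[of 0] T by (simp add: init)
    \<comment> \<open>Additivity of the block follows from that of the low-pass operators, since a
      block is a difference of two of them.\<close>
    also have "\<dots> = LP_block \<phi> j w x"
      using lowpass_Suc[OF wc wb, of j x] lowpass_Suc[OF u_continuous[OF t] Mu(2)[OF t], of j x] lowpass_Suc[OF u0_facts(1,2), of j x]
        lowpass_diff[OF t, of j x] lowpass_diff[OF t, of "j + 1" x] unfolding w_def[abs_def] by simp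
    finally show ?thesis .
  qed
  show "is_HN_conv \<phi> N (\<lambda>y. \<theta> t y - \<theta>0 y) ?H"
    unfolding is_HN_conv_def blk
  proof (intro conjI allI impI)
    show "continuous_on UNIV ?H" by (intro continuous_intros wc lowpass_continuous[OF wc wb])
    have "norm (?H x) \<le> 2 * Mu + C" for x
      using norm_triangle_ineq4[of "w x" "lowpass N w x"] wb[of x] SC[of N x] by simp
    then show "bounded (range ?H)" by (auto simp: bounded_iff)
    fix \<psi> assume \<psi>: "schwartz \<psi>"
    have \<psi>i: "integrable lborel \<psi>" by (intro kernel_integrable schwartz_kernel \<psi>)
    have [measurable]: "\<psi> \<in> borel_measurable borel" "w \<in> borel_measurable borel" "lowpass n w \<in> borel_measurable borel" for n
      using \<psi>i by (auto intro: borel_measurable_continuous_onI wc lowpass_continuous[OF wc wb])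
    have bi: "integrable lborel (\<lambda>y. \<psi> y *\<^sub>R LP_block \<phi> j w y)" for j
    proof (rule Bochner_Integration.integrable_bound)
      have e: "LP_block \<phi> j w y = lowpass (j + 1) w y - lowpass j w y" for y using lowpass_Suc[OF wc wb, of j y] by simp
      show "integrable lborel (\<lambda>y. (2 * C) * \<psi> y)" using \<psi>i by simp
      show "(\<lambda>y. \<psi> y *\<^sub>R LP_block \<phi> j w y) \<in> borel_measurable lborel" unfolding e by measurable
      show "AE y in lborel. norm (\<psi> y *\<^sub>R LP_block \<phi> j w y) \<le> norm ((2 * C) * \<psi> y)"
      proof (rule AE_I2)
        fix y
        have "norm (LP_block \<phi> j w y) \<le> 2 * C"
          unfolding e using norm_triangle_ineq4[of "lowpass (j + 1) w y" "lowpass j w y"] SC[of "j + 1" y] SC[of j y] by simp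
        from mult_left_mono[OF this, of "\<bar>\<psi> y\<bar>"]
        show "norm (\<psi> y *\<^sub>R LP_block \<phi> j w y) \<le> norm ((2 * C) * \<psi> y)" using C0 by (simp add: abs_mult mult.commute)
      qed
    qed
    \<comment> \<open>The partial sums telescope to a difference of low-pass terms, which are
      bounded uniformly in the frequency; the test function then provides the majorant for the
      limit.\<close>
    have "(\<Sum>j<m. LBINT y. \<psi> y *\<^sub>R LP_block \<phi> (N + int j) w y) = (LBINT y. \<psi> y *\<^sub>R (lowpass (int m + N) w y - lowpass N w y))" for m
    proof -
      have "(\<Sum>j<m. LBINT y. \<psi> y *\<^sub>R LP_block \<phi> (N + int j) w y) = (LBINT y. \<Sum>j<m. \<psi> y *\<^sub>R LP_block \<phi> (N + int j) w y)"
        by (rule Bochner_Integration.integral_sum[symmetric]) (rule bi)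
      also have "\<dots> = (LBINT y. \<psi> y *\<^sub>R (lowpass (int m + N) w y - lowpass N w y))"
        by (intro Bochner_Integration.integral_cong refl) (simp add: scaleR_sum_right[symmetric] lowpass_sum[OF wc wb, of N m] add.commute[of "int m"])
      finally show ?thesis .
    qed
    moreover have "(\<lambda>m. LBINT y. \<psi> y *\<^sub>R (lowpass (int m + N) w y - lowpass N w y)) \<longlonglongrightarrow> (LBINT y. \<psi> y *\<^sub>R ?H y)"
    proof (rule integral_dominated_convergence[where w="\<lambda>y. \<bar>\<psi> y\<bar> * (2 * C)"])
      show "integrable lborel (\<lambda>y. \<bar>\<psi> y\<bar> * (2 * C))" using \<psi>i by simp
      show "AE y in lborel. (\<lambda>m. \<psi> y *\<^sub>R (lowpass (int m + N) w y - lowpass N w y)) \<longlonglongrightarrow> \<psi> y *\<^sub>R ?H y"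
        by (intro AE_I2 tendsto_intros lowpass_tendsto[OF wc wb])
      show "AE y in lborel. norm (\<psi> y *\<^sub>R (lowpass (int m + N) w y - lowpass N w y)) \<le> \<bar>\<psi> y\<bar> * (2 * C)" for m
      proof (rule AE_I2)
        fix y
        have "norm (lowpass (int m + N) w y - lowpass N w y) \<le> 2 * C"
          using norm_triangle_ineq4[of "lowpass (int m + N) w y" "lowpass N w y"] SC[of "int m + N" y] SC[of N y] by simp
        from mult_left_mono[OF this, of "\<bar>\<psi> y\<bar>"]
        show "norm (\<psi> y *\<^sub>R (lowpass (int m + N) w y - lowpass N w y)) \<le> \<bar>\<psi> y\<bar> * (2 * C)" by simp
      qed
    qed measurable
    ultimately show "(\<lambda>j. LBINT y. \<psi> y *\<^sub>R LP_block \<phi> (N + int j) w y) sums (LBINT y. \<psi> y *\<^sub>R ?H y)"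
      unfolding sums_def by simp
  qed
qed

end


section \<open>Uniformly local square integrability\<close>

text \<open>With values in \<open>ennreal\<close>, comparison and Tonelli need no integrability;
  \<open>L2_ball_eq\<close> gives the link to the integral in \<open>L2ul_norm\<close>.\<close>

definition ball_sq :: "real^2 \<Rightarrow> (real^2 \<Rightarrow> 'b::real_normed_vector) \<Rightarrow> ennreal" where
  "ball_sq c f = (\<integral>\<^sup>+y. ennreal ((norm (f y))\<^sup>2) * indicator (ball c 1) y \<partial>lborel)"

text \<open>The measurable function \<open>f\<close> has \<open>L\<^sup>2\<^sub>u\<^sub>l\<close> norm at most \<open>a\<close>.\<close>

definition ul_le :: "(real^2 \<Rightarrow> 'b::{banach,second_countable_topology}) \<Rightarrow> real \<Rightarrow> bool" where
  "ul_le f a \<longleftrightarrow> 0 \<le> a \<and> f \<in> borel_measurable borel \<and> (\<forall>c. ball_sq c f \<le> ennreal (a\<^sup>2))"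

lemma ball_sq_mono: "(\<And>y. y \<in> ball c 1 \<Longrightarrow> norm (f y) \<le> norm (g y)) \<Longrightarrow> ball_sq c f \<le> ball_sq c g"
  unfolding ball_sq_def by (intro nn_integral_mono) (auto split: split_indicator intro!: ennreal_leI power_mono)

lemma indicator_ball_measurable [measurable]: "(\<lambda>y. indicator (ball c r) y :: ennreal) \<in> borel_measurable (borel :: (real^2) measure)"
  by (intro borel_measurable_indicator) simp

lemma ball_sq_bounded:
  assumes "\<And>y. y \<in> ball c 1 \<Longrightarrow> norm (f y) \<le> B" "0 \<le> B"
  shows "ball_sq c f \<le> ennreal (pi * B\<^sup>2)"
proof -
  have "ball_sq c f \<le> (\<integral>\<^sup>+y. ennreal (B\<^sup>2) * indicator (ball c 1) y \<partial>lborel)"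
    unfolding ball_sq_def using assms by (intro nn_integral_mono) (auto split: split_indicator intro!: ennreal_leI power_mono)
  also have "\<dots> = ennreal (B\<^sup>2) * ennreal (pi * 1\<^sup>2)"
    by (simp add: nn_integral_cmult_indicator emeasure_ball_plane)
  also have "\<dots> = ennreal (pi * B\<^sup>2)" by (simp add: ennreal_mult'[symmetric] mult.commute)
  finally show ?thesis .
qed

lemma ball_sq_add:
  fixes f g :: "real^2 \<Rightarrow> 'b::{banach,second_countable_topology}"
  assumes [measurable]: "f \<in> borel_measurable borel" "g \<in> borel_measurable borel"
    and f: "ball_sq c f \<le> ennreal a" and g: "ball_sq c g \<le> ennreal b" and "0 \<le> a" "0 \<le> b"
  shows "ball_sq c (\<lambda>x. f x + g x) \<le> ennreal (2 * a + 2 * b)"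
proof -
  have sq: "(norm (v + w))\<^sup>2 \<le> 2 * (norm v)\<^sup>2 + 2 * (norm w)\<^sup>2" for v w :: 'b
  proof -
    have "(norm (v + w))\<^sup>2 \<le> (norm v + norm w)\<^sup>2" by (intro power_mono norm_triangle_ineq) simp
    also have "\<dots> \<le> 2 * (norm v)\<^sup>2 + 2 * (norm w)\<^sup>2"
      using sum_squares_bound[of "norm v" "norm w"] by (simp add: power2_sum)
    finally show ?thesis .
  qed
  have "ennreal ((norm (f y + g y))\<^sup>2) \<le> 2 * ennreal ((norm (f y))\<^sup>2) + 2 * ennreal ((norm (g y))\<^sup>2)" for y
  proof -
    have e: "2 * ennreal ((norm (f y))\<^sup>2) + 2 * ennreal ((norm (g y))\<^sup>2) = ennreal (2 * (norm (f y))\<^sup>2 + 2 * (norm (g y))\<^sup>2)"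
      by (simp add: ennreal_plus ennreal_mult)
    show ?thesis unfolding e by (rule ennreal_leI[OF sq])
  qed
  then have "ball_sq c (\<lambda>x. f x + g x) \<le> (\<integral>\<^sup>+y. 2 * (ennreal ((norm (f y))\<^sup>2) * indicator (ball c 1) y) + 2 * (ennreal ((norm (g y))\<^sup>2) * indicator (ball c 1) y) \<partial>lborel)"
    unfolding ball_sq_def by (intro nn_integral_mono) (auto split: split_indicator)
  also have "\<dots> = 2 * ball_sq c f + 2 * ball_sq c g"
    unfolding ball_sq_def by (subst nn_integral_add) (auto simp: nn_integral_cmult)
  also have "\<dots> \<le> 2 * ennreal a + 2 * ennreal b" by (intro add_mono mult_left_mono f g) auto
  also have "\<dots> = ennreal (2 * a + 2 * b)" using assms(5,6) by (simp add: ennreal_plus ennreal_mult)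
  finally show ?thesis .
qed

lemma ul_le_mono: "ul_le f a \<Longrightarrow> a \<le> b \<Longrightarrow> ul_le f b"
  unfolding ul_le_def by (auto intro: order_trans[OF _ ennreal_leI] power_mono)

text \<open>A crude triangle inequality: the squares obey 2 a^2 + 2 b^2, which is below the square
  of 2 (a + b). The factor 2 accounts for most numerical constants of the final estimate.\<close>

lemma ul_le_add: assumes "ul_le f a" "ul_le g b" shows "ul_le (\<lambda>x. f x + g x) (2 * (a + b))"
  unfolding ul_le_def
proof (intro conjI allI)
  have ab: "0 \<le> a" "0 \<le> b" using assms unfolding ul_le_def by auto
  then show "0 \<le> 2 * (a + b)" by simp
  show "(\<lambda>x. f x + g x) \<in> borel_measurable borel" using assms unfolding ul_le_def by auto
  fix c
  have "ball_sq c (\<lambda>x. f x + g x) \<le> ennreal (2 * a\<^sup>2 + 2 * b\<^sup>2)"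
    using assms unfolding ul_le_def by (intro ball_sq_add) auto
  also have "\<dots> \<le> ennreal ((2 * (a + b))\<^sup>2)"
    using mult_nonneg_nonneg[OF ab] by (intro ennreal_leI) (simp add: power2_eq_square algebra_simps)
  finally show "ball_sq c (\<lambda>x. f x + g x) \<le> ennreal ((2 * (a + b))\<^sup>2)" .
qed

text \<open>The unit ball has area pi, which is at most 2^2.\<close>

lemma ul_le_bounded:
  assumes "f \<in> borel_measurable borel" "\<And>x. norm (f x) \<le> B" shows "ul_le f (2 * B)"
proof -
  have B: "0 \<le> B" using order_trans[OF norm_ge_zero assms(2)] by blast
  have "pi * B\<^sup>2 \<le> (2 * B)\<^sup>2"
    using mult_right_mono[of pi 4 "B\<^sup>2"] pi_less_4 by (simp add: power_mult_distrib)
  then have "ball_sq c f \<le> ennreal ((2 * B)\<^sup>2)" for c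
    using order_trans[OF ball_sq_bounded[of c f B] ennreal_leI] assms B by blast
  then show ?thesis using assms(1) B unfolding ul_le_def by simp
qed

lemma ul_le_dominated:
  assumes "f \<in> borel_measurable borel" "\<And>x. norm (f x) \<le> q * norm (g x)" "ul_le g a" "0 \<le> q"
  shows "ul_le f (q * a)"
  unfolding ul_le_def
proof (intro conjI allI assms(1))
  have [measurable]: "g \<in> borel_measurable borel" using assms(3) unfolding ul_le_def by simp
  show "0 \<le> q * a" using assms unfolding ul_le_def by simp
  fix c
  have "ball_sq c f \<le> ball_sq c (\<lambda>x. q *\<^sub>R g x)" using assms by (intro ball_sq_mono) simp
  also have "\<dots> = (\<integral>\<^sup>+y. ennreal (q\<^sup>2) * (ennreal ((norm (g y))\<^sup>2) * indicator (ball c 1) y) \<partial>lborel)"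
    unfolding ball_sq_def by (intro nn_integral_cong) (simp add: power_mult_distrib ennreal_mult mult.assoc)
  also have "\<dots> = ennreal (q\<^sup>2) * ball_sq c g" unfolding ball_sq_def by (intro nn_integral_cmult) measurable
  also have "\<dots> \<le> ennreal (q\<^sup>2) * ennreal (a\<^sup>2)" using assms(3) unfolding ul_le_def by (intro mult_left_mono) auto
  also have "\<dots> = ennreal ((q * a)\<^sup>2)" by (simp add: ennreal_mult[symmetric] power_mult_distrib)
  finally show "ball_sq c f \<le> ennreal ((q * a)\<^sup>2)" .
qed

lemma ball_sq_translate:
  assumes [measurable]: "f \<in> borel_measurable borel"
  shows "ball_sq c (\<lambda>x. f (z + x)) = ball_sq (z + c) f"
proof -
  have "ball_sq (z + c) f = (\<integral>\<^sup>+y. ennreal ((norm (f y))\<^sup>2) * indicator (ball (z + c) 1) y \<partial>distr lborel borel ((+) z))"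
    unfolding ball_sq_def lborel_distr_plus ..
  also have "\<dots> = (\<integral>\<^sup>+y. ennreal ((norm (f (z + y)))\<^sup>2) * indicator (ball (z + c) 1) (z + y) \<partial>lborel)"
    by (subst nn_integral_distr) auto
  also have "\<dots> = ball_sq c (\<lambda>x. f (z + x))"
    unfolding ball_sq_def by (intro nn_integral_cong) (simp add: indicator_def dist_norm)
  finally show ?thesis ..
qed

lemma ul_le_translate: assumes "ul_le f a" shows "ul_le (\<lambda>x. f (z + x)) a"
proof -
  have [measurable]: "f \<in> borel_measurable borel" using assms unfolding ul_le_def by simp
  have "(\<lambda>x. f (z + x)) \<in> borel_measurable borel" by measurable
  then show ?thesis using assms unfolding ul_le_def by (simp add: ball_sq_translate)
qed

lemma ul_le_LIMSEQ: assumes "\<And>n. ul_le f (a n)" "a \<longlonglongrightarrow> b" shows "ul_le f b"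
  unfolding ul_le_def
proof (intro conjI allI)
  show "0 \<le> b" using assms(1) unfolding ul_le_def by (intro LIMSEQ_le_const[OF assms(2)]) auto
  show "f \<in> borel_measurable borel" using assms(1) unfolding ul_le_def by blast
  fix c
  have "(\<lambda>n. ennreal ((a n)\<^sup>2)) \<longlonglongrightarrow> ennreal (b\<^sup>2)" by (intro tendsto_intros assms(2))
  then show "ball_sq c f \<le> ennreal (b\<^sup>2)"
    by (rule LIMSEQ_le_const) (use assms(1) in \<open>auto simp: ul_le_def\<close>)
qed

lemma L2_ball_eq:
  fixes f :: "real^2 \<Rightarrow> 'b::{banach,second_countable_topology}"
  assumes [measurable]: "f \<in> borel_measurable borel"
  shows "(LBINT y:ball c 1. (norm (f y))\<^sup>2) = enn2real (ball_sq c f)"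
proof -
  have "(LBINT y:ball c 1. (norm (f y))\<^sup>2) = enn2real (\<integral>\<^sup>+y. ennreal (indicator (ball c 1) y *\<^sub>R (norm (f y))\<^sup>2) \<partial>lborel)"
    unfolding set_lebesgue_integral_def
  proof (rule integral_eq_nn_integral)
    show "(\<lambda>y. indicator (ball c 1) y *\<^sub>R (norm (f y))\<^sup>2) \<in> borel_measurable lborel"
      by (intro borel_measurable_scaleR borel_measurable_indicator) (simp, measurable)
  qed simp
  also have "(\<integral>\<^sup>+y. ennreal (indicator (ball c 1) y *\<^sub>R (norm (f y))\<^sup>2) \<partial>lborel) = ball_sq c f"
    unfolding ball_sq_def by (intro nn_integral_cong) (simp add: indicator_def)
  finally show ?thesis .
qed

lemma L2ul_norm_le: assumes "ul_le f a" shows "L2ul_norm f \<le> a"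
  unfolding L2ul_norm_def
proof (rule cSUP_least)
  fix c
  have a: "0 \<le> a" and m: "f \<in> borel_measurable borel" and "ball_sq c f \<le> ennreal (a\<^sup>2)" using assms unfolding ul_le_def by auto
  then have "enn2real (ball_sq c f) \<le> a\<^sup>2" by (simp add: enn2real_leI)
  then have "sqrt (enn2real (ball_sq c f)) \<le> sqrt (a\<^sup>2)" by (rule real_sqrt_le_mono)
  then show "sqrt (LBINT y:ball c 1. (norm (f y))\<^sup>2) \<le> a" using a by (simp add: L2_ball_eq[OF m])
qed simp

lemma ul_le_L2ul_norm:
  fixes f :: "real^2 \<Rightarrow> 'b::{banach,second_countable_topology}"
  assumes m: "f \<in> borel_measurable borel" and b: "\<And>x. norm (f x) \<le> B"
  shows "ul_le f (L2ul_norm f)"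
proof -
  have u: "ul_le f (2 * B)" by (rule ul_le_bounded[OF m b])
  have bdd: "bdd_above (range (\<lambda>c. sqrt (LBINT y:ball c 1. (norm (f y))\<^sup>2)))"
  proof (rule bdd_aboveI2)
    fix c
    have "0 \<le> 2 * B" "ball_sq c f \<le> ennreal ((2 * B)\<^sup>2)" using u unfolding ul_le_def by auto
    then have "enn2real (ball_sq c f) \<le> (2 * B)\<^sup>2" by (simp add: enn2real_leI)
    then have "sqrt (enn2real (ball_sq c f)) \<le> sqrt ((2 * B)\<^sup>2)" by (rule real_sqrt_le_mono)
    also have "\<dots> = 2 * B" using \<open>0 \<le> 2 * B\<close> by (rule real_sqrt_unique[OF refl])
    finally show "sqrt (LBINT y:ball c 1. (norm (f y))\<^sup>2) \<le> 2 * B" unfolding L2_ball_eq[OF m] .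
  qed
  have le: "sqrt (enn2real (ball_sq c f)) \<le> L2ul_norm f" for c
    unfolding L2ul_norm_def L2_ball_eq[OF m, symmetric] by (rule cSUP_upper[OF UNIV_I bdd])
  have nn: "0 \<le> L2ul_norm f" by (rule order_trans[OF _ le[of 0]]) simp
  have "ball_sq c f \<le> ennreal ((L2ul_norm f)\<^sup>2)" for c
  proof -
    have "ball_sq c f < top" using u unfolding ul_le_def by (metis ennreal_less_top le_less_trans)
    then have "ball_sq c f = ennreal (enn2real (ball_sq c f))" by simp
    also have "\<dots> \<le> ennreal ((L2ul_norm f)\<^sup>2)"
      using power_mono[OF le[of c], of 2] by (intro ennreal_leI) simp
    finally show ?thesis .
  qed
  then show ?thesis using m nn unfolding ul_le_def by blast
qed

text \<open>Minkowski's inequality for integrals, obtained from Cauchy--Schwarz with respect to the weight \<open>p\<close>.\<close>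

lemma ball_sq_integral:
  fixes F :: "'a::euclidean_space \<Rightarrow> real^2 \<Rightarrow> 'b::{banach,second_countable_topology}"
  assumes p: "integrable lborel p" "\<And>a. 0 \<le> p a"
    and H: "(\<lambda>(a, x). H a x) \<in> borel_measurable (lborel \<Otimes>\<^sub>M lborel)" "\<And>a x. 0 \<le> H a x"
    and F: "\<And>x. x \<in> ball c 1 \<Longrightarrow> integrable lborel (\<lambda>a. F a x)" "\<And>a x. x \<in> ball c 1 \<Longrightarrow> norm (F a x) \<le> p a * H a x"
    and D: "\<And>a. ball_sq c (\<lambda>x. H a x :: real) \<le> ennreal (D\<^sup>2)"
  shows "ball_sq c (\<lambda>x. LBINT a. F a x) \<le> ennreal (((LBINT a. p a) * D)\<^sup>2)"
proof -
  define P where "P = (LBINT a. p a)"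
  have P: "(\<integral>\<^sup>+a. ennreal (p a) \<partial>lborel) = ennreal P" unfolding P_def using p by (intro nn_integral_eq_integral) auto
  have P0: "0 \<le> P" unfolding P_def using p by (intro Bochner_Integration.integral_nonneg) auto
  have [measurable]: "p \<in> borel_measurable borel" using p by auto
  have [measurable]: "(\<lambda>(a, x). H a x) \<in> borel_measurable (borel \<Otimes>\<^sub>M borel)"
    using H(1) by (simp cong: measurable_cong_sets)
  have Hm[measurable]: "(\<lambda>a. H a x) \<in> borel_measurable borel" for x
  proof -
    have "(\<lambda>a. (\<lambda>(a, x). H a x) (a, x)) \<in> borel_measurable borel" by measurable
    then show ?thesis by simp
  qed
  have "ball_sq c (\<lambda>x. LBINT a. F a x) \<le> (\<integral>\<^sup>+x. (ennreal P * (\<integral>\<^sup>+a. ennreal (p a) * ennreal ((H a x)\<^sup>2) \<partial>lborel)) * indicator (ball c 1) x \<partial>lborel)"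
    unfolding ball_sq_def
  proof (intro nn_integral_mono)
    fix x
    show "ennreal ((norm (LBINT a. F a x))\<^sup>2) * indicator (ball c 1) x \<le> (ennreal P * (\<integral>\<^sup>+a. ennreal (p a) * ennreal ((H a x)\<^sup>2) \<partial>lborel)) * indicator (ball c 1) x"
    proof (cases "x \<in> ball c 1")
      case True
      have "ennreal (norm (LBINT a. F a x)) \<le> (\<integral>\<^sup>+a. ennreal (norm (F a x)) \<partial>lborel)"
        using F(1)[OF True] by (rule integral_norm_bound_ennreal)
      also have "\<dots> \<le> (\<integral>\<^sup>+a. ennreal (sqrt (p a)) * ennreal (sqrt (p a) * H a x) \<partial>lborel)"
        using F(2)[OF True] p(2) H(2) by (intro nn_integral_mono) (auto simp: ennreal_mult'[symmetric] mult.assoc[symmetric] intro!: ennreal_leI)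
      finally have "(ennreal (norm (LBINT a. F a x)))\<^sup>2 \<le> (\<integral>\<^sup>+a. ennreal (sqrt (p a)) * ennreal (sqrt (p a) * H a x) \<partial>lborel)\<^sup>2"
        by (rule power_mono) simp
      also have "\<dots> \<le> (\<integral>\<^sup>+a. (ennreal (sqrt (p a)))\<^sup>2 \<partial>lborel) * (\<integral>\<^sup>+a. (ennreal (sqrt (p a) * H a x))\<^sup>2 \<partial>lborel)"
        by (rule Cauchy_Schwarz_nn_integral) measurable
      also have "(\<integral>\<^sup>+a. (ennreal (sqrt (p a)))\<^sup>2 \<partial>lborel) = ennreal P"
        using p(2) by (simp add: P[symmetric] ennreal_power)
      also have "(\<integral>\<^sup>+a. (ennreal (sqrt (p a) * H a x))\<^sup>2 \<partial>lborel) = (\<integral>\<^sup>+a. ennreal (p a) * ennreal ((H a x)\<^sup>2) \<partial>lborel)"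
        using p(2) H(2) by (intro nn_integral_cong) (simp add: ennreal_power power_mult_distrib ennreal_mult')
      finally show ?thesis using True by (simp add: ennreal_power)
    qed simp
  qed
  also have "\<dots> = ennreal P * (\<integral>\<^sup>+x. (\<integral>\<^sup>+a. ennreal (p a) * ennreal ((H a x)\<^sup>2) * indicator (ball c 1) x \<partial>lborel) \<partial>lborel)"
  proof -
    have "(\<integral>\<^sup>+a. ennreal (p a) * ennreal ((H a x)\<^sup>2) * indicator (ball c 1) x \<partial>lborel)
       = (\<integral>\<^sup>+a. ennreal (p a) * ennreal ((H a x)\<^sup>2) \<partial>lborel) * indicator (ball c 1) x" for x
      by (rule nn_integral_multc) measurable
    then have e: "(ennreal P * (\<integral>\<^sup>+a. ennreal (p a) * ennreal ((H a x)\<^sup>2) \<partial>lborel)) * indicator (ball c 1) x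
       = ennreal P * (\<integral>\<^sup>+a. ennreal (p a) * ennreal ((H a x)\<^sup>2) * indicator (ball c 1) x \<partial>lborel)" for x
      by (simp only: mult.assoc)
    show ?thesis unfolding e by (rule nn_integral_cmult) measurable
  qed
  also have "(\<integral>\<^sup>+x. (\<integral>\<^sup>+a. ennreal (p a) * ennreal ((H a x)\<^sup>2) * indicator (ball c 1) x \<partial>lborel) \<partial>lborel)
     = (\<integral>\<^sup>+a. (\<integral>\<^sup>+x. ennreal (p a) * ennreal ((H a x)\<^sup>2) * indicator (ball c 1) x \<partial>lborel) \<partial>lborel)"
    by (rule lborel_pair.Fubini') measurable
  also have "\<dots> = (\<integral>\<^sup>+a. ennreal (p a) * ball_sq c (H a) \<partial>lborel)"
  proof (intro nn_integral_cong)
    fix a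
    have [measurable]: "H a \<in> borel_measurable borel"
    proof -
      have "(\<lambda>x. (\<lambda>(a, x). H a x) (a, x)) \<in> borel_measurable borel" by measurable
      then show ?thesis by simp
    qed
    show "(\<integral>\<^sup>+x. ennreal (p a) * ennreal ((H a x)\<^sup>2) * indicator (ball c 1) x \<partial>lborel) = ennreal (p a) * ball_sq c (H a)"
      unfolding ball_sq_def by (subst nn_integral_cmult[symmetric]) (auto simp: mult.assoc)
  qed
  also have "\<dots> \<le> (\<integral>\<^sup>+a. ennreal (p a) * ennreal (D\<^sup>2) \<partial>lborel)" by (intro nn_integral_mono mult_left_mono D) auto
  also have "\<dots> = ennreal P * ennreal (D\<^sup>2)" by (simp add: nn_integral_multc P)
  finally have "ball_sq c (\<lambda>x. LBINT a. F a x) \<le> ennreal P * (ennreal P * ennreal (D\<^sup>2))"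
    by (simp add: mult_left_mono)
  also have "\<dots> = ennreal ((P * D)\<^sup>2)" using P0 by (simp add: ennreal_mult'[symmetric] power2_eq_square mult_ac)
  finally show ?thesis unfolding P_def .
qed

text \<open>Young's inequality for the uniformly local norm, which translations preserve. The
  integrand is kept abstract so as to cover both a vector kernel acting on a scalar and a scalar
  kernel acting on a vector field.\<close>

lemma ul_le_convolution:
  fixes F :: "real^2 \<Rightarrow> real^2 \<Rightarrow> 'b::{banach,second_countable_topology}"
  assumes p: "integrable lborel p" "\<And>y. 0 \<le> p y"
    and q: "ul_le q D"
    and F: "\<And>x. integrable lborel (\<lambda>y. F y x)" "\<And>y x. norm (F y x) \<le> p y * norm (q (x - y))"
    and m: "(\<lambda>x. LBINT y. F y x) \<in> borel_measurable borel"
  shows "ul_le (\<lambda>x. LBINT y. F y x) ((LBINT y. p y) * D)"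
  unfolding ul_le_def
proof (intro conjI allI m)
  have [measurable]: "q \<in> borel_measurable borel" and D: "0 \<le> D" "\<And>c. ball_sq c q \<le> ennreal (D\<^sup>2)" using q unfolding ul_le_def by auto
  show "0 \<le> (LBINT y. p y) * D" using p D by (intro mult_nonneg_nonneg Bochner_Integration.integral_nonneg) auto
  fix c
  show "ball_sq c (\<lambda>x. LBINT y. F y x) \<le> ennreal (((LBINT y. p y) * D)\<^sup>2)"
  proof (rule ball_sq_integral[where H="\<lambda>y x. norm (q (x - y))"])
    show "(\<lambda>(y, x). norm (q (x - y))) \<in> borel_measurable (lborel \<Otimes>\<^sub>M lborel)" by measurable
    show "ball_sq c (\<lambda>x. norm (q (x - y))) \<le> ennreal (D\<^sup>2)" for y
    proof -
      have "ball_sq c (\<lambda>x. norm (q (x - y))) = ball_sq c (\<lambda>x. q (- y + x))" by (simp add: ball_sq_def)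
      also have "\<dots> = ball_sq (- y + c) q" by (rule ball_sq_translate) measurable
      finally show ?thesis using D(2)[of "- y + c"] by simp
    qed
  qed (use p F in auto)
qed

section \<open>The essential supremum of a continuous function\<close>

text \<open>If a continuous function exceeded its essential supremum at a point, it would do so on a
  ball, which has positive measure. The bound \<open>B\<close> keeps the essential supremum finite,
  so that \<open>real_of_ereal\<close> does not fall back to its default value.\<close>

lemma Linf_norm_continuous:
  fixes f :: "real^2 \<Rightarrow> 'b::real_normed_vector"
  assumes c: "continuous_on UNIV f" and b: "\<And>x. norm (f x) \<le> B"
  shows "norm (f x) \<le> Linf_norm f" "0 \<le> Linf_norm f"
proof -
  define e where "e = esssup lborel (\<lambda>x. ereal (norm (f x)))"
  have [measurable]: "(\<lambda>x. norm (f x)) \<in> borel_measurable borel"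
    by (intro borel_measurable_continuous_onI continuous_intros c)
  have m: "(\<lambda>x. ereal (norm (f x))) \<in> borel_measurable lborel" by measurable
  have AE: "AE x in lborel. ereal (norm (f x)) \<le> e" unfolding e_def by (rule esssup_AE)
  have le: "ereal (norm (f x)) \<le> e" for x
  proof (rule ccontr)
    assume "\<not> ereal (norm (f x)) \<le> e"
    then have lt: "e < ereal (norm (f x))" by simp
    then obtain r where r: "e \<le> ereal r" "r < norm (f x)"
      by (metis ereal_dense2 ereal_less(2) less_ereal.simps(1) less_imp_le)
    have "open {y. r < norm (f y)}" by (intro open_Collect_less continuous_intros c)
    then obtain d where d: "d > 0" "ball x d \<subseteq> {y. r < norm (f y)}" using r(2) by (auto simp: open_contains_ball)
    have "AE y in lborel. y \<notin> ball x d"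
      using AE
    proof eventually_elim
      fix y assume "ereal (norm (f y)) \<le> e"
      then have "ereal (norm (f y)) \<le> ereal r" using r(1) by (rule order_trans)
      then show "y \<notin> ball x d" using d(2) by auto
    qed
    then have "emeasure lborel (ball x d) = 0" by (subst (asm) AE_iff_measurable[of "ball x d"]) auto
    then have "ennreal (pi * d\<^sup>2) = 0" using emeasure_ball_plane[of d x] d(1) by simp
    moreover have "0 < pi * d\<^sup>2" using d(1) by simp
    ultimately show False by (simp add: ennreal_eq_0_iff)
  qed
  have "e \<le> ereal B" unfolding e_def using b by (intro esssup_I[OF m]) auto
  moreover have "0 \<le> e" using le[of 0] by (rule order_trans[rotated]) simp
  ultimately have e: "ereal (real_of_ereal e) = e" by (intro ereal_real') (auto simp: abs_ereal_ge0)
  then have "ereal (norm (f x)) \<le> ereal (Linf_norm f)" for x using le[of x] by (simp add: Linf_norm_def e_def)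
  then show "norm (f x) \<le> Linf_norm f" by simp
  then show "0 \<le> Linf_norm f" using norm_ge_zero order_trans by blast
qed


section \<open>The high-frequency part of the velocity\<close>

text \<open>The terms are at most \<open>c\<close> times the smaller of a / 2^j and 2^j / a. Below
  the first index k with 2^k at least \<open>a\<close> the second bound gives a growing geometric
  series, from k on the first bound gives a decaying one; each contributes at most
  \<open>2 * c\<close>.\<close>

lemma sum_frequency_bound:
  fixes h :: "nat \<Rightarrow> real"
  assumes "0 \<le> a" "0 \<le> c" "\<And>j. h j \<le> c * (a / 2 ^ j)" "\<And>j. a * h j \<le> c * 2 ^ j"
  shows "(\<Sum>j<M. h j) \<le> 4 * c"
proof (cases "a = 0")
  case True
  then have "h j \<le> 0" for j using assms(3)[of j] by simp
  then have "(\<Sum>j<M. h j) \<le> 0" by (intro sum_nonpos) auto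
  then show ?thesis using assms(2) by linarith
next
  case False
  then have a: "a > 0" using assms(1) by simp
  define k where "k = (LEAST k::nat. a \<le> 2 ^ k)"
  have ex: "\<exists>k::nat. a \<le> 2 ^ k" using real_arch_pow[of 2 a] by (auto intro: less_imp_le)
  have k: "a \<le> 2 ^ k" unfolding k_def by (rule LeastI_ex[OF ex])
  have low: "(\<Sum>j<m. h j) \<le> c * (2 ^ m / a)" for m
  proof (induction m)
    case 0 then show ?case using assms(2) a by simp
  next
    case (Suc m)
    have "h m \<le> c * (2 ^ m / a)" using assms(4)[of m] a by (simp add: pos_le_divide_eq mult.commute)
    moreover have "c * (2 ^ Suc m / a) = c * (2 ^ m / a) + c * (2 ^ m / a)" using a by (simp add: field_simps)
    ultimately show ?case using Suc unfolding sum.lessThan_Suc by linarith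
  qed
  have low': "(\<Sum>j<m. h j) \<le> 2 * c" if "m \<le> k" for m
  proof (cases m)
    case 0 then show ?thesis using assms(2) by simp
  next
    case (Suc n)
    then have "\<not> a \<le> 2 ^ n" using not_less_Least[of n "\<lambda>k. a \<le> 2 ^ k"] that k_def by simp
    then have "2 ^ m / a \<le> 2" using a Suc by (simp add: divide_le_eq)
    then have "c * (2 ^ m / a) \<le> c * 2" using assms(2) by (rule mult_left_mono)
    then show ?thesis using low[of m] by simp
  qed
  have high: "(\<Sum>j=k..<k + n. h j) \<le> 2 * c - 2 * c * a / 2 ^ (k + n)" for n
  proof (induction n)
    case 0
    have "c * a \<le> c * 2 ^ k" using k assms(2) by (rule mult_left_mono)
    then show ?case by (simp add: divide_le_eq)
  next
    case (Suc n)
    have "2 * c * a / 2 ^ (k + n) - c * (a / 2 ^ (k + n)) = 2 * c * a / 2 ^ (k + Suc n)" by simp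
    then show ?case using Suc assms(3)[of "k + n"] by simp
  qed
  show ?thesis
  proof (cases "M \<le> k")
    case True then show ?thesis using low'[of M] assms(2) by linarith
  next
    case False
    then obtain n where n: "M = k + n" using le_Suc_ex[of k M] by auto
    have M: "{..<M} = {..<k} \<union> {k..<k + n}" using n by auto
    have "(\<Sum>j<M. h j) = (\<Sum>j<k. h j) + (\<Sum>j=k..<k + n. h j)"
      unfolding M by (rule sum.union_disjoint) auto
    moreover have "0 \<le> 2 * c * a / 2 ^ (k + n)" using assms(1,2) by simp
    ultimately show ?thesis using low'[of k] high[of n] by simp
  qed
qed

context LP
begin

lemma fourier_sum_kernel:
  fixes f :: "nat \<Rightarrow> real^2 \<Rightarrow> real"
  assumes "\<And>j. kernel (f j)"
  shows "fourier (\<lambda>x. \<Sum>j<M. f j x) \<xi> = (\<Sum>j<M. fourier (f j) \<xi>)"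
proof (induction M)
  case 0 show ?case by (simp add: fourier_def)
next
  case (Suc M)
  then show ?case using fourier_add_kernel[OF kernel_sum[of "{..<M}" f] assms[of M]] assms by simp
qed

lemma kernel_mollK_\<phi>0: "kernel (mollK \<phi>)"
  by (rule kernel_mollK[OF schwartz_\<phi> integral_\<phi>])

lemma kernel_nth: "kernel F \<Longrightarrow> kernel (\<lambda>x. F x $ i)"
  by (rule kernel_bounded_linear[OF bounded_linear_vec_nth])

lemma mollK_nth: "mollK \<psi> x $ 1 = - Riesz (pd 2 \<psi>) x" "mollK \<psi> x $ 2 = Riesz (pd 1 \<psi>) x"
  by (simp_all add: mollK_def axis_def)

text \<open>Both ends of the frequency range follow from integrability. The components of
  \<open>mollK \<phi>\<close> are, up to sign, derivatives of the kernel
  \<open>Riesz \<phi>\<close>, which gives the factor |\<xi>| at low frequencies; their own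
  derivatives are integrable, which gives decay 1/|\<xi>| at high frequencies.\<close>

lemma mollK_\<phi>_fourier_bound:
  obtains c where "0 \<le> c" "\<And>i \<xi>. norm (fourier (\<lambda>x. mollK \<phi> x $ i) \<xi>) \<le> c * norm \<xi>"
    "\<And>i \<xi>. norm \<xi> * norm (fourier (\<lambda>x. mollK \<phi> x $ i) \<xi>) \<le> c"
proof -
  let ?p = "LBINT x. \<bar>Riesz \<phi> x\<bar>"
  define d where "d i n = (LBINT x. \<bar>mollK (pd n \<phi>) x $ i\<bar>)" for i n
  have kp: "kernel (Riesz \<phi>)" by (intro kernel_Riesz schwartz_rapid schwartz_\<phi> integral_\<phi> moment_\<phi>)
  have kpd: "kernel (Riesz (pd n \<phi>))" for n
    using schwartz_\<phi> by (intro kernel_Riesz schwartz_rapid schwartz_pd) (auto simp: integral_schwartz_pd integral_\<phi>)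
  have hp: "has_pd n (Riesz \<phi>) (Riesz (pd n \<phi>))" for n
    using schwartz_\<phi> by (intro has_pd_Riesz schwartz_has_pd schwartz_kernel schwartz_pd)
  have b: "norm (fourier (Riesz (pd n \<phi>)) \<xi>) \<le> ?p * norm \<xi>" for n \<xi>
  proof -
    have "norm (fourier (Riesz (pd n \<phi>)) \<xi>) = \<bar>\<xi> $ n\<bar> * norm (fourier (Riesz \<phi>) \<xi>)"
      unfolding fourier_pd[OF hp kp kpd] by (simp add: norm_mult)
    also have "\<dots> \<le> norm \<xi> * ?p"
      by (intro mult_mono component_le_norm_cart norm_fourier_le kernel_integrable kp) auto
    finally show ?thesis by (simp add: mult.commute)
  qed
  have fm: "fourier (\<lambda>x. - f x) \<xi> = - fourier f \<xi>" for f :: "real^2 \<Rightarrow> real" and \<xi>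
    by (simp add: fourier_def)
  have 1: "norm (fourier (\<lambda>x. mollK \<phi> x $ i) \<xi>) \<le> ?p * norm \<xi>" for i \<xi>
    using exhaust_2[of i] b by (auto simp: mollK_nth fm)
  have 2: "norm \<xi> * norm (fourier (\<lambda>x. mollK \<phi> x $ i) \<xi>) \<le> d i 1 + d i 2" for i \<xi>
  proof -
    let ?g = "fourier (\<lambda>x. mollK \<phi> x $ i) \<xi>"
    have n: "\<bar>\<xi> $ n\<bar> * norm ?g \<le> d i n" for n
    proof -
      have h: "has_pd n (\<lambda>x. mollK \<phi> x $ i) (\<lambda>x. mollK (pd n \<phi>) x $ i)"
        by (rule has_pd_linear[OF bounded_linear_vec_nth has_pd_mollK[OF schwartz_\<phi>]])
      have k: "kernel (\<lambda>x. mollK (pd n \<phi>) x $ i)" by (intro kernel_nth kernel_mollK_pd schwartz_\<phi>)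
      have "\<bar>\<xi> $ n\<bar> * norm ?g = norm (fourier (\<lambda>x. mollK (pd n \<phi>) x $ i) \<xi>)"
        unfolding fourier_pd[OF h kernel_nth[OF kernel_mollK_\<phi>0] k] by (simp add: norm_mult)
      also have "\<dots> \<le> d i n" unfolding d_def by (rule norm_fourier_le[OF kernel_integrable[OF k]])
      finally show ?thesis .
    qed
    have "norm \<xi> \<le> \<bar>\<xi> $ 1\<bar> + \<bar>\<xi> $ 2\<bar>" using norm_le_l1_cart[of \<xi>] by (simp add: sum_2)
    then have "norm \<xi> * norm ?g \<le> (\<bar>\<xi> $ 1\<bar> + \<bar>\<xi> $ 2\<bar>) * norm ?g" by (intro mult_right_mono) auto
    then show ?thesis using n[of 1] n[of 2] by (simp add: distrib_right)
  qed
  define c where "c = ?p + (\<Sum>i\<in>UNIV. d i 1 + d i 2)"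
  have d0: "0 \<le> d i n" for i n unfolding d_def by (intro Bochner_Integration.integral_nonneg) auto
  have p0: "0 \<le> ?p" by (intro Bochner_Integration.integral_nonneg) auto
  have dc: "d i 1 + d i 2 \<le> c" for i
    using exhaust_2[of i] d0[of 1 1] d0[of 1 2] d0[of 2 1] d0[of 2 2] p0 unfolding c_def sum_2 by auto
  have pc: "?p \<le> c" using d0[of 1 1] d0[of 1 2] d0[of 2 1] d0[of 2 2] unfolding c_def sum_2 by linarith
  show ?thesis
  proof (rule that)
    show "0 \<le> c" using p0 pc by linarith
    show "norm (fourier (\<lambda>x. mollK \<phi> x $ i) \<xi>) \<le> c * norm \<xi>" for i \<xi>
      using order_trans[OF 1[of i \<xi>] mult_right_mono[OF pc]] by simp
    show "norm \<xi> * norm (fourier (\<lambda>x. mollK \<phi> x $ i) \<xi>) \<le> c" for i \<xi>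
      using order_trans[OF 2 dc] .
  qed
qed

text \<open>A truncation of \<open>H\<^sub>0 K\<close>.\<close>

definition highK :: "nat \<Rightarrow> real^2 \<Rightarrow> real^2" where
  "highK M x = (\<Sum>j<M. mollK (dilate \<phi> (int j)) x)"

lemma kernel_highK: "kernel (highK M)"
  unfolding highK_def[abs_def] by (intro kernel_sum kernel_mollK_dilate_\<phi>)

text \<open>Adding L1 norms of the blocks would give growth linear in \<open>M\<close>. The
  transform of the j-th block is that of \<open>mollK \<phi>\<close> at frequency \<xi> / 2^j, and
  the smallness of the latter at both ends makes the sum bounded uniformly in
  \<open>M\<close>.\<close>

lemma highK_fourier_bound: obtains A where "0 \<le> A" "\<And>M i \<xi>. norm (fourier (\<lambda>x. highK M x $ i) \<xi>) \<le> A"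
proof -
  obtain c where c: "0 \<le> c" "\<And>i \<xi>. norm (fourier (\<lambda>x. mollK \<phi> x $ i) \<xi>) \<le> c * norm \<xi>"
    "\<And>i \<xi>. norm \<xi> * norm (fourier (\<lambda>x. mollK \<phi> x $ i) \<xi>) \<le> c" using mollK_\<phi>_fourier_bound by blast
  have "norm (fourier (\<lambda>x. highK M x $ i) \<xi>) \<le> 4 * c" for M i \<xi>
  proof -
    let ?F = "fourier (\<lambda>x. mollK \<phi> x $ i)"
    have e: "fourier (\<lambda>x. mollK (dilate \<phi> (int j)) x $ i) \<xi> = ?F ((1 / 2 ^ j) *\<^sub>R \<xi>)" for j
    proof -
      have "(\<lambda>x. mollK (dilate \<phi> (int j)) x $ i) = dilate (\<lambda>x. mollK \<phi> x $ i) (int j)"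
        by (rule ext) (simp add: mollK_dilate[OF schwartz_\<phi>] dilate_eq)
      then show ?thesis by (simp add: fourier_dilate power_int_minus inverse_eq_divide)
    qed
    have "fourier (\<lambda>x. highK M x $ i) \<xi> = (\<Sum>j<M. ?F ((1 / 2 ^ j) *\<^sub>R \<xi>))"
      unfolding highK_def sum_component e[symmetric] by (intro fourier_sum_kernel kernel_nth kernel_mollK_dilate_\<phi>)
    then have "norm (fourier (\<lambda>x. highK M x $ i) \<xi>) \<le> (\<Sum>j<M. norm (?F ((1 / 2 ^ j) *\<^sub>R \<xi>)))"
      by (simp add: sum_norm_le)
    also have "\<dots> \<le> 4 * c"
    proof (rule sum_frequency_bound[of "norm \<xi>"])
      show "norm (?F ((1 / 2 ^ j) *\<^sub>R \<xi>)) \<le> c * (norm \<xi> / 2 ^ j)" for j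
        using c(2)[of i "(1 / 2 ^ j) *\<^sub>R \<xi>"] by simp
      show "norm \<xi> * norm (?F ((1 / 2 ^ j) *\<^sub>R \<xi>)) \<le> c * 2 ^ j" for j
        using c(3)[of "(1 / 2 ^ j) *\<^sub>R \<xi>" i] by (simp add: divide_le_eq)
    qed (use c in auto)
    finally show ?thesis .
  qed
  then show ?thesis using that[of "4 * c"] c(1) by simp
qed

text \<open>Away from the origin cubic decay beats the dilation factor: the j-th block is of order
  4^j (2^j |x|)^(-3) = 2^(-j) |x|^(-3). The constant 16 is the geometric sum 2 times 2^3, because 1
  + |x| is at most 2 |x| there.\<close>

lemma highK_decay: obtains C where "0 \<le> C" "\<And>M x. 1 \<le> norm x \<Longrightarrow> norm (highK M x) \<le> C / (1 + norm x) ^ 3"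
proof -
  obtain C where C: "C > 0" "\<And>x. norm (mollK \<phi> x) \<le> C / (1 + norm x) ^ 3" using kernelE[OF kernel_mollK_\<phi>0] by blast
  have "norm (highK M x) \<le> (16 * C) / (1 + norm x) ^ 3" if x: "1 \<le> norm x" for M x
  proof -
    have t: "norm (mollK (dilate \<phi> (int j)) x) \<le> (C / norm x ^ 3) * (1 / 2) ^ j" for j
    proof -
      have "norm (mollK (dilate \<phi> (int j)) x) = 4 ^ j * norm (mollK \<phi> (2 ^ j *\<^sub>R x))"
        by (simp add: mollK_dilate[OF schwartz_\<phi>] power2_eq_square power_mult_distrib[symmetric])
      also have "\<dots> \<le> 4 ^ j * (C / (2 ^ j * norm x) ^ 3)"
      proof (intro mult_left_mono)
        have "C / (1 + norm (2 ^ j *\<^sub>R x)) ^ 3 \<le> C / (2 ^ j * norm x) ^ 3"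
          using C(1) x by (intro divide_left_mono power_mono mult_pos_pos zero_less_power) (auto simp: add_pos_nonneg)
        then show "norm (mollK \<phi> (2 ^ j *\<^sub>R x)) \<le> C / (2 ^ j * norm x) ^ 3" using C(2) order_trans by blast
      qed simp
      also have "\<dots> = (C / norm x ^ 3) * (1 / 2) ^ j"
      proof -
        have "(2::real) ^ j * (2 ^ j * 2 ^ j) = 2 ^ j * 4 ^ j" by (simp add: power_mult_distrib[symmetric])
        then show ?thesis using x by (simp add: power_mult_distrib power_divide power3_eq_cube field_simps)
      qed
      finally show ?thesis .
    qed
    have "norm (highK M x) \<le> (\<Sum>j<M. (C / norm x ^ 3) * (1 / 2) ^ j)"
      unfolding highK_def by (intro sum_norm_le t)
    also have "\<dots> = (C / norm x ^ 3) * (\<Sum>j<M. (1 / 2) ^ j)" by (simp only: sum_distrib_left)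
    also have "\<dots> \<le> (C / norm x ^ 3) * 2"
    proof (rule mult_left_mono)
      have "(\<Sum>j<M. (1 / 2 :: real) ^ j) = 2 - 2 * (1 / 2) ^ M" by (induction M) (simp_all add: field_simps)
      then show "(\<Sum>j<M. (1 / 2 :: real) ^ j) \<le> 2" by simp
    qed (use C(1) in simp)
    also have "\<dots> \<le> (16 * C) / (1 + norm x) ^ 3"
    proof -
      have "(1 + norm x) ^ 3 \<le> (2 * norm x) ^ 3" using x by (intro power_mono) auto
      moreover have "0 < norm x" using x by linarith
      ultimately have "(16 * C) / (2 * norm x) ^ 3 \<le> (16 * C) / (1 + norm x) ^ 3"
        using C(1) by (intro divide_left_mono mult_pos_pos zero_less_power) (auto simp: add_pos_nonneg)
      then show ?thesis by (simp add: power_mult_distrib mult.commute[of C 2])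
    qed
    finally show ?thesis .
  qed
  then show ?thesis using that[of "16 * C"] C(1) by simp
qed

text \<open>The part of \<open>f\<close> near the ball is treated by Plancherel's theorem, the distant part by the decay of the kernel.\<close>

lemma ul_le_highK:
  obtains C where "0 \<le> C"
    "\<And>M f B. f \<in> borel_measurable borel \<Longrightarrow> (\<And>x. \<bar>f x\<bar> \<le> B) \<Longrightarrow> ul_le (kconv (highK M) f) (C * B)"
proof -
  obtain A where A: "0 \<le> A" "\<And>M i \<xi>. norm (fourier (\<lambda>x. highK M x $ i) \<xi>) \<le> A" using highK_fourier_bound by blast
  obtain C where C: "0 \<le> C" "\<And>M x. 1 \<le> norm x \<Longrightarrow> norm (highK M x) \<le> C / (1 + norm x) ^ 3" using highK_decay by blast
  define F where "F = (LBINT y. C / (1 + norm (y::real^2)) ^ 3)"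
  have F0: "0 \<le> F" unfolding F_def using C(1) by (intro Bochner_Integration.integral_nonneg) (auto intro!: divide_nonneg_nonneg)
  \<comment> \<open>The first part collects the two components of the near field, with 9 pi the area
    of the ball of radius 3; the second is the far field. The factors 2 stem from
    \<open>ball_sq_add\<close>.\<close>
  define Q where "Q = 2 * (2 * (A\<^sup>2 * (9 * pi)) + 2 * (A\<^sup>2 * (9 * pi))) + 2 * (pi * F\<^sup>2)"
  have Q0: "0 \<le> Q" unfolding Q_def by simp
  have "ul_le (kconv (highK M) f) (sqrt Q * B)" if fm: "f \<in> borel_measurable borel" and fb: "\<And>x. \<bar>f x\<bar> \<le> B" for M f B
    unfolding ul_le_def
  proof (intro conjI allI)
    have [measurable]: "f \<in> borel_measurable borel" by (rule fm)
    have B: "0 \<le> B" using order_trans[OF abs_ge_zero fb] by blast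
    then show "0 \<le> sqrt Q * B" using Q0 by simp
    have ki: "integrable lborel (highK M)" by (rule kernel_integrable[OF kernel_highK])
    have [measurable]: "highK M \<in> borel_measurable borel" using ki by auto
    show "kconv (highK M) f \<in> borel_measurable borel" unfolding kconv_def[abs_def] by measurable
    fix c
    \<comment> \<open>If \<open>x\<close> lies in the unit ball about \<open>c\<close> and |y| < 1,
      then \<open>x - y\<close> is within distance 2 of \<open>c\<close>. So \<open>f2\<close> meets
      the kernel only where |y| is at least 1, in the range of \<open>highK_decay\<close>.\<close>
    define f1 where "f1 y = f y * indicator (ball c 3) y" for y
    define f2 where "f2 y = f y * (1 - indicator (ball c 3) y)" for y
    have [measurable]: "ball c 3 \<in> sets borel" by simp
    have f1m[measurable]: "f1 \<in> borel_measurable borel" unfolding f1_def[abs_def]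
      by (intro borel_measurable_times borel_measurable_indicator fm) simp
    have f2m[measurable]: "f2 \<in> borel_measurable borel" unfolding f2_def[abs_def]
      by (intro borel_measurable_times borel_measurable_diff borel_measurable_const borel_measurable_indicator fm) simp
    have f1b: "\<bar>f1 y\<bar> \<le> B" and f2b: "\<bar>f2 y\<bar> \<le> B" for y
      using fb[of y] B by (auto simp: f1_def f2_def indicator_def)
    have f12: "f = (\<lambda>y. f1 y + f2 y)" by (auto simp: f1_def f2_def algebra_simps)
    have split: "kconv (highK M) f x = kconv (highK M) f1 x + kconv (highK M) f2 x" for x
      using kconv_add[OF ki f1m f1b f2m f2b, of x] unfolding f12[symmetric] .
    have f1i: "integrable lborel f1"
    proof (rule Bochner_Integration.integrable_bound)
      show "integrable lborel (\<lambda>y. B * indicator (ball c 3) y)"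
        by (intro integrable_mult_right integrable_real_indicator) (auto simp: emeasure_ball_plane)
      show "AE y in lborel. norm (f1 y) \<le> norm (B * indicator (ball c 3) y)"
        using fb by (auto simp: f1_def abs_mult indicator_def intro: order_trans[OF _ abs_ge_self])
    qed simp
    have f1sq: "(LBINT y. (f1 y)\<^sup>2) \<le> 9 * pi * B\<^sup>2"
    proof -
      have "(LBINT y. (f1 y)\<^sup>2) \<le> (LBINT y. B\<^sup>2 * indicator (ball c 3) y)"
      proof (rule integral_mono_AE')
        show "integrable lborel (\<lambda>y. B\<^sup>2 * indicator (ball c 3) y)"
          by (intro integrable_mult_right integrable_real_indicator) (auto simp: emeasure_ball_plane)
        show "AE y in lborel. (f1 y)\<^sup>2 \<le> B\<^sup>2 * indicator (ball c 3) y"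
          using fb B by (intro AE_I2) (auto simp: f1_def indicator_def intro: abs_le_square_iff[THEN iffD1] power2_le_iff_abs_le[THEN iffD2])
      qed auto
      also have "\<dots> = B\<^sup>2 * measure lborel (ball c 3)" by simp
      also have "\<dots> = 9 * pi * B\<^sup>2" using emeasure_ball_plane[of 3 c] by (simp add: measure_def)
      finally show ?thesis .
    qed
    have near: "ball_sq c (\<lambda>x. kconv (highK M) f1 x $ i) \<le> ennreal (A\<^sup>2 * (9 * pi * B\<^sup>2))" for i
    proof -
      define g where "g x = (LBINT y. highK M (x - y) $ i * f1 y)" for x
      have P: "integrable lborel (\<lambda>x. (g x)\<^sup>2)" "(LBINT x. (g x)\<^sup>2) \<le> A\<^sup>2 * (LBINT x. (f1 x)\<^sup>2)"
        unfolding g_def by (rule Plancherel_le[OF kernel_nth[OF kernel_highK] f1i f1b A(2)])+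
      have "kconv (highK M) f1 x $ i = g x" for x
      proof -
        have "kconv (highK M) f1 x $ i = (LBINT y. (f1 (x - y) *\<^sub>R highK M y) $ i)"
          unfolding kconv_def by (rule integral_bounded_linear[symmetric, OF bounded_linear_vec_nth kconv_integrable[OF ki f1m f1b]])
        also have "\<dots> = g x"
          unfolding g_def using integral_lborel_reflect[of "\<lambda>y. highK M (x - y) $ i * f1 y" x] by (simp add: mult.commute)
        finally show ?thesis .
      qed
      then have "ball_sq c (\<lambda>x. kconv (highK M) f1 x $ i) \<le> (\<integral>\<^sup>+x. ennreal ((g x)\<^sup>2) \<partial>lborel)"
        unfolding ball_sq_def by (intro nn_integral_mono) (auto split: split_indicator)
      also have "\<dots> = ennreal (LBINT x. (g x)\<^sup>2)" using P(1) by (intro nn_integral_eq_integral) auto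
      also have "\<dots> \<le> ennreal (A\<^sup>2 * (9 * pi * B\<^sup>2))"
        using P(2) mult_left_mono[OF f1sq, of "A\<^sup>2"] by (intro ennreal_leI) auto
      finally show ?thesis .
    qed
    have kcm: "kconv (highK M) f1 \<in> borel_measurable borel" "kconv (highK M) f2 \<in> borel_measurable borel"
      unfolding kconv_def[abs_def] by measurable
    have n1: "ball_sq c (kconv (highK M) f1) \<le> ennreal (2 * (A\<^sup>2 * (9 * pi * B\<^sup>2)) + 2 * (A\<^sup>2 * (9 * pi * B\<^sup>2)))"
    proof -
      have [measurable]: "kconv (highK M) f1 \<in> borel_measurable borel" by (rule kcm)
      have e: "kconv (highK M) f1 x = (kconv (highK M) f1 x $ 1) *\<^sub>R axis 1 1 + (kconv (highK M) f1 x $ 2) *\<^sub>R axis 2 1" for x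
        by (simp add: vec_eq_iff forall_2 axis_def)
      have na: "ball_sq c (\<lambda>x. (kconv (highK M) f1 x $ i) *\<^sub>R axis i (1::real) :: real^2) \<le> ennreal (A\<^sup>2 * (9 * pi * B\<^sup>2))" for i
        using near[of i] by (simp add: ball_sq_def)
      have ma: "(\<lambda>x. (kconv (highK M) f1 x $ i) *\<^sub>R axis i (1::real) :: real^2) \<in> borel_measurable borel" for i
        by (intro borel_measurable_scaleR borel_measurable_const
            measurable_compose[OF kcm(1) borel_measurable_continuous_onI[OF linear_continuous_on[OF bounded_linear_vec_nth]]])
      have "ball_sq c (\<lambda>x. (kconv (highK M) f1 x $ 1) *\<^sub>R axis 1 1 + (kconv (highK M) f1 x $ 2) *\<^sub>R axis 2 1 :: real^2)
         \<le> ennreal (2 * (A\<^sup>2 * (9 * pi * B\<^sup>2)) + 2 * (A\<^sup>2 * (9 * pi * B\<^sup>2)))"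
        by (rule ball_sq_add[OF ma ma na na]) simp_all
      then show ?thesis unfolding e[symmetric] .
    qed
    have n2: "ball_sq c (kconv (highK M) f2) \<le> ennreal (pi * (F * B)\<^sup>2)"
    proof (rule ball_sq_bounded)
      fix x assume x: "x \<in> ball c 1"
      have "norm (kconv (highK M) f2 x) \<le> (LBINT y. norm (f2 (x - y) *\<^sub>R highK M y))"
        unfolding kconv_def by (rule integral_norm_bound)
      also have "\<dots> \<le> (LBINT y::real^2. B * (C / (1 + norm y) ^ 3))"
      proof (rule integral_mono)
        show "integrable lborel (\<lambda>y. norm (f2 (x - y) *\<^sub>R highK M y))" by (intro integrable_norm kconv_integrable[OF ki f2m f2b])
        show "integrable lborel (\<lambda>y::real^2. B * (C / (1 + norm y) ^ 3))" by (intro integrable_mult_right kernel_integrable kernel_inverse_cube)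
        fix y
        show "norm (f2 (x - y) *\<^sub>R highK M y) \<le> B * (C / (1 + norm y) ^ 3)"
        proof (cases "1 \<le> norm y")
          case True
          then show ?thesis using mult_mono[OF f2b[of "x - y"] C(2)[OF True, of M]] B by simp
        next
          case False
          have "dist c (x - y) \<le> dist c x + norm y" using norm_triangle_ineq[of "c - x" y] by (simp add: dist_norm algebra_simps)
          then have "x - y \<in> ball c 3" using x False by auto
          then show ?thesis using B C(1) by (simp add: f2_def)
        qed
      qed
      also have "\<dots> = B * F" unfolding F_def by (rule integral_mult_right_zero)
      also have "\<dots> = F * B" by (rule mult.commute)
      finally show "norm (kconv (highK M) f2 x) \<le> F * B" .
    qed (use F0 B in simp)
    have "kconv (highK M) f = (\<lambda>x. kconv (highK M) f1 x + kconv (highK M) f2 x)" by (rule ext) (rule split)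
    then have "ball_sq c (kconv (highK M) f) = ball_sq c (\<lambda>x. kconv (highK M) f1 x + kconv (highK M) f2 x)" by (rule arg_cong)
    also have "\<dots> \<le> ennreal (2 * (2 * (A\<^sup>2 * (9 * pi * B\<^sup>2)) + 2 * (A\<^sup>2 * (9 * pi * B\<^sup>2))) + 2 * (pi * (F * B)\<^sup>2))"
      by (rule ball_sq_add[OF kcm n1 n2]) simp_all
    also have "\<dots> = ennreal ((sqrt Q * B)\<^sup>2)"
      using Q0 by (simp add: power_mult_distrib) (simp add: Q_def algebra_simps)
    finally show "ball_sq c (kconv (highK M) f) \<le> ennreal ((sqrt Q * B)\<^sup>2)" .
  qed
  then show ?thesis using that[of "sqrt Q"] Q0 by simp
qed

end

lemma ul_le_pointwise_limit:
  fixes f :: "nat \<Rightarrow> real^2 \<Rightarrow> 'b::{banach,second_countable_topology}"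
  assumes f: "\<And>n. ul_le (f n) a" and lim: "\<And>x. (\<lambda>n. f n x) \<longlonglongrightarrow> g x" and b: "\<And>n x. norm (f n x) \<le> B"
  shows "ul_le g a"
  unfolding ul_le_def
proof (intro conjI allI)
  have fm: "f n \<in> borel_measurable borel" for n using f unfolding ul_le_def by blast
  note [measurable] = fm
  show gm[measurable]: "g \<in> borel_measurable borel"
    by (rule borel_measurable_LIMSEQ_metric[of f]) (auto simp: fm lim)
  show "0 \<le> a" using f unfolding ul_le_def by blast
  fix c
  have B: "0 \<le> B" using order_trans[OF norm_ge_zero b] by blast
  have "(\<lambda>n. ball_sq c (f n)) \<longlonglongrightarrow> ball_sq c g"
    unfolding ball_sq_def
  proof (rule nn_integral_dominated_convergence[where w="\<lambda>y. ennreal (B\<^sup>2) * indicator (ball c 1) y"])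
    show "(\<integral>\<^sup>+y. ennreal (B\<^sup>2) * indicator (ball c 1) y \<partial>lborel) < \<infinity>"
      by (simp add: nn_integral_cmult_indicator emeasure_ball_plane ennreal_mult_less_top)
    show "AE y in lborel. ennreal ((norm (f n y))\<^sup>2) * indicator (ball c 1) y \<le> ennreal (B\<^sup>2) * indicator (ball c 1) y" for n
      using b by (intro AE_I2) (auto split: split_indicator intro!: ennreal_leI power_mono)
    show "AE y in lborel. (\<lambda>n. ennreal ((norm (f n y))\<^sup>2) * indicator (ball c 1) y) \<longlonglongrightarrow> ennreal ((norm (g y))\<^sup>2) * indicator (ball c 1) y"
    proof (rule AE_I2)
      fix y
      have "(\<lambda>n. ennreal ((norm (f n y))\<^sup>2)) \<longlonglongrightarrow> ennreal ((norm (g y))\<^sup>2)"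
        by (intro tendsto_ennrealI tendsto_power tendsto_norm lim)
      then show "(\<lambda>n. ennreal ((norm (f n y))\<^sup>2) * indicator (ball c 1) y) \<longlonglongrightarrow> ennreal ((norm (g y))\<^sup>2) * indicator (ball c 1) y"
        by (cases "y \<in> ball c 1") simp_all
    qed
  qed measurable
  then show "ball_sq c g \<le> ennreal (a\<^sup>2)"
    by (rule LIMSEQ_le_const2) (use f in \<open>auto simp: ul_le_def\<close>)
qed

text \<open>By the constitutive law the truncated kernel applied to the scalar telescopes to a
  difference of low-pass velocities. It converges pointwise, and its bound, uniform in
  \<open>M\<close>, passes to the limit.\<close>

lemma (in solution) ul_le_high_frequency:
  assumes t: "t \<in> {0..T}" and B: "\<And>x. \<bar>\<theta> t x\<bar> \<le> B"
    and C: "\<And>M f B. f \<in> borel_measurable borel \<Longrightarrow> (\<And>x. \<bar>f x\<bar> \<le> B) \<Longrightarrow> ul_le (kconv (highK M) f) (C * B)"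
  shows "ul_le (\<lambda>x. u t x - lowpass 0 (u t) x) (C * B)"
proof (rule ul_le_pointwise_limit)
  note uc = u_continuous[OF t] Mu(2)[OF t]
  have e: "kconv (highK M) (\<theta> t) x = lowpass (int M + 0) (u t) x - lowpass 0 (u t) x" for M x
  proof (induction M)
    case 0 show ?case by (simp add: kconv_def highK_def)
  next
    case (Suc M)
    have "highK (Suc M) = (\<lambda>x. highK M x + mollK (dilate \<phi> (int M)) x)" by (simp add: highK_def fun_eq_iff)
    then have "kconv (highK (Suc M)) (\<theta> t) x = kconv (highK M) (\<theta> t) x + kconv (mollK (dilate \<phi> (int M))) (\<theta> t) x"
      using kconv_add_kernel[OF kernel_integrable[OF kernel_highK] kernel_integrable[OF kernel_mollK_dilate_\<phi>] \<theta>_measurable[OF t] M\<theta>(2)[OF t]] by simp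
    moreover have "lowpass (int (Suc M) + 0) (u t) x = lowpass (int M) (u t) x + kconv (mollK (dilate \<phi> (int M))) (\<theta> t) x"
      using lowpass_Suc[OF uc, of "int M" x] hom_law_t[OF t] by (simp add: add.commute)
    ultimately show ?case using Suc by simp
  qed
  show "ul_le (kconv (highK M) (\<theta> t)) (C * B)" for M by (rule C[OF \<theta>_measurable[OF t] B])
  show "(\<lambda>M. kconv (highK M) (\<theta> t) x) \<longlonglongrightarrow> u t x - lowpass 0 (u t) x" for x
    unfolding e by (intro tendsto_diff tendsto_const lowpass_tendsto[OF uc])
  show "norm (kconv (highK M) (\<theta> t) x) \<le> Mu * (LBINT y. \<bar>chis 0 y\<bar>) + Mu * (LBINT y. \<bar>chis 0 y\<bar>)" for M x
    unfolding e by (rule order_trans[OF norm_triangle_ineq4 add_mono[OF lowpass_le[OF uc] lowpass_le[OF uc]]])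
qed


section \<open>The estimate in uniformly local spaces\<close>

context LP
begin

text \<open>The factors 4 in \<open>K1\<close> and \<open>K2\<close> anticipate
  \<open>ul_le_source\<close>: two nested uses of \<open>ul_le_add\<close>, respectively one such
  use and one of \<open>ul_le_bounded\<close>. The summand 1 makes \<open>K2\<close> strictly
  positive, as the weight in \<open>ul_le_integral_source\<close> must be.\<close>

definition K0 :: real where "K0 = (LBINT y. \<bar>chis 0 y\<bar>)"
definition K1 :: real where "K1 = 4 * (\<Sum>i\<in>UNIV. LBINT y. norm (mollK (pd i (chis 0)) y))"
definition K2 :: real where "K2 = 4 * (LBINT y. norm (mollLapK (chis 0) y)) + 1"

lemma K_nonneg: "0 \<le> K0" "0 \<le> K1" "0 < K2"
proof -
  have n: "0 \<le> (LBINT y. norm (F y))" for F :: "real^2 \<Rightarrow> real^2" by (intro Bochner_Integration.integral_nonneg) auto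
  show "0 < K2" unfolding K2_def using n[of "mollLapK (chis 0)"] by linarith
  show "0 \<le> K1" unfolding K1_def using n by (intro mult_nonneg_nonneg sum_nonneg) auto
  show "0 \<le> K0" unfolding K0_def by (intro Bochner_Integration.integral_nonneg) auto
qed

end

context solution
begin

text \<open>The curve driven by \<open>Uinf\<close>. Seen from it, the flux is \<theta> times a
  component of \<open>urel\<close>, so \<open>Uinf\<close> no longer appears in the bound of the
  source.\<close>

definition frame :: "real \<Rightarrow> real^2" where "frame s = integral {0..s} Uinf"
definition urel :: "real \<Rightarrow> real^2 \<Rightarrow> real^2" where "urel t y = u t y - Uinf t"

lemma urel_measurable: "t \<in> {0..T} \<Longrightarrow> urel t \<in> borel_measurable borel"
  unfolding urel_def[abs_def] by (intro borel_measurable_continuous_onI continuous_intros u_continuous)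

lemma ul_le_kconv:
  assumes G: "kernel G" and f: "ul_le f D" "\<And>x. \<bar>f x\<bar> \<le> B"
  shows "ul_le (kconv G f) ((LBINT y. norm (G y)) * D)"
proof -
  have fm[measurable]: "f \<in> borel_measurable borel" using f unfolding ul_le_def by simp
  have Gi: "integrable lborel G" by (rule kernel_integrable[OF G])
  have [measurable]: "G \<in> borel_measurable borel" using Gi by auto
  show ?thesis
    unfolding kconv_def[abs_def]
  proof (rule ul_le_convolution[OF _ _ f(1)])
    show "integrable lborel (\<lambda>y. f (x - y) *\<^sub>R G y)" for x by (rule kconv_integrable[OF Gi fm f(2)])
    show "(\<lambda>x. LBINT y. f (x - y) *\<^sub>R G y) \<in> borel_measurable borel" by measurable
  qed (use Gi in \<open>auto simp: mult.commute\<close>)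
qed

lemma ul_le_lowpass:
  assumes f: "ul_le f D" "continuous_on UNIV f" "\<And>x. norm (f x) \<le> B"
  shows "ul_le (lowpass 0 f) (K0 * D)"
proof -
  have fm[measurable]: "f \<in> borel_measurable borel" using f unfolding ul_le_def by simp
  have [measurable]: "chis 0 \<in> borel_measurable borel" using chis_integrable by auto
  have e: "lowpass 0 f x = (LBINT y. chis 0 y *\<^sub>R f (x - y))" for x
    unfolding lowpass_def using integral_lborel_reflect[of "\<lambda>y. chis 0 (x - y) *\<^sub>R f y" x] by simp
  have i: "integrable lborel (\<lambda>y. chis 0 y *\<^sub>R f (x - y))" for x
    using kernel_conv_integrable[OF chis_integrable fm f(3), of 0 x] integrable_lborel_reflect[of "\<lambda>y. chis 0 (x - y) *\<^sub>R f y" x] by simp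
  show ?thesis
    unfolding e[abs_def] K0_def
  proof (rule ul_le_convolution[OF _ _ f(1)])
    show "(\<lambda>x. LBINT y. chis 0 y *\<^sub>R f (x - y)) \<in> borel_measurable borel" by measurable
  qed (use chis_integrable i in auto)
qed

section \<open>Self-improving bound in the moving frame\<close>

context
  fixes B :: real
  assumes B: "0 < B" "\<And>t x. t \<in> {0..T} \<Longrightarrow> \<bar>\<theta> t x\<bar> \<le> B"
begin

lemma ul_le_source:
  assumes s: "s \<in> {0..T}" and D: "ul_le (urel s) D"
  shows "ul_le (\<lambda>x. source 0 Uinf frame s x) (K1 * B * D + K2 * \<nu> * B)"
proof -
  have D0: "0 \<le> D" using D unfolding ul_le_def by simp
  let ?k = "\<lambda>i. LBINT y. norm (mollK (pd i (chis 0)) y)"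
  let ?l = "LBINT y. norm (mollLapK (chis 0) y)"
  have fl: "ul_le (\<lambda>x. kconv (mollK (pd i (chis 0))) (flux Uinf i s) (x + frame s)) (?k i * (B * D))" for i
  proof -
    have "ul_le (flux Uinf i s) (B * D)"
    proof (rule ul_le_dominated[OF _ _ D])
      show "flux Uinf i s \<in> borel_measurable borel"
        by (intro borel_measurable_continuous_onI continuous_on_slice[OF flux_cont[OF Uinf_continuous] s])
      show "norm (flux Uinf i s x) \<le> B * norm (urel s x)" for x
        using B(2)[OF s, of x] component_le_norm_cart[of "u s x - Uinf s" i] B(1)
        unfolding flux_def urel_def by (auto simp: abs_mult intro!: mult_mono)
    qed (use B in simp)
    then have "ul_le (kconv (mollK (pd i (chis 0))) (flux Uinf i s)) (?k i * (B * D))"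
      by (rule ul_le_kconv[OF kernel_mollK_pd[OF schwartz_chis] _ flux_le[where U=Uinf, OF s order_refl]])
    from ul_le_translate[OF this, of "frame s"] show ?thesis by (simp add: add.commute)
  qed
  have l: "ul_le (\<lambda>x. - (\<nu> *\<^sub>R kconv (mollLapK (chis 0)) (\<theta> s) (x + frame s))) (2 * (\<nu> * (B * ?l)))"
  proof (rule ul_le_bounded)
    have "continuous_on UNIV (\<lambda>x. kconv (mollLapK (chis 0)) (\<theta> s) (x + frame s))"
      by (rule kconv_continuous_param[OF kernel_integrable[OF kernel_mollLapK[OF schwartz_chis]] \<theta>_cont, where tt="\<lambda>_. s" and B=B])
         (use s B in \<open>auto intro!: continuous_intros\<close>)
    then show "(\<lambda>x. - (\<nu> *\<^sub>R kconv (mollLapK (chis 0)) (\<theta> s) (x + frame s))) \<in> borel_measurable borel"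
      by (intro borel_measurable_continuous_onI continuous_intros)
    show "norm (- (\<nu> *\<^sub>R kconv (mollLapK (chis 0)) (\<theta> s) (x + frame s))) \<le> \<nu> * (B * ?l)" for x
      using \<nu> kconv_norm_le[OF kernel_integrable[OF kernel_mollLapK[OF schwartz_chis]] \<theta>_measurable[OF s] B(2)[OF s]]
      by (auto intro!: mult_left_mono)
  qed
  have "ul_le (\<lambda>x. (kconv (mollK (pd 1 (chis 0))) (flux Uinf 1 s) (x + frame s) + kconv (mollK (pd 2 (chis 0))) (flux Uinf 2 s) (x + frame s))
      + - (\<nu> *\<^sub>R kconv (mollLapK (chis 0)) (\<theta> s) (x + frame s))) (2 * (2 * (?k 1 * (B * D) + ?k 2 * (B * D)) + 2 * (\<nu> * (B * ?l))))"
    by (rule ul_le_add[OF ul_le_add[OF fl fl] l])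
  moreover have "2 * (2 * (?k 1 * (B * D) + ?k 2 * (B * D)) + 2 * (\<nu> * (B * ?l))) \<le> K1 * B * D + K2 * \<nu> * B"
    using mult_pos_pos[OF \<nu> B(1)] by (simp add: K1_def K2_def sum_2 algebra_simps)
  ultimately show ?thesis unfolding source_def sum_2 by (simp add: ul_le_mono)
qed

text \<open>In \<open>ball_sq_integral\<close> the majorant \<open>b\<close> itself serves as the
  weight. The quotient of the source by \<open>b\<close> then has norm at most 1 at each time, and
  the weight integrates to the claimed bound; the division is the reason for \<open>b\<close> to be
  positive.\<close>

lemma ul_le_integral_source:
  assumes t: "t \<in> {0..T}" and b: "continuous_on {0..t} b" "\<And>s. s \<in> {0..t} \<Longrightarrow> 0 < b s"
    and source: "\<And>s. s \<in> {0..t} \<Longrightarrow> ul_le (\<lambda>x. source 0 Uinf frame s x) (b s)"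
  shows "ul_le (\<lambda>x. LBINT s:{0..t}. source 0 Uinf frame s x) (integral {0..t} b)"
proof -
  note XU = Uinf_continuous frame_def
  have bi: "set_integrable lborel {0..t} b" by (rule borel_integrable_atLeastAtMost'[OF b(1)])
  have be: "(LBINT s. indicator {0..t} s * b s) = integral {0..t} b"
    using set_borel_integral_eq_integral(2)[OF bi] by (simp add: set_lebesgue_integral_def)
  have Jc: "continuous_on ({0..t} \<times> UNIV) (\<lambda>p. source 0 Uinf frame (fst p) (snd p))"
    using t by (intro continuous_on_subset[OF source_continuous2[OF XU]]) auto
  have "(\<lambda>p. indicator ({0..t} \<times> UNIV) p *\<^sub>R source 0 Uinf frame (fst p) (snd p)) \<in> borel_measurable borel"
    by (rule borel_measurable_continuous_on_indicator[OF _ Jc]) (auto intro!: borel_closed closed_Times)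
  then have "(\<lambda>(s, x). indicator {0..t} s *\<^sub>R source 0 Uinf frame s x) \<in> borel_measurable borel"
    by (simp add: case_prod_unfold indicator_times)
  then have Jm[measurable]: "(\<lambda>(s, x). indicator {0..t} s *\<^sub>R source 0 Uinf frame s x) \<in> borel_measurable (borel \<Otimes>\<^sub>M borel)"
    by (simp add: borel_prod)
  define b' where "b' s = indicator {0..t} s *\<^sub>R b s" for s
  have [measurable]: "b' \<in> borel_measurable borel" unfolding b'_def[abs_def]
    by (rule borel_measurable_continuous_on_indicator[OF _ b(1)]) simp
  let ?F = "\<lambda>s x. indicator {0..t} s *\<^sub>R source 0 Uinf frame s x"
  let ?H = "\<lambda>s x. norm (?F s x) / b' s"
  have int: "integrable lborel (\<lambda>s. ?F s x)" for x
    using source_integrable[OF XU t, of 0 x] by (simp add: set_integrable_def)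
  have b'0: "0 \<le> b' s" for s using b(2)[of s] by (auto simp: b'_def indicator_def less_imp_le)
  have N: "ball_sq c (\<lambda>x. LBINT s. ?F s x) \<le> ennreal (((LBINT s. b' s) * 1)\<^sup>2)" for c
  proof (rule ball_sq_integral[where H="?H"])
    show "integrable lborel b'" using bi by (simp add: set_integrable_def b'_def[abs_def])
    have "(\<lambda>z. norm (case z of (s, x) \<Rightarrow> ?F s x) / b' (fst z)) \<in> borel_measurable (borel \<Otimes>\<^sub>M borel)"
      by measurable
    then show "(\<lambda>(s, x). ?H s x) \<in> borel_measurable (lborel \<Otimes>\<^sub>M lborel)"
      by (simp add: case_prod_unfold cong: measurable_cong_sets)
    show "norm (?F s x) \<le> b' s * ?H s x" for s x
      using b(2)[of s] by (auto simp: b'_def indicator_def)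
    show "ball_sq c (?H s) \<le> ennreal (1\<^sup>2)" for s
    proof (cases "s \<in> {0..t}")
      case True
      have "ul_le (\<lambda>x. norm (source 0 Uinf frame s x) / b s) ((1 / b s) * b s)"
      proof (rule ul_le_dominated[OF _ _ source[OF True]])
        have "(\<lambda>x. source 0 Uinf frame s x) \<in> borel_measurable borel" using source[OF True] unfolding ul_le_def by simp
        then show "(\<lambda>x. norm (source 0 Uinf frame s x) / b s) \<in> borel_measurable borel" by measurable
      qed (use b(2)[OF True] in auto)
      then have "ball_sq c (\<lambda>x. norm (source 0 Uinf frame s x) / b s) \<le> ennreal (((1 / b s) * b s)\<^sup>2)" unfolding ul_le_def by blast
      then show ?thesis using b(2)[OF True] True by (simp add: b'_def)
    next
      case False then show ?thesis by (simp add: ball_sq_def)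
    qed
  qed (use b'0 int in auto)
  have "(\<lambda>x. LBINT s:{0..t}. source 0 Uinf frame s x) \<in> borel_measurable borel"
  proof -
    have "(\<lambda>x. LBINT s. (\<lambda>(s, x). ?F s x) (s, x)) \<in> borel_measurable borel" by measurable
    then show ?thesis by (simp add: set_lebesgue_integral_def)
  qed
  moreover have "0 \<le> integral {0..t} b"
    using b by (intro Henstock_Kurzweil_Integration.integral_nonneg integrable_continuous_real) (auto simp: less_imp_le)
  ultimately show ?thesis
    using N be unfolding ul_le_def by (simp add: set_lebesgue_integral_def b'_def)
qed

text \<open>In the frame driven by \<open>Uinf\<close> the balance identity expresses
  \<open>urel\<close> as high frequencies plus the low-pass initial velocity minus the integrated
  source. The assumed bound enters only through the source. Nested uses of \<open>ul_le_add\<close>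
  put a factor 4 on the first two terms and 2 on the third, whence \<open>Q\<close>.\<close>

lemma ul_le_urel_step:
  assumes C1: "0 \<le> C1" "\<And>M f B. f \<in> borel_measurable borel \<Longrightarrow> (\<And>x. \<bar>f x\<bar> \<le> B) \<Longrightarrow> ul_le (kconv (highK M) f) (C1 * B)"
    and m: "0 \<le> m" "\<And>s. s \<in> {0..T} \<Longrightarrow> ul_le (urel s) (m * exp ((4 * K1 + 1) * B * s))" and t: "t \<in> {0..T}"
  defines "Q \<equiv> 4 * C1 * B + 4 * K0 * L2ul_norm u0 + 2 * K2 * \<nu>"
  shows "ul_le (urel t) ((Q + m / 2) * exp ((4 * K1 + 1) * B * t))"
proof -
  \<comment> \<open>A rate of at least \<open>4 * K1\<close> makes the integral of the source's
    velocity part at most (m / 4) times the exponential, and the outer \<open>ul_le_add\<close>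
    doubles this to m / 2. The summand 1 ensures that \<open>B * t\<close> is below the exponential,
    which absorbs the linear growth of the viscous part.\<close>
  define \<Lambda> where "\<Lambda> = 4 * K1 + 1"
  have \<Lambda>: "0 < \<Lambda>" "4 * K1 \<le> \<Lambda>" "1 \<le> \<Lambda>" unfolding \<Lambda>_def using K_nonneg by auto
  note XU = Uinf_continuous frame_def
  define b where "b s = K1 * B * (m * exp (\<Lambda> * B * s)) + K2 * \<nu> * B" for s
  have bpos: "0 < b s" for s
    unfolding b_def using K_nonneg B(1) \<nu> m(1) by (intro add_nonneg_pos mult_nonneg_nonneg mult_pos_pos) auto
  have IJ: "ul_le (\<lambda>x. LBINT s:{0..t}. source 0 Uinf frame s x) (integral {0..t} b)"
  proof (rule ul_le_integral_source[OF t])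
    show "continuous_on {0..t} b" unfolding b_def by (intro continuous_intros)
    show "ul_le (\<lambda>x. source 0 Uinf frame s x) (b s)" if "s \<in> {0..t}" for s
      using ul_le_source[OF _ m(2)[of s]] that t unfolding b_def \<Lambda>_def by auto
  qed (rule bpos)
  have E1: "1 \<le> exp (\<Lambda> * B * t)" using t B(1) \<Lambda> by simp
  have ib: "integral {0..t} b \<le> (m / 4 + K2 * \<nu>) * exp (\<Lambda> * B * t)"
  proof -
    define P where "P s = (K1 * m / \<Lambda>) * exp (\<Lambda> * B * s) + K2 * \<nu> * B * s" for s
    have "(b has_integral P t - P 0) {0..t}"
    proof (rule fundamental_theorem_of_calculus)
      show "(P has_vector_derivative b s) (at s within {0..t})" for s
        unfolding P_def has_real_derivative_iff_has_vector_derivative[symmetric]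
        by (rule derivative_eq_intros refl | use \<Lambda> in \<open>simp add: b_def field_simps\<close>)+
    qed (use t in simp)
    then have "integral {0..t} b = P t - P 0" by (rule integral_unique)
    also have "\<dots> \<le> (K1 * m / \<Lambda>) * exp (\<Lambda> * B * t) + K2 * \<nu> * (B * t)"
      using K_nonneg m(1) \<Lambda> by (simp add: P_def mult.assoc)
    also have "\<dots> \<le> (m / 4) * exp (\<Lambda> * B * t) + K2 * \<nu> * exp (\<Lambda> * B * t)"
    proof (intro add_mono mult_right_mono mult_left_mono)
      have "4 * K1 * m \<le> \<Lambda> * m" using \<Lambda>(2) m(1) by (rule mult_right_mono)
      then show "K1 * m / \<Lambda> \<le> m / 4" using \<Lambda>(1) by (simp add: field_simps)
      have "B * t \<le> \<Lambda> * (B * t)" using \<Lambda>(3) B(1) t mult_right_mono[of 1 \<Lambda> "B * t"] by simp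
      also have "\<dots> \<le> exp (\<Lambda> * B * t)" using exp_ge_add_one_self[of "\<Lambda> * B * t"] unfolding mult.assoc by linarith
      finally show "B * t \<le> exp (\<Lambda> * B * t)" .
    qed (use K_nonneg \<nu> in auto)
    finally show ?thesis by (simp add: distrib_right)
  qed
  have u0: "ul_le u0 (L2ul_norm u0)"
    by (rule ul_le_L2ul_norm[OF borel_measurable_continuous_onI[OF u0_facts(1)] u0_facts(2)])
  have S: "ul_le (lowpass 0 u0) (K0 * L2ul_norm u0)" by (rule ul_le_lowpass[OF u0 u0_facts(1,2)])
  have R: "ul_le (\<lambda>x. u t (x + frame t) - lowpass 0 (u t) (x + frame t)) (C1 * B)"
    using ul_le_translate[OF ul_le_high_frequency[OF t B(2)[OF t] C1(2)], of "frame t"] by (simp add: add.commute)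
  have NJ: "ul_le (\<lambda>x. - (LBINT s:{0..t}. source 0 Uinf frame s x)) (1 * integral {0..t} b)"
    by (rule ul_le_dominated[OF _ _ IJ]) (use IJ in \<open>auto simp: ul_le_def\<close>)
  have "ul_le (\<lambda>x. ((u t (x + frame t) - lowpass 0 (u t) (x + frame t)) + lowpass 0 u0 x) + - (LBINT s:{0..t}. source 0 Uinf frame s x))
     (2 * (2 * (C1 * B + K0 * L2ul_norm u0) + 1 * integral {0..t} b))"
    by (rule ul_le_add[OF ul_le_add[OF R S] NJ])
  \<comment> \<open>Here \<open>Uinf t\<close>, the value of the balance, moves to the left-hand
    side and turns \<open>u\<close> into \<open>urel\<close>.\<close>
  moreover have "((u t (x + frame t) - lowpass 0 (u t) (x + frame t)) + lowpass 0 u0 x) + - (LBINT s:{0..t}. source 0 Uinf frame s x) = urel t (x + frame t)" for x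
    using balance_eq_Uinf[OF XU t, of 0 x] unfolding balance_def urel_def by (simp add: algebra_simps)
  ultimately have "ul_le (\<lambda>x. urel t (x + frame t)) (2 * (2 * (C1 * B + K0 * L2ul_norm u0) + 1 * integral {0..t} b))" by simp
  moreover have "2 * (2 * (C1 * B + K0 * L2ul_norm u0) + 1 * integral {0..t} b) \<le> (Q + m / 2) * exp (\<Lambda> * B * t)"
  proof -
    have "0 \<le> L2ul_norm u0" using u0 unfolding ul_le_def by simp
    then have "0 \<le> 4 * C1 * B + 4 * K0 * L2ul_norm u0" using C1(1) B(1) K_nonneg by simp
    then have "(4 * C1 * B + 4 * K0 * L2ul_norm u0) * 1 \<le> (4 * C1 * B + 4 * K0 * L2ul_norm u0) * exp (\<Lambda> * B * t)"
      using E1 by (intro mult_left_mono)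
    then show ?thesis using ib unfolding Q_def by (simp add: algebra_simps)
  qed
  ultimately have "ul_le (\<lambda>x. urel t (x + frame t)) ((Q + m / 2) * exp (\<Lambda> * B * t))" by (rule ul_le_mono)
  from ul_le_translate[OF this, of "- frame t"] show ?thesis by (simp add: \<Lambda>_def)
qed

text \<open>The step maps a prefactor m to Q + m/2, whose fixed point is 2 Q. Starting from the
  qualitative bound \<open>r\<close>, n steps leave 2 Q + r / 2^n, so \<open>r\<close> disappears in
  the limit. Adding \<open>Uinf\<close> back turns 2 Q into 4 Q and contributes four times its norm;
  this gives the summands 16, 16, 8 and 4 of \<open>C\<close>, and the last summand dominates the
  exponential rate.\<close>

lemma ul_le_u:
  assumes C1: "0 \<le> C1" "\<And>M f B. f \<in> borel_measurable borel \<Longrightarrow> (\<And>x. \<bar>f x\<bar> \<le> B) \<Longrightarrow> ul_le (kconv (highK M) f) (C1 * B)"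
    and t: "t \<in> {0..T}"
  defines "C \<equiv> 16 * C1 + 16 * K0 + 8 * K2 + 4 + (4 * K1 + 1)"
  shows "ul_le (u t) (C * (L2ul_norm u0 + B + norm (Uinf t) + \<nu>) * exp (C * t * B))"
proof -
  let ?\<Lambda> = "4 * K1 + 1"
  define Q where "Q = 4 * C1 * B + 4 * K0 * L2ul_norm u0 + 2 * K2 * \<nu>"
  have V0: "0 \<le> L2ul_norm u0"
    using ul_le_L2ul_norm[OF borel_measurable_continuous_onI[OF u0_facts(1)] u0_facts(2)] unfolding ul_le_def by simp
  have Q0: "0 \<le> Q" unfolding Q_def using C1(1) B(1) K_nonneg V0 \<nu> by simp
  obtain b where b: "\<And>s. s \<in> {0..T} \<Longrightarrow> norm (Uinf s) \<le> b" "b \<ge> 0"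
    using U_bounded[OF Uinf_continuous frame_def] by blast
  define r where "r = 2 * (Mu + b)"
  have r0: "0 \<le> r" unfolding r_def using Mu(1) b(2) by simp
  have it: "\<forall>s\<in>{0..T}. ul_le (urel s) ((2 * Q + r / 2 ^ n) * exp (?\<Lambda> * B * s))" for n
  proof (induction n)
    case 0
    show ?case
    proof
      fix s assume s: "s \<in> {0..T}"
      have "norm (urel s x) \<le> Mu + b" for x
        using norm_triangle_ineq4[of "u s x" "Uinf s"] Mu(2)[OF s, of x] b(1)[OF s] unfolding urel_def by linarith
      from ul_le_bounded[OF urel_measurable[OF s] this] have "ul_le (urel s) r" unfolding r_def .
      moreover have "1 \<le> exp (?\<Lambda> * B * s)" using s B(1) K_nonneg by simp
      then have "r * 1 \<le> (2 * Q + r) * exp (?\<Lambda> * B * s)" using r0 Q0 by (intro mult_mono) auto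
      ultimately show "ul_le (urel s) ((2 * Q + r / 2 ^ 0) * exp (?\<Lambda> * B * s))" by (auto elim: ul_le_mono)
    qed
  next
    case (Suc n)
    show ?case
    proof
      fix s assume s: "s \<in> {0..T}"
      have "ul_le (urel s) ((Q + (2 * Q + r / 2 ^ n) / 2) * exp (?\<Lambda> * B * s))"
        unfolding Q_def by (rule ul_le_urel_step[OF C1 _ _ s]) (use Suc Q0 r0 in \<open>auto simp: Q_def\<close>)
      moreover have "Q + (2 * Q + r / 2 ^ n) / 2 = 2 * Q + r / 2 ^ Suc n" by (simp add: field_simps)
      ultimately show "ul_le (urel s) ((2 * Q + r / 2 ^ Suc n) * exp (?\<Lambda> * B * s))" by simp
    qed
  qed
  have "ul_le (urel t) ((2 * Q + r * 0) * exp (?\<Lambda> * B * t))"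
  proof (rule ul_le_LIMSEQ)
    show "ul_le (urel t) ((2 * Q + r * (1 / 2) ^ n) * exp (?\<Lambda> * B * t))" for n
      using it[of n] t by (auto simp: power_divide)
    show "(\<lambda>n. (2 * Q + r * (1 / 2) ^ n) * exp (?\<Lambda> * B * t)) \<longlonglongrightarrow> (2 * Q + r * 0) * exp (?\<Lambda> * B * t)"
      by (intro tendsto_intros LIMSEQ_power_zero) simp
  qed
  moreover have "ul_le (\<lambda>_. Uinf t) (2 * norm (Uinf t))" by (rule ul_le_bounded) auto
  ultimately have "ul_le (\<lambda>x. urel t x + Uinf t) (2 * ((2 * Q + r * 0) * exp (?\<Lambda> * B * t) + 2 * norm (Uinf t)))" by (rule ul_le_add)
  then have "ul_le (u t) (2 * ((2 * Q + r * 0) * exp (?\<Lambda> * B * t) + 2 * norm (Uinf t)))" unfolding urel_def by simp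
  moreover have "2 * ((2 * Q + r * 0) * exp (?\<Lambda> * B * t) + 2 * norm (Uinf t)) \<le> C * (L2ul_norm u0 + B + norm (Uinf t) + \<nu>) * exp (C * t * B)"
  proof -
    let ?n = "norm (Uinf t)"
    have C: "16 * C1 \<le> C" "16 * K0 \<le> C" "8 * K2 \<le> C" "4 \<le> C" "?\<Lambda> \<le> C"
      unfolding C_def using C1(1) K_nonneg by auto
    have "?\<Lambda> * (B * t) \<le> C * (B * t)" using C(5) B(1) t by (intro mult_right_mono) auto
    then have E: "exp (?\<Lambda> * B * t) \<le> exp (C * t * B)" by (simp add: mult_ac)
    have E1: "1 \<le> exp (C * t * B)" using C(4) B(1) t by simp
    have "16 * C1 * B \<le> C * B" "16 * K0 * L2ul_norm u0 \<le> C * L2ul_norm u0" "8 * K2 * \<nu> \<le> C * \<nu>" "4 * ?n \<le> C * ?n"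
      using C B(1) V0 \<nu> by (auto intro!: mult_right_mono)
    then have s: "4 * Q + 4 * ?n \<le> C * (L2ul_norm u0 + B + ?n + \<nu>)" unfolding Q_def by (simp add: algebra_simps)
    have "2 * ((2 * Q + r * 0) * exp (?\<Lambda> * B * t) + 2 * ?n) = 4 * Q * exp (?\<Lambda> * B * t) + 4 * ?n" by simp
    also have "\<dots> \<le> 4 * Q * exp (C * t * B) + 4 * ?n * exp (C * t * B)"
      using E E1 Q0 mult_left_mono[OF E1, of "4 * ?n"] by (intro add_mono mult_left_mono) auto
    also have "\<dots> = (4 * Q + 4 * ?n) * exp (C * t * B)" by (simp only: distrib_right)
    also have "\<dots> \<le> C * (L2ul_norm u0 + B + ?n + \<nu>) * exp (C * t * B)" using s by (intro mult_right_mono) auto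
    finally show ?thesis .
  qed
  ultimately show ?thesis by (rule ul_le_mono)
qed

end

text \<open>The previous estimate asks for a strictly positive bound on the scalar. It is applied to
  the maximum norm plus 1/(n + 1) and passes to the limit, which includes the case of vanishing
  initial data.\<close>

lemma L2ul_estimate:
  assumes C1: "0 \<le> C1" "\<And>M f B. f \<in> borel_measurable borel \<Longrightarrow> (\<And>x. \<bar>f x\<bar> \<le> B) \<Longrightarrow> ul_le (kconv (highK M) f) (C1 * B)"
    and t: "t \<in> {0..T}"
  defines "C \<equiv> 16 * C1 + 16 * K0 + 8 * K2 + 4 + (4 * K1 + 1)"
  shows "L2ul_norm (u t) \<le> C * (L2ul_norm u0 + Linf_norm \<theta>0 + norm (Uinf t) + \<nu>) * exp (C * t * Linf_norm \<theta>0)"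
proof (rule L2ul_norm_le, rule ul_le_LIMSEQ)
  let ?B = "\<lambda>n. Linf_norm \<theta>0 + 1 / real (Suc n)"
  have \<theta>B: "\<bar>\<theta> s x\<bar> \<le> Linf_norm \<theta>0" if "s \<in> {0..T}" for s x
    using order_trans[OF Linf_norm_continuous(1)[OF \<theta>_continuous[OF that], of M\<theta> x] max_principle[rule_format, OF that]]
      M\<theta>(2)[OF that] by simp
  have nn: "0 \<le> Linf_norm \<theta>0" using order_trans[OF abs_ge_zero \<theta>B[of 0 0]] T by simp
  show "ul_le (u t) (C * (L2ul_norm u0 + ?B n + norm (Uinf t) + \<nu>) * exp (C * t * ?B n))" for n
    unfolding C_def
  proof (rule ul_le_u[OF _ _ C1 t])
    show "0 < ?B n" using nn by (intro add_nonneg_pos) auto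
    show "\<bar>\<theta> s x\<bar> \<le> ?B n" if "s \<in> {0..T}" for s x
      using \<theta>B[OF that, of x] by (rule order_trans) simp
  qed
  have "?B \<longlonglongrightarrow> Linf_norm \<theta>0 + 0"
    using LIMSEQ_inverse_real_of_nat by (intro tendsto_intros) (simp add: inverse_eq_divide)
  then show "(\<lambda>n. C * (L2ul_norm u0 + ?B n + norm (Uinf t) + \<nu>) * exp (C * t * ?B n)) \<longlonglongrightarrow>
    C * (L2ul_norm u0 + Linf_norm \<theta>0 + norm (Uinf t) + \<nu>) * exp (C * t * Linf_norm \<theta>0)"
    by (intro tendsto_intros) simp_all
qed

end

theorem theorem4p1:
  fixes chi \<phi> :: "real^2 \<Rightarrow> real" and chis :: "int \<Rightarrow> real^2 \<Rightarrow> real" and k :: nat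
  assumes "littlewood_paley chi \<phi> chis" and "k \<ge> 2"
  shows "\<exists>C>0. \<forall>\<nu>>0. \<forall>T>0. \<forall>\<theta>0 u0 \<theta> u.
    smooth_nondecaying_solution \<phi> k \<nu> T \<theta>0 u0 \<theta> u \<longrightarrow>
    (\<exists>Uinf :: real \<Rightarrow> real^2. continuous_on {0..T} Uinf \<and> Uinf 0 = 0 \<and>
      (\<forall>N. \<forall>t\<in>{0..T}. \<exists>HNK. is_HN_conv \<phi> N (\<lambda>y. \<theta> t y - \<theta>0 y) HNK \<and>
        (\<forall>x. u t x - u0 x =
          Uinf t
          - (LBINT s:{0..t}. SN_gradK_conv (chis N) (\<lambda>y. \<theta> s y *\<^sub>R u s y) x
                             - \<nu> *\<^sub>R SN_lapK_conv (chis N) (\<theta> s) x)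
          + HNK x)) \<and>
      (\<forall>t\<in>{0..T}. L2ul_norm (u t) \<le>
        C * (L2ul_norm u0 + Linf_norm \<theta>0 + norm (Uinf t) + \<nu>) * exp (C * t * Linf_norm \<theta>0)))"
proof -
  interpret LP chi \<phi> chis by standard (rule assms(1))
  obtain C1 where C1: "0 \<le> C1"
    "\<And>M f B. f \<in> borel_measurable borel \<Longrightarrow> (\<And>x. \<bar>f x\<bar> \<le> B) \<Longrightarrow> ul_le (kconv (highK M) f) (C1 * B)"
    using ul_le_highK by blast
  \<comment> \<open>All ingredients are built from the Littlewood-Paley functions alone, before
    \<nu>, the time and the solution are chosen; this gives the uniformity of the constant.\<close>
  define C where "C = 16 * C1 + 16 * K0 + 8 * K2 + 4 + (4 * K1 + 1)"
  have "C > 0" unfolding C_def using C1(1) K_nonneg by simp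
  show ?thesis
  proof (intro exI[of _ C] conjI \<open>C > 0\<close> allI impI)
    fix \<nu> T :: real and \<theta>0 u0 \<theta> u
    assume "0 < \<nu>" "0 < T" and sol: "smooth_nondecaying_solution \<phi> k \<nu> T \<theta>0 u0 \<theta> u"
    then interpret S: solution chi \<phi> chis k \<nu> T \<theta>0 u0 \<theta> u
      by unfold_locales (use assms in auto)
    show "\<exists>Uinf :: real \<Rightarrow> real^2. continuous_on {0..T} Uinf \<and> Uinf 0 = 0 \<and>
      (\<forall>N. \<forall>t\<in>{0..T}. \<exists>HNK. is_HN_conv \<phi> N (\<lambda>y. \<theta> t y - \<theta>0 y) HNK \<and>
        (\<forall>x. u t x - u0 x =
          Uinf t
          - (LBINT s:{0..t}. SN_gradK_conv (chis N) (\<lambda>y. \<theta> s y *\<^sub>R u s y) x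
                             - \<nu> *\<^sub>R SN_lapK_conv (chis N) (\<theta> s) x)
          + HNK x)) \<and>
      (\<forall>t\<in>{0..T}. L2ul_norm (u t) \<le>
        C * (L2ul_norm u0 + Linf_norm \<theta>0 + norm (Uinf t) + \<nu>) * exp (C * t * Linf_norm \<theta>0))"
      using S.Uinf_continuous S.Uinf_0 S.representation S.L2ul_estimate[OF C1]
      unfolding C_def by (intro exI[of _ S.Uinf] conjI allI ballI) blast+
  qed
qed


end
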